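(* The generating series of planar rooted pointed quadrangulations satisfies $$\overrightarrow{Q_0}^{\bullet}(z)=2T(z),$$ and the number $\vec q_{0,n}$ of planar rooted quadrangulations with $n$ faces is $$\vec q_{0,n}=\frac{\vec q^{\;\bullet}_{0,n}}{n+2}=\frac{2}{n+2}\cdot\frac{3^n}{n+1}\binom{2n}{n}.$$
   Context: A planar map is an embedding (without edge crossings; loops and multiple edges allowed) of a graph in the sphere, all of whose faces are homeomorphic to discs, considered up to orientation-preserving homeomorphisms (carrying roots and basepoints). A rooted map has a distinguished arc (oriented edge). A planar quadrangulation is a planar map with all faces of degree 4 (an edge with the same face on both sides counts twice for the degree of that face). A rooted pointed quadrangulation has, in addition to its root, a distinguished vertex (basepoint) chosen independently of the root. $\vec q^{\;\bullet}_{0,n}$ is the number of rooted pointed planar quadrangulations with $n$ faces and $\overrightarrow{Q_0}^{\bullet}(z)=\sum_{n\ge0}\vec q^{\;\bullet}_{0,n}z^n$, with the convention $\vec q_{0,0}=1$, $\vec q^{\;\bullet}_{0,0}=2$. $T(z)$ is the generating series, by number of edges, of rooted embedded plane trees: rooted planar maps with one face (the single-vertex tree being counted once, with no edge) whose vertices have integer labels differing by at most one along every edge, the root vertex having label $1$. It is the formal power series satisfying $T=1+3zT^2$, i.e. $T(z)=\frac{1-\sqrt{1-12z}}{6z}$. *)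

theory Defs
  imports
    Complex_Main
    "HOL-Combinatorics.Orbits"
    "HOL-Computational_Algebra.Formal_Power_Series"
begin

text \<open>
  An embedding of a connected graph with at least one edge into an oriented closed surface, with
  all faces homeomorphic to discs, is recorded by its arcs (darts), the counterclockwise rotation
  of the arcs around their origins, and the reversal of arcs. Orientation-preserving
  homeomorphisms of embeddings correspond to bijections of the darts that commute with both
  permutations.
\<close>

record 'd cmap =
  darts :: "'d set"
  rot :: "'d \<Rightarrow> 'd"
  opp :: "'d \<Rightarrow> 'd"

definition connected_darts :: "'d cmap \<Rightarrow> bool" where
  "connected_darts M \<longleftrightarrow>
     (\<forall>d\<in>darts M. \<forall>e\<in>darts M.
        (d, e) \<in> ({(x, rot M x) |x. x \<in> darts M} \<union> {(x, opp M x) |x. x \<in> darts M})\<^sup>*)"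

definition cmap :: "'d cmap \<Rightarrow> bool" where
  "cmap M \<longleftrightarrow>
     finite (darts M) \<and> darts M \<noteq> {} \<and>
     rot M permutes darts M \<and> opp M permutes darts M \<and>
     (\<forall>d\<in>darts M. opp M d \<noteq> d \<and> opp M (opp M d) = d) \<and>
     connected_darts M"

text \<open>A vertex is identified with the set of arcs leaving it.\<close>

definition vertex_of :: "'d cmap \<Rightarrow> 'd \<Rightarrow> 'd set" where
  "vertex_of M d = orbit (rot M) d"

definition vertices :: "'d cmap \<Rightarrow> 'd set set" where
  "vertices M = vertex_of M ` darts M"

definition edges :: "'d cmap \<Rightarrow> 'd set set" where
  "edges M = (\<lambda>d. {d, opp M d}) ` darts M"

text \<open>
  A face is identified with the set of arcs that have it on their right. An edge with the same
  face on both sides contributes both of its arcs, so the degree of a face is its cardinality.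
\<close>

definition faces :: "'d cmap \<Rightarrow> 'd set set" where
  "faces M = orbit (rot M \<circ> opp M) ` darts M"

text \<open>The underlying surface is the sphere iff its Euler characteristic is 2.\<close>

definition planar_map :: "'d cmap \<Rightarrow> bool" where
  "planar_map M \<longleftrightarrow>
     cmap M \<and> int (card (vertices M)) - int (card (edges M)) + int (card (faces M)) = 2"

definition cmap_iso :: "('d \<Rightarrow> 'e) \<Rightarrow> 'd cmap \<Rightarrow> 'e cmap \<Rightarrow> bool" where
  "cmap_iso f M N \<longleftrightarrow>
     bij_betw f (darts M) (darts N) \<and>
     (\<forall>d\<in>darts M. f (rot M d) = rot N (f d) \<and> f (opp M d) = opp N (f d))"

definition quadrangulation :: "'d cmap \<Rightarrow> bool" where
  "quadrangulation M \<longleftrightarrow> planar_map M \<and> (\<forall>F\<in>faces M. card F = 4)"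


text \<open>
  Counting is up to isomorphism; since all maps are finite, it suffices to consider maps whose
  darts are natural numbers. A rooted map is a pair of a map and its root arc.
\<close>

definition rooted_quads :: "nat \<Rightarrow> (nat cmap \<times> nat) set" where
  "rooted_quads n =
     {(M, r). quadrangulation M \<and> card (faces M) = n \<and> r \<in> darts M}"

definition rooted_iso :: "(('d cmap \<times> 'd) \<times> ('d cmap \<times> 'd)) set" where
  "rooted_iso = {((M, r), (N, s)). \<exists>f. cmap_iso f M N \<and> f r = s}"

definition rooted_pointed_quads :: "nat \<Rightarrow> (nat cmap \<times> nat \<times> nat set) set" where
  "rooted_pointed_quads n =
     {(M, r, v). quadrangulation M \<and> card (faces M) = n \<and> r \<in> darts M \<and> v \<in> vertices M}"

definition rooted_pointed_iso ::
    "(('d cmap \<times> 'd \<times> 'd set) \<times> ('d cmap \<times> 'd \<times> 'd set)) set" where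
  "rooted_pointed_iso =
     {((M, r, v), (N, s, w)). \<exists>f. cmap_iso f M N \<and> f r = s \<and> f ` v = w}"

text \<open>The values at 0 are conventions: no map has all faces of degree 4 and no face.\<close>

definition num_rooted_quads :: "nat \<Rightarrow> nat" where
  "num_rooted_quads n =
     (if n = 0 then 1
      else card (rooted_quads n // (rooted_iso \<inter> rooted_quads n \<times> rooted_quads n)))"

definition num_rooted_pointed_quads :: "nat \<Rightarrow> nat" where
  "num_rooted_pointed_quads n =
     (if n = 0 then 2
      else card (rooted_pointed_quads n //
                   (rooted_pointed_iso \<inter> rooted_pointed_quads n \<times> rooted_pointed_quads n)))"

definition Q_pointed :: "real fps" where
  "Q_pointed = Abs_fps (\<lambda>n. real (num_rooted_pointed_quads n))"


text \<open>
  Labels are given by a function on all sets of darts; isomorphism compares only its values on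
  vertices.
\<close>

definition labeled_trees :: "nat \<Rightarrow> (nat cmap \<times> nat \<times> (nat set \<Rightarrow> int)) set" where
  "labeled_trees n =
     {(M, r, l). planar_map M \<and> card (faces M) = 1 \<and> card (edges M) = n \<and> r \<in> darts M \<and>
        (\<forall>d\<in>darts M. \<bar>l (vertex_of M d) - l (vertex_of M (opp M d))\<bar> \<le> 1) \<and>
        l (vertex_of M r) = 1}"

definition labeled_iso ::
    "(('d cmap \<times> 'd \<times> ('d set \<Rightarrow> int)) \<times> ('d cmap \<times> 'd \<times> ('d set \<Rightarrow> int))) set" where
  "labeled_iso =
     {((M, r, l), (N, s, k)).
        \<exists>f. cmap_iso f M N \<and> f r = s \<and> (\<forall>v\<in>vertices M. k (f ` v) = l v)}"

text \<open>The single-vertex tree has no arc, hence is not a dart structure as above.\<close>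

definition num_labeled_trees :: "nat \<Rightarrow> nat" where
  "num_labeled_trees n =
     (if n = 0 then 1
      else card (labeled_trees n // (labeled_iso \<inter> labeled_trees n \<times> labeled_trees n)))"

definition T_series :: "real fps" where
  "T_series = Abs_fps (\<lambda>n. real (num_labeled_trees n))"


text \<open>The relations used for the quotients are equivalences.\<close>

lemma cmap_iso_id: "cmap_iso id M M"
  by (simp add: cmap_iso_def)

lemma cmap_iso_comp:
  assumes "cmap_iso f M N" "cmap_iso g N P"
  shows "cmap_iso (g \<circ> f) M P"
  using assms unfolding cmap_iso_def
  by (auto intro: bij_betw_trans simp: bij_betwE)

lemma cmap_iso_inv:
  assumes M: "cmap M" and f: "cmap_iso f M N"
  shows "cmap_iso (inv_into (darts M) f) N M"
proof -
  let ?g = "inv_into (darts M) f"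
  have bij: "bij_betw f (darts M) (darts N)"
    using f by (simp add: cmap_iso_def)
  have "?g (rot N e) = rot M (?g e) \<and> ?g (opp N e) = opp M (?g e)" if "e \<in> darts N" for e
  proof -
    have "e \<in> f ` darts M"
      using that bij by (simp add: bij_betw_def)
    then obtain d where d: "d \<in> darts M" "e = f d"
      by blast
    have "rot M d \<in> darts M" "opp M d \<in> darts M"
      using M d by (auto simp: cmap_def permutes_in_image)
    moreover have "rot N e = f (rot M d)" "opp N e = f (opp M d)"
      using f d by (simp_all add: cmap_iso_def)
    ultimately show ?thesis
      using d bij by (simp add: bij_betw_inv_into_left)
  qed
  then show ?thesis
    using bij by (simp add: cmap_iso_def bij_betw_inv_into)
qed

lemma vertex_of_subset:
  assumes "cmap M" "d \<in> darts M"
  shows "vertex_of M d \<subseteq> darts M"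
proof
  fix x assume "x \<in> vertex_of M d"
  then have "x \<in> orbit (rot M) d" by (simp add: vertex_of_def)
  then show "x \<in> darts M"
    using assms by induction (auto simp: cmap_def permutes_in_image)
qed

lemma vertex_of_iso:
  assumes M: "cmap M" and f: "cmap_iso f M N" and d: "d \<in> darts M"
  shows "f ` vertex_of M d = vertex_of N (f d)"
proof -
  have M_pow: "(rot M ^^ k) d \<in> darts M" for k
    using M d by (induction k) (auto simp: cmap_def permutes_in_image)
  have "f ((rot M ^^ k) d) = (rot N ^^ k) (f d)" for k
    using f M_pow by (induction k) (auto simp: cmap_iso_def)
  then show ?thesis
    by (auto simp: vertex_of_def orbit_altdef image_iff; metis)
qed

lemma vertices_iso:
  assumes "cmap M" "cmap_iso f M N"
  shows "vertices N = (`) f ` vertices M"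
proof -
  have "darts N = f ` darts M"
    using assms(2) by (simp add: cmap_iso_def bij_betw_def)
  then show ?thesis
    using vertex_of_iso[OF assms] by (simp add: vertices_def image_image)
qed

lemma inv_into_image_vertex:
  assumes "cmap M" "cmap_iso f M N" "v \<in> vertices M"
  shows "inv_into (darts M) f ` f ` v = v"
proof (rule inv_into_image_cancel)
  show "inj_on f (darts M)"
    using assms(2) by (simp add: cmap_iso_def bij_betw_def)
  show "v \<subseteq> darts M"
    using assms(3) vertex_of_subset[OF assms(1)] unfolding vertices_def by blast
qed

lemma cmap_iso_inv_root:
  assumes "cmap_iso f M N" "r \<in> darts M"
  shows "inv_into (darts M) f (f r) = r"
  using assms by (auto simp: cmap_iso_def intro: bij_betw_inv_into_left)

lemma equiv_rooted_iso:
  "equiv (rooted_quads n) (rooted_iso \<inter> rooted_quads n \<times> rooted_quads n)"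
proof (rule equivI)
  show "refl_on (rooted_quads n) (rooted_iso \<inter> rooted_quads n \<times> rooted_quads n)"
    by (rule refl_onI) (use cmap_iso_id in \<open>fastforce simp: rooted_iso_def\<close>)
  show "sym (rooted_iso \<inter> rooted_quads n \<times> rooted_quads n)"
    by (rule symI)
      (use cmap_iso_inv cmap_iso_inv_root in
        \<open>fastforce simp: rooted_iso_def rooted_quads_def quadrangulation_def planar_map_def\<close>)
  show "trans (rooted_iso \<inter> rooted_quads n \<times> rooted_quads n)"
    by (rule transI) (use cmap_iso_comp in \<open>fastforce simp: rooted_iso_def\<close>)
qed auto

lemma equiv_rooted_pointed_iso:
  "equiv (rooted_pointed_quads n)
     (rooted_pointed_iso \<inter> rooted_pointed_quads n \<times> rooted_pointed_quads n)"
    (is "equiv ?X ?R")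
proof (rule equivI)
  show "refl_on ?X ?R"
    by (rule refl_onI) (use cmap_iso_id in \<open>fastforce simp: rooted_pointed_iso_def\<close>)
  show "sym ?R"
  proof (rule symI)
    fix x y assume xy: "(x, y) \<in> ?R"
    obtain M r v N s w where eq: "x = (M, r, v)" "y = (N, s, w)"
      by (metis prod_cases3)
    obtain f where f: "cmap_iso f M N" "s = f r" "w = f ` v"
      using xy by (auto simp: eq rooted_pointed_iso_def)
    have M: "cmap M" "r \<in> darts M" "v \<in> vertices M"
      using xy by (auto simp: eq rooted_pointed_quads_def quadrangulation_def planar_map_def)
    have "cmap_iso (inv_into (darts M) f) N M \<and> inv_into (darts M) f s = r \<and>
        inv_into (darts M) f ` w = v"
      using cmap_iso_inv[OF M(1) f(1)] cmap_iso_inv_root[OF f(1) M(2)]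
        inv_into_image_vertex[OF M(1) f(1) M(3)] f(2,3) by simp
    then show "(y, x) \<in> ?R"
      using xy unfolding eq rooted_pointed_iso_def by blast
  qed
  show "trans ?R"
  proof (rule transI)
    fix x y z assume xy: "(x, y) \<in> ?R" and yz: "(y, z) \<in> ?R"
    obtain M r v N s w P t u where eq: "x = (M, r, v)" "y = (N, s, w)" "z = (P, t, u)"
      by (metis prod_cases3)
    obtain f g where "cmap_iso f M N" "s = f r" "w = f ` v"
        "cmap_iso g N P" "t = g s" "u = g ` w"
      using xy yz by (auto simp: eq rooted_pointed_iso_def)
    then have "cmap_iso (g \<circ> f) M P \<and> (g \<circ> f) r = t \<and> (g \<circ> f) ` v = u"
      using cmap_iso_comp by (auto simp: image_comp)
    then show "(x, z) \<in> ?R"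
      using xy yz unfolding eq rooted_pointed_iso_def by blast
  qed
qed auto

lemma equiv_labeled_iso:
  "equiv (labeled_trees n) (labeled_iso \<inter> labeled_trees n \<times> labeled_trees n)"
    (is "equiv ?X ?R")
proof (rule equivI)
  have "(x, x) \<in> labeled_iso" for x :: "nat cmap \<times> nat \<times> (nat set \<Rightarrow> int)"
    using cmap_iso_id[of "fst x"] by (cases x) (auto simp: labeled_iso_def intro!: exI[of _ id])
  then show "refl_on ?X ?R"
    by (auto intro: refl_onI)
  show "sym ?R"
  proof (rule symI)
    fix x y assume xy: "(x, y) \<in> ?R"
    obtain M r l N s k where eq: "x = (M, r, l)" "y = (N, s, k)"
      by (metis prod_cases3)
    obtain f where f: "cmap_iso f M N" "s = f r" "\<forall>v\<in>vertices M. k (f ` v) = l v"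
      using xy by (auto simp: eq labeled_iso_def)
    have M: "cmap M" "r \<in> darts M"
      using xy by (auto simp: eq labeled_trees_def planar_map_def)
    have "l (inv_into (darts M) f ` w) = k w" if "w \<in> vertices N" for w
      using that vertices_iso[OF M(1) f(1)] inv_into_image_vertex[OF M(1) f(1)] f(3) by auto
    then have "cmap_iso (inv_into (darts M) f) N M \<and> inv_into (darts M) f s = r \<and>
        (\<forall>w\<in>vertices N. l (inv_into (darts M) f ` w) = k w)"
      using cmap_iso_inv[OF M(1) f(1)] cmap_iso_inv_root[OF f(1) M(2)] f(2) by simp
    then show "(y, x) \<in> ?R"
      using xy unfolding eq labeled_iso_def by blast
  qed
  show "trans ?R"
  proof (rule transI)
    fix x y z assume xy: "(x, y) \<in> ?R" and yz: "(y, z) \<in> ?R"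
    obtain M r l N s k P t j where eq: "x = (M, r, l)" "y = (N, s, k)" "z = (P, t, j)"
      by (metis prod_cases3)
    obtain f g where fg: "cmap_iso f M N" "s = f r" "\<forall>v\<in>vertices M. k (f ` v) = l v"
        "cmap_iso g N P" "t = g s" "\<forall>w\<in>vertices N. j (g ` w) = k w"
      using xy yz by (auto simp: eq labeled_iso_def)
    have "cmap M"
      using xy by (auto simp: eq labeled_trees_def planar_map_def)
    then have "f ` v \<in> vertices N" if "v \<in> vertices M" for v
      using that vertices_iso[OF _ fg(1)] by simp
    then have "\<forall>v\<in>vertices M. j ((g \<circ> f) ` v) = l v"
      using fg(3,6) by (metis image_comp)
    then have "cmap_iso (g \<circ> f) M P \<and> (g \<circ> f) r = t \<and>
        (\<forall>v\<in>vertices M. j ((g \<circ> f) ` v) = l v)"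
      using fg(2,5) cmap_iso_comp[OF fg(1,4)] by simp
    then show "(x, z) \<in> ?R"
      using xy yz unfolding eq labeled_iso_def by blast
  qed
qed auto

end

theory Submission
  imports Defs
begin

text \<open>
  A map is glued from its faces: its darts, permuted cyclically around every face by a permutation
  \<open>f\<close>, are paired off by an involution \<open>h\<close>, and its vertices are the cycles of \<open>f \<circ> h\<close>. The proof fixes
  \<open>f\<close> and counts the involutions that give a connected surface of Euler characteristic 2; such an
  involution is called a spherical gluing here. Quadrangulations are glued from \<open>n\<close> quadrangles, and
  trees with \<open>n\<close> edges from a single polygon with \<open>2 * n\<close> sides, so one count covers both.

  The count is Tutte's deletion of the root edge. Deleting the edge between two darts \<open>a\<close> and \<open>b\<close>
  multiplies both \<open>f\<close> and \<open>h\<close> by the transposition of \<open>a\<close> and \<open>b\<close>. The product \<open>f \<circ> h\<close>, hence every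
  vertex, is unchanged, and two face cycles merge or one splits. Together with the inequality
  \<open>V - E + F \<le> 2 * c\<close>, where \<open>c\<close> counts components (\<open>euler_inequality\<close>), this shows what happens on
  a sphere. An edge between two different faces can be deleted freely (\<open>nonbridge_spherical\<close>), and an
  edge with the same face on both sides is a bridge between two spherical gluings
  (\<open>bridge_spherical\<close>, \<open>bridge_separates\<close>). Deleted darts remain in the dart set as inert marks, so
  that no relabelling is needed, and an induction on the number of sides gives the number of gluings
  of a polygon with \<open>p\<close> sides and \<open>m\<close> quadrangles as \<open>m! * 4 ^ m * disk_count p m\<close> (\<open>card_gluings\<close>),
  where \<open>disk_count\<close> satisfies Tutte's recursion.

  The recursion is solved by a bivariate series with coefficients in the series \<open>R = T(z)\<close>, where
  \<open>R = 1 + 3 * z * R\<^sup>2\<close>. Substituting it into the functional equation leaves a polynomial identity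
  that follows from the equation of the Catalan series (\<open>disk_fps_rec\<close>).

  Gluings are related to isomorphism classes by rigidity: an isomorphism of connected maps is
  determined by the image of one dart. Hence each rooted map arises from exactly as many gluings as
  there are identifications of its faces with the fixed ones that respect the root, which is
  \<open>(n - 1)! * k ^ (n - 1)\<close> for \<open>n\<close> faces of degree \<open>k\<close> (\<open>card_gluings_iso\<close>). Rigidity also makes the
  \<open>n + 2\<close> possible basepoints of a rooted quadrangulation inequivalent, and a rooted tree with \<open>n\<close>
  edges has \<open>3 ^ n\<close> inequivalent labellings, since the increments along its edges are arbitrary
  (\<open>card_labelings\<close>).
\<close>


section \<open>Classes of a generated equivalence\<close>

text \<open>
  The components of a map and the cycles of a permutation are both described as classes of a
  generated equivalence, so that one lemma about merging classes serves both.
\<close>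

definition conn :: "('a \<times> 'a) set \<Rightarrow> ('a \<times> 'a) set" where
  "conn S = (S \<union> S\<inverse>)\<^sup>*"

definition cl :: "('a \<times> 'a) set \<Rightarrow> 'a \<Rightarrow> 'a set" where
  "cl S x = conn S `` {x}"

definition parts :: "'a set \<Rightarrow> ('a \<times> 'a) set \<Rightarrow> 'a set set" where
  "parts D S = cl S ` D"

lemma conn_refl [simp]: "(x, x) \<in> conn S"
  by (simp add: conn_def)

lemma conn_sym: "(x, y) \<in> conn S \<Longrightarrow> (y, x) \<in> conn S"
proof -
  have "sym (S \<union> S\<inverse>)" by (auto simp: sym_def)
  then show "(x, y) \<in> conn S \<Longrightarrow> (y, x) \<in> conn S"
    unfolding conn_def by (metis sym_rtrancl symD)
qed

lemma conn_trans: "(x, y) \<in> conn S \<Longrightarrow> (y, z) \<in> conn S \<Longrightarrow> (x, z) \<in> conn S"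
  unfolding conn_def by (rule rtrancl_trans)

lemma conn_base: "(x, y) \<in> S \<Longrightarrow> (x, y) \<in> conn S"
  unfolding conn_def by auto

lemma subset_conn: "S \<subseteq> conn S"
  by (auto intro: conn_base)

lemma conn_least:
  assumes "S \<subseteq> conn T"
  shows "conn S \<subseteq> conn T"
proof -
  have "S \<union> S\<inverse> \<subseteq> conn T" using assms conn_sym[of _ _ T] by auto
  then have "(S \<union> S\<inverse>)\<^sup>* \<subseteq> (conn T)\<^sup>*" by (rule rtrancl_mono)
  also have "(conn T)\<^sup>* = conn T" unfolding conn_def by simp
  finally show ?thesis by (simp add: conn_def)
qed

lemma conn_mono: "S \<subseteq> T \<Longrightarrow> conn S \<subseteq> conn T"
  by (rule conn_least) (auto intro: conn_base)

lemma conn_eqI: "S \<subseteq> conn T \<Longrightarrow> T \<subseteq> conn S \<Longrightarrow> conn S = conn T"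
  using conn_least by blast

lemma conn_induct [consumes 1, case_names base fwd bwd]:
  assumes "(x, y) \<in> conn S" and "P x"
    and "\<And>u v. P u \<Longrightarrow> (u, v) \<in> S \<Longrightarrow> P v"
    and "\<And>u v. P u \<Longrightarrow> (v, u) \<in> S \<Longrightarrow> P v"
  shows "P y"
  using assms(1) unfolding conn_def
proof (induction rule: rtrancl_induct)
  case (step u v)
  then show ?case using assms(3)[of u v] assms(4)[of u v] by blast
qed (rule assms(2))

lemma cl_self [simp]: "x \<in> cl S x"
  by (simp add: cl_def)

lemma cl_iff: "y \<in> cl S x \<longleftrightarrow> (x, y) \<in> conn S"
  by (simp add: cl_def)

lemma cl_eq_iff: "cl S x = cl S y \<longleftrightarrow> (x, y) \<in> conn S"
proof
  assume "cl S x = cl S y"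
  then have "y \<in> cl S x" by simp
  then show "(x, y) \<in> conn S" by (simp add: cl_iff)
next
  assume "(x, y) \<in> conn S"
  then have "(x, z) \<in> conn S \<longleftrightarrow> (y, z) \<in> conn S" for z
    using conn_trans conn_sym by metis
  then show "cl S x = cl S y" by (auto simp: cl_def)
qed

lemma cl_eq: "y \<in> cl S x \<Longrightarrow> cl S y = cl S x"
  by (simp add: cl_eq_iff cl_iff conn_sym)

lemma cl_disjoint: "cl S x \<noteq> cl S y \<Longrightarrow> cl S x \<inter> cl S y = {}"
  by (auto dest: cl_eq)

lemma cl_mono: "S \<subseteq> T \<Longrightarrow> cl S x \<subseteq> cl T x"
  unfolding cl_def using conn_mono by blast

lemma cl_closed_subset:
  assumes "x \<in> B" and "\<And>u v. (u, v) \<in> S \<Longrightarrow> u \<in> B \<longleftrightarrow> v \<in> B"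
  shows "cl S x \<subseteq> B"
proof
  fix y assume "y \<in> cl S x"
  then have "(x, y) \<in> conn S" by (simp add: cl_iff)
  then show "y \<in> B"
    by (induction rule: conn_induct) (use assms in blast)+
qed

lemma cl_subset: "S \<subseteq> D \<times> D \<Longrightarrow> x \<in> D \<Longrightarrow> cl S x \<subseteq> D"
  by (rule cl_closed_subset) auto

lemma cl_closed: "(u, v) \<in> S \<Longrightarrow> u \<in> cl S x \<longleftrightarrow> v \<in> cl S x"
  using conn_base[of u v S] by (metis cl_iff conn_sym conn_trans)

lemma finite_parts [simp]: "finite D \<Longrightarrow> finite (parts D S)"
  by (simp add: parts_def)

lemma cl_in_parts [simp]: "x \<in> D \<Longrightarrow> cl S x \<in> parts D S"
  by (simp add: parts_def)

lemma parts_eq_cl: "C \<in> parts D S \<Longrightarrow> x \<in> C \<Longrightarrow> C = cl S x"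
  by (auto simp: parts_def dest: cl_eq)

lemma parts_disjoint: "C \<in> parts D S \<Longrightarrow> C' \<in> parts D S \<Longrightarrow> C \<noteq> C' \<Longrightarrow> C \<inter> C' = {}"
  by (auto simp: parts_def dest: cl_eq)

lemma parts_nonempty: "C \<in> parts D S \<Longrightarrow> C \<noteq> {}"
  by (metis cl_self empty_iff imageE parts_def)

lemma parts_subset: "S \<subseteq> D \<times> D \<Longrightarrow> C \<in> parts D S \<Longrightarrow> C \<subseteq> D"
  using cl_subset[of S D] by (auto simp: parts_def)

lemma Union_parts: "S \<subseteq> D \<times> D \<Longrightarrow> \<Union> (parts D S) = D"
  using cl_subset[of S D] by (auto simp: parts_def intro: cl_self)

lemma card_parts_1_iff:
  assumes "D \<noteq> {}"
  shows "card (parts D S) = 1 \<longleftrightarrow> (\<forall>x\<in>D. \<forall>y\<in>D. (x, y) \<in> conn S)"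
proof
  assume "card (parts D S) = 1"
  then obtain C where "cl S ` D = {C}" by (auto simp: card_1_singleton_iff parts_def)
  then have "\<forall>x\<in>D. cl S x = C" by blast
  then show "\<forall>x\<in>D. \<forall>y\<in>D. (x, y) \<in> conn S" by (metis cl_eq_iff)
next
  assume *: "\<forall>x\<in>D. \<forall>y\<in>D. (x, y) \<in> conn S"
  obtain x where "x \<in> D" using assms by auto
  then have "cl S y = cl S x" if "y \<in> D" for y using * that by (simp add: cl_eq_iff)
  then have "parts D S = {cl S x}" using \<open>x \<in> D\<close> unfolding parts_def by blast
  then show "card (parts D S) = 1" by simp
qed

lemma cl_union_disjoint:
  assumes "x \<in> D1" "S1 \<subseteq> D1 \<times> D1" "S2 \<subseteq> D2 \<times> D2" "D1 \<inter> D2 = {}"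
  shows "cl (S1 \<union> S2) x = cl S1 x"
proof
  show "cl S1 x \<subseteq> cl (S1 \<union> S2) x" by (rule cl_mono) simp
  have sub: "cl S1 x \<subseteq> D1" using assms by (intro cl_subset)

  have "u \<in> cl S1 x \<longleftrightarrow> v \<in> cl S1 x" if uv: "(u, v) \<in> S1 \<union> S2" for u v
  proof (cases "(u, v) \<in> S1")
    case False
    then have "u \<in> D2" "v \<in> D2" using uv assms(3) by auto
    then show ?thesis using sub assms(4) by blast
  qed (rule cl_closed)
  then show "cl (S1 \<union> S2) x \<subseteq> cl S1 x"
    by (intro cl_closed_subset) auto
qed

lemma parts_union:
  assumes "S1 \<subseteq> D1 \<times> D1" "S2 \<subseteq> D2 \<times> D2" "D1 \<inter> D2 = {}"
  shows "parts (D1 \<union> D2) (S1 \<union> S2) = parts D1 S1 \<union> parts D2 S2"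
    and "parts D1 S1 \<inter> parts D2 S2 = {}"
proof -
  have "cl (S1 \<union> S2) x = cl S1 x" if "x \<in> D1" for x
    using that assms by (rule cl_union_disjoint)
  moreover have "cl (S1 \<union> S2) x = cl S2 x" if "x \<in> D2" for x
    unfolding Un_commute[of S1] using that assms(2,1) by (rule cl_union_disjoint) (use assms(3) in blast)
  ultimately show "parts (D1 \<union> D2) (S1 \<union> S2) = parts D1 S1 \<union> parts D2 S2"
    unfolding parts_def image_Un by (simp cong: image_cong)
  show "parts D1 S1 \<inter> parts D2 S2 = {}"
  proof (rule equals0I)
    fix C assume C: "C \<in> parts D1 S1 \<inter> parts D2 S2"
    then have "C \<subseteq> D1 \<inter> D2" using parts_subset assms(1,2) by blast
    then show False using C parts_nonempty[of C D1 S1] assms(3) by blast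
  qed
qed

text \<open>
  A new generating pair merges the classes of its two ends and leaves the others alone. Every change
  in the number of faces or components comes from this fact.
\<close>

lemma cl_insert:
  "cl (insert (a, b) S) x =
     (if x \<in> cl S a \<union> cl S b then cl S a \<union> cl S b else cl S x)"
proof -
  let ?T = "insert (a, b) S"
  have mono: "cl S y \<subseteq> cl ?T y" for y by (rule cl_mono) auto
  have ab: "(a, b) \<in> conn ?T" by (rule conn_base) simp
  have closed: "u \<in> cl S y \<longleftrightarrow> v \<in> cl S y" if "(u, v) \<in> S" for u v y
    using that by (rule cl_closed)
  show ?thesis
  proof (cases "x \<in> cl S a \<union> cl S b")
    case True
    then have "x \<in> cl ?T a \<union> cl ?T b" using mono by blast
    moreover have "cl ?T a = cl ?T b" using ab by (simp add: cl_eq_iff)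
    ultimately have "x \<in> cl ?T a" by simp
    then have "cl ?T x = cl ?T a" by (rule cl_eq)
    moreover have "cl ?T a = cl ?T b" using ab by (simp add: cl_eq_iff)
    ultimately have "cl ?T x = cl ?T a" "cl ?T x = cl ?T b" by simp_all
    then have "cl S a \<union> cl S b \<subseteq> cl ?T x" using mono[of a] mono[of b] by blast
    moreover have "cl ?T x \<subseteq> cl S a \<union> cl S b"
      by (rule cl_closed_subset) (use True closed in auto)
    ultimately show ?thesis using True by auto
  next
    case False
    have "a \<notin> cl S x" "b \<notin> cl S x"
      using False conn_sym[of x a S] conn_sym[of x b S] by (auto simp: cl_iff)
    then have "cl ?T x \<subseteq> cl S x"
      by (intro cl_closed_subset) (use closed in auto)
    then show ?thesis using False mono[of x] by auto
  qed
qed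

lemma parts_insert:
  assumes "a \<in> D" "b \<in> D"
  shows "parts D (insert (a, b) S) = parts D S - {cl S a, cl S b} \<union> {cl S a \<union> cl S b}"
    (is "?L = ?R")
proof
  show "?L \<subseteq> ?R"
  proof
    fix C assume "C \<in> ?L"
    then obtain x where x: "x \<in> D" "C = cl (insert (a, b) S) x" by (auto simp: parts_def)
    show "C \<in> ?R"
    proof (cases "x \<in> cl S a \<union> cl S b")
      case True
      then show ?thesis using x by (simp add: cl_insert)
    next
      case False
      then have "C = cl S x" using x by (simp add: cl_insert)
      moreover have "cl S x \<noteq> cl S a" "cl S x \<noteq> cl S b"
        using False cl_self[of x S] by (metis UnI1, metis UnI2)
      ultimately show ?thesis using x by simp
    qed
  qed
  show "?R \<subseteq> ?L"
  proof
    fix C assume "C \<in> ?R"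
    then consider "C = cl S a \<union> cl S b" | x where "x \<in> D" "C = cl S x" "C \<noteq> cl S a" "C \<noteq> cl S b"
      by (auto simp: parts_def)
    then show "C \<in> ?L"
    proof cases
      case 1
      then have "C = cl (insert (a, b) S) a" by (simp add: cl_insert)
      then show ?thesis using assms by simp
    next
      case 2
      then have "x \<notin> cl S a \<union> cl S b" using cl_eq[of x S a] cl_eq[of x S b] by blast
      then have "C = cl (insert (a, b) S) x" using 2 by (simp add: cl_insert)
      then show ?thesis using 2 by simp
    qed
  qed
qed

lemma parts_insert_same:
  assumes "(a, b) \<in> conn S"
  shows "parts D (insert (a, b) S) = parts D S"
proof -
  have "conn (insert (a, b) S) = conn S"
    using assms by (intro conn_eqI) (auto intro: conn_base)
  then show ?thesis by (simp add: parts_def cl_def)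
qed

lemma card_parts_insert:
  assumes "finite D" "a \<in> D" "b \<in> D" "(a, b) \<notin> conn S"
  shows "card (parts D S) = Suc (card (parts D (insert (a, b) S)))"
proof -
  have ne: "cl S a \<noteq> cl S b" using assms(4) by (simp add: cl_eq_iff)
  have "cl S a \<union> cl S b \<notin> parts D S"
  proof
    assume "cl S a \<union> cl S b \<in> parts D S"
    then have "cl S a \<union> cl S b = cl S a" "cl S a \<union> cl S b = cl S b"
      by (metis UnCI cl_self parts_eq_cl)+
    then show False using ne by simp
  qed
  moreover have "card (parts D S - {cl S a, cl S b}) = card (parts D S) - 2"
    using assms ne by (subst card_Diff_subset) auto
  moreover have "card {cl S a, cl S b} \<le> card (parts D S)"
    by (rule card_mono) (use assms in auto)
  ultimately show ?thesis
    using assms ne by (simp add: parts_insert)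
qed

lemma card_parts_insert_le:
  assumes "finite D" "a \<in> D" "b \<in> D"
  shows "card (parts D S) \<le> Suc (card (parts D (insert (a, b) S)))"
  using card_parts_insert[OF assms, of S] parts_insert_same[of a b S D] by (cases "(a, b) \<in> conn S") auto


section \<open>Cycles and transpositions\<close>

text \<open>
  The graph of a function. Its classes on \<open>D\<close> are the cycles when \<open>f\<close> permutes \<open>D\<close>, and unions of such
  graphs generate the components of a map.
\<close>

definition link :: "'a set \<Rightarrow> ('a \<Rightarrow> 'a) \<Rightarrow> ('a \<times> 'a) set" where
  "link D f = {(x, f x) |x. x \<in> D}"

abbreviation cycle :: "'a set \<Rightarrow> ('a \<Rightarrow> 'a) \<Rightarrow> 'a \<Rightarrow> 'a set" where
  "cycle D f \<equiv> cl (link D f)"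

abbreviation cycles :: "'a set \<Rightarrow> ('a \<Rightarrow> 'a) \<Rightarrow> 'a set set" where
  "cycles D f \<equiv> parts D (link D f)"

lemma link_subset: "f ` D \<subseteq> D \<Longrightarrow> link D f \<subseteq> D \<times> D"
  by (auto simp: link_def)

lemma link_union: "link (D1 \<union> D2) f = link D1 f \<union> link D2 f"
  by (auto simp: link_def)

lemma link_cong: "(\<And>x. x \<in> D \<Longrightarrow> f x = g x) \<Longrightarrow> link D f = link D g"
  by (auto simp: link_def)

text \<open>
  Permutations are taken as \<open>bij_betw f D D\<close> with arbitrary values outside \<open>D\<close>, so that the same
  function can be restricted to any union of its cycles.
\<close>

lemma finite_permutes_returns:
  fixes f :: "'a \<Rightarrow> 'a"
  assumes "finite D" "bij_betw f D D" "x \<in> D"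
  obtains n where "n > 0" "(f ^^ n) x = x"
proof -
  have in_D: "(f ^^ i) y \<in> D" if "y \<in> D" for i y
    using that assms(2) by (induction i) (auto simp: bij_betw_apply)
  have inj: "inj_on (f ^^ i) D" for i
    by (induction i) (use assms in_D in \<open>auto simp: bij_betw_def inj_on_def\<close>)
  have "\<not> inj_on (\<lambda>i. (f ^^ i) x) (UNIV :: nat set)"
  proof
    assume "inj (\<lambda>i. (f ^^ i) x)"
    moreover have "range (\<lambda>i. (f ^^ i) x) \<subseteq> D" using in_D[OF assms(3)] by auto
    ultimately show False using assms(1) finite_subset finite_imageD infinite_UNIV_nat by metis
  qed
  then obtain i j :: nat where "i \<noteq> j" "(f ^^ i) x = (f ^^ j) x" by (auto simp: inj_on_def)
  then obtain i j :: nat where ij: "i < j" "(f ^^ i) x = (f ^^ j) x" by (metis nat_neq_iff)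
  have "(f ^^ j) x = (f ^^ i) ((f ^^ (j - i)) x)"
    using ij by (metis add_diff_inverse_nat funpow_add less_imp_not_less o_apply)
  then have "(f ^^ (j - i)) x = x"
    using ij inj[of i] in_D assms(3) by (metis inj_onD)
  with ij show thesis by (intro that[of "j - i"]) auto
qed

text \<open>
  The generated equivalence also steps backwards; on a finite set a step back is an iterate forward.
\<close>

lemma cycle_eq_funpow:
  assumes "finite D" "bij_betw f D D" "x \<in> D"
  shows "cycle D f x = {(f ^^ n) x |n. True}" (is "_ = ?R")
proof
  have in_D: "(f ^^ i) y \<in> D" if "y \<in> D" for i y
    using that assms(2) by (induction i) (auto simp: bij_betw_apply)
  obtain k where k: "k > 0" "(f ^^ k) x = x" using finite_permutes_returns[OF assms] .
  have "u \<in> ?R" if fu: "f u \<in> ?R" and uD: "u \<in> D" for u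
  proof -
    obtain n where n: "f u = (f ^^ n) x" using fu by blast
    have "\<exists>m. f u = (f ^^ Suc m) x"
    proof (cases n)
      case 0
      then have "f u = (f ^^ Suc (k - 1)) x" using n k by simp
      then show ?thesis ..
    qed (use n in auto)
    then obtain m where m: "f u = f ((f ^^ m) x)" by auto
    then have "u = (f ^^ m) x"
      using inj_onD[OF bij_betw_imp_inj_on[OF assms(2)] m uD in_D[OF assms(3)]] by simp
    then show ?thesis by auto
  qed
  moreover have "f u \<in> ?R" if u: "u \<in> ?R" for u
  proof -
    obtain n where "u = (f ^^ n) x" using u by auto
    then have "f u = (f ^^ Suc n) x" by simp
    then show ?thesis by blast
  qed
  ultimately have step: "u \<in> ?R \<longleftrightarrow> f u \<in> ?R" if "u \<in> D" for u
    using that by blast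
  have "x = (f ^^ 0) x" by simp
  then have "x \<in> ?R" by blast
  then show "cycle D f x \<subseteq> ?R"
  proof (rule cl_closed_subset)
    fix u v assume "(u, v) \<in> link D f"
    then have "u \<in> D" "v = f u" unfolding link_def by blast+
    then show "u \<in> ?R \<longleftrightarrow> v \<in> ?R" using step by simp
  qed
  have "(x, (f ^^ n) x) \<in> conn (link D f)" for n
  proof (induction n)
    case (Suc n)
    have "((f ^^ n) x, (f ^^ Suc n) x) \<in> link D f"
      using in_D[OF assms(3)] by (auto simp: link_def)
    with Suc show ?case by (blast intro: conn_trans conn_base)
  qed simp
  then show "?R \<subseteq> cycle D f x" by (auto simp: cl_iff)
qed

lemma cycle_eq_orbit:
  assumes "finite D" "bij_betw f D D" "x \<in> D"
  shows "cycle D f x = orbit f x"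
proof -
  obtain k where "k > 0" "(f ^^ k) x = x" using finite_permutes_returns[OF assms] .
  then have "x \<in> orbit f x" by (auto simp: orbit_altdef) (metis)
  then show ?thesis using cycle_eq_funpow[OF assms] orbit_altdef_self_in by metis
qed

lemma cycles_eq_orbits:
  assumes "finite D" "bij_betw f D D"
  shows "cycles D f = orbit f ` D"
  using cycle_eq_orbit[OF assms] by (auto simp: parts_def)

abbreviation tau :: "'a \<Rightarrow> 'a \<Rightarrow> 'a \<Rightarrow> 'a" where
  "tau \<equiv> Transposition.transpose"

text \<open>
  Multiplication by the transposition of \<open>a\<close> and \<open>b\<close> exchanges the images of \<open>a\<close> and \<open>b\<close>, which makes no
  difference once \<open>a\<close> and \<open>b\<close> are related. So it can only split their common cycle or merge their two
  cycles.
\<close>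

lemma swap_link_conn:
  assumes "a \<in> D" "b \<in> D" "a \<noteq> b"
  shows "conn (insert (a, b) (link D (f \<circ> tau a b) \<union> R)) =
         conn (insert (a, b) (link D f \<union> R))"
proof -
  have *: "link D f \<subseteq> conn (insert (a, b) (link D (f \<circ> tau a b) \<union> R))" for f
  proof
    fix p assume "p \<in> link D f"
    then obtain x where x: "x \<in> D" "p = (x, f x)" by (auto simp: link_def)
    let ?T = "insert (a, b) (link D (f \<circ> tau a b) \<union> R)"
    let ?y = "tau a b x"
    have ab: "(a, b) \<in> conn ?T" by (rule conn_base) simp
    have "(x, ?y) \<in> conn ?T"
      using ab conn_sym[OF ab] by (auto simp: Transposition.transpose_def)
    moreover have "?y \<in> D" using x assms by (auto simp: Transposition.transpose_def)
    then have "(?y, f x) \<in> link D (f \<circ> tau a b)"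
      by (auto simp: link_def intro!: exI[of _ ?y])
    then have "(?y, f x) \<in> conn ?T" by (intro conn_base) simp
    ultimately show "p \<in> conn ?T" using x conn_trans by metis
  qed
  have eq: "f \<circ> tau a b \<circ> tau a b = f"
    by (simp add: comp_assoc)
  show ?thesis
  proof (rule conn_eqI)
    show "insert (a, b) (link D (f \<circ> tau a b) \<union> R) \<subseteq> conn (insert (a, b) (link D f \<union> R))"
      using *[of "f \<circ> tau a b"] unfolding eq by (auto intro: conn_base)
    show "insert (a, b) (link D f \<union> R) \<subseteq> conn (insert (a, b) (link D (f \<circ> tau a b) \<union> R))"
      using *[of f] by (auto intro: conn_base)
  qed
qed

lemma bij_betw_swap:
  assumes "bij_betw f D D" "a \<in> D" "b \<in> D"
  shows "bij_betw (f \<circ> tau a b) D D"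
proof -
  have "bij_betw (tau a b) D D" using assms by simp
  then show ?thesis using assms(1) bij_betw_trans by blast
qed

text \<open>
  If \<open>b\<close> lies on the cycle of \<open>a\<close>, then \<open>f\<close> after the transposition closes the stretch from \<open>f a\<close> to \<open>b\<close>
  into a cycle of its own. The explicit form of this stretch is what later measures the two parts of
  a split face.
\<close>

lemma swap_cycle_arc:
  fixes f :: "'a \<Rightarrow> 'a"
  assumes fin: "finite D" and bij: "bij_betw f D D" and a: "a \<in> D"
    and k: "(f ^^ k) a = b" "a \<noteq> b" and least: "\<And>i. i < k \<Longrightarrow> (f ^^ i) a \<noteq> b"
  defines "g \<equiv> f \<circ> tau a b"
  shows "cycle D g b = (\<lambda>i. (f ^^ i) a) ` {1..k}" (is "_ = ?B") and "a \<notin> cycle D g b"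
    and "inj_on (\<lambda>i. (f ^^ i) a) {1..k}"
proof -
  have in_D: "(f ^^ i) y \<in> D" if "y \<in> D" for i y
    using that bij by (induction i) (auto simp: bij_betw_apply)
  have b: "b \<in> D" using k in_D a by auto
  have k0: "0 < k" using k by (cases k) auto
  have not_a: "(f ^^ i) a \<noteq> a" if "1 \<le> i" "i \<le> k" for i
  proof
    assume ret: "(f ^^ i) a = a"
    have "(f ^^ k) a = (f ^^ (k - i)) ((f ^^ i) a)"
      using that by (metis add.commute add_diff_inverse_nat funpow_add not_less o_apply)
    then have "(f ^^ (k - i)) a = b" using ret k by simp
    with least[of "k - i"] that show False by simp
  qed
  have g: "g ((f ^^ i) a) = (f ^^ Suc i) a" if "1 \<le> i" "i < k" for i
    using that not_a[of i] least[of i] by (simp add: g_def)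
  have gb: "g b = f a" by (simp add: g_def)
  have g_in: "g u \<in> ?B" if u: "u \<in> ?B" for u
  proof -
    obtain i where i: "1 \<le> i" "i \<le> k" "u = (f ^^ i) a" using u by auto
    show ?thesis
    proof (cases "i < k")
      case True
      then have "g u = (f ^^ Suc i) a" using g i by blast
      then show ?thesis using True i by (intro image_eqI[of _ _ "Suc i"]) auto
    next
      case False
      then have "g u = (f ^^ 1) a" using gb i k by simp
      then show ?thesis using k0 by (intro image_eqI[of _ _ 1]) auto
    qed
  qed
  have bijg: "bij_betw g D D" unfolding g_def using bij a b by (rule bij_betw_swap)
  have "cycle D g b \<subseteq> ?B"
  proof -
    have "(g ^^ n) b \<in> ?B" for n
    proof (induction n)
      case 0
      then show ?case using k k0 by (auto intro!: image_eqI[of _ _ k])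
    qed (use g_in in auto)
    then show ?thesis unfolding cycle_eq_funpow[OF fin bijg b] by auto
  qed
  moreover have "(b, (f ^^ i) a) \<in> conn (link D g)" if "1 \<le> i" "i \<le> k" for i
    using that
  proof (induction i rule: dec_induct)
    case base
    have "(b, f a) \<in> link D g" using b gb by (auto simp: link_def)
    then show ?case by (simp add: conn_base)
  next
    case (step i)
    then have "((f ^^ i) a, (f ^^ Suc i) a) \<in> link D g"
      using g[of i] in_D[OF a] by (auto simp: link_def)
    then show ?case using step by (meson Suc_leD conn_base conn_trans)
  qed
  ultimately show B: "cycle D g b = ?B" by (auto simp: cl_iff)
  show "a \<notin> cycle D g b" unfolding B using not_a by force
  show "inj_on (\<lambda>i. (f ^^ i) a) {1..k}"
  proof (rule linorder_inj_onI)
    fix i j assume ij: "i < j" "i \<in> {1..k}" "j \<in> {1..k}"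
    show "(f ^^ i) a \<noteq> (f ^^ j) a"
    proof
      assume eq: "(f ^^ i) a = (f ^^ j) a"
      have "(f ^^ (k - j)) ((f ^^ j) a) = (f ^^ k) a"
        using ij by (metis atLeastAtMost_iff funpow_add le_add_diff_inverse2 o_apply)
      moreover have "(f ^^ (k - j)) ((f ^^ i) a) = (f ^^ (k - j + i)) a"
        by (simp add: funpow_add)
      ultimately have "(f ^^ (k - j + i)) a = b" using eq k by simp
      moreover have "k - j + i < k" using ij by auto
      ultimately show False using least by blast
    qed
  qed auto
qed

lemma swap_split:
  assumes "finite D" "bij_betw f D D" "a \<in> D" "b \<in> cycle D f a" "a \<noteq> b"
  shows "b \<notin> cycle D (f \<circ> tau a b) a"
proof -
  obtain n where n: "(f ^^ n) a = b" using assms cycle_eq_funpow[OF assms(1-3)] by auto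
  define k where "k = (LEAST n. (f ^^ n) a = b)"
  have "(f ^^ k) a = b" unfolding k_def using n by (rule LeastI)
  moreover have "\<And>i. i < k \<Longrightarrow> (f ^^ i) a \<noteq> b" unfolding k_def by (rule not_less_Least)
  ultimately have "a \<notin> cycle D (f \<circ> tau a b) b"
    using swap_cycle_arc(2)[OF assms(1-3)] assms(5) by blast
  then show ?thesis using cl_iff conn_sym by metis
qed

text \<open>
  After the transposition, \<open>a\<close> is sent to \<open>f b\<close>, from where the old cycle of \<open>b\<close> is followed until it
  returns to \<open>b\<close>.
\<close>

lemma swap_merge:
  fixes f :: "'a \<Rightarrow> 'a"
  assumes fin: "finite D" and bij: "bij_betw f D D" and ab: "a \<in> D" "b \<in> D"
    and sep: "b \<notin> cycle D f a"
  shows "b \<in> cycle D (f \<circ> tau a b) a"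
proof -
  let ?g = "f \<circ> tau a b"
  have in_D: "(f ^^ i) b \<in> D" for i
    using ab bij by (induction i) (auto simp: bij_betw_apply)
  obtain n where n: "n > 0" "(f ^^ n) b = b" using finite_permutes_returns[OF fin bij ab(2)] .
  \<comment> \<open>The walk stops at the first return to \<open>b\<close>, where the transposition takes effect again.\<close>
  define k where "k = (LEAST n. n > 0 \<and> (f ^^ n) b = b)"
  have k: "k > 0" "(f ^^ k) b = b"
    unfolding k_def using n LeastI[of "\<lambda>n. n > 0 \<and> (f ^^ n) b = b"] by auto
  have least: "(f ^^ i) b \<noteq> b" if "0 < i" "i < k" for i
    using not_less_Least[of i "\<lambda>n. n > 0 \<and> (f ^^ n) b = b"] that unfolding k_def by auto
  have not_a: "(f ^^ i) b \<noteq> a" for i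
  proof
    assume "(f ^^ i) b = a"
    then have "a \<in> cycle D f b" unfolding cycle_eq_funpow[OF fin bij ab(2)] by auto
    then show False using sep cl_iff conn_sym by metis
  qed
  have "(a, (f ^^ i) b) \<in> conn (link D ?g)" if "1 \<le> i" "i \<le> k" for i
    using that
  proof (induction i rule: dec_induct)
    case base
    have "(a, f b) \<in> link D ?g" using ab by (auto simp: link_def)
    then have "(a, f b) \<in> conn (link D ?g)" by (rule conn_base)
    then show ?case by (simp del: o_apply)
  next
    case (step i)
    then have "?g ((f ^^ i) b) = (f ^^ Suc i) b" using least[of i] not_a[of i] by simp
    then have "((f ^^ i) b, (f ^^ Suc i) b) \<in> link D ?g"
      using in_D by (auto simp: link_def)
    then show ?case using step by (meson Suc_leD conn_base conn_trans)
  qed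
  from this[of k] k show ?thesis by (simp add: cl_iff)
qed

lemma cycles_swap_merge:
  assumes fin: "finite D" and bij: "bij_betw f D D" and ab: "a \<in> D" "b \<in> D"
    and sep: "b \<notin> cycle D f a"
  defines "g \<equiv> f \<circ> tau a b"
  shows "cycles D g = cycles D f - {cycle D f a, cycle D f b} \<union> {cycle D f a \<union> cycle D f b}"
    and "card (cycles D f) = Suc (card (cycles D g))"
proof -
  have ne: "a \<noteq> b" using sep by auto
  have "(a, b) \<in> conn (link D g)" using swap_merge[OF fin bij ab sep] by (simp add: g_def cl_iff)
  then have "cycles D g = parts D (insert (a, b) (link D g))" by (simp add: parts_insert_same)
  also have "\<dots> = parts D (insert (a, b) (link D f))"
    using swap_link_conn[OF ab ne, of f "{}"] by (simp add: g_def parts_def cl_def)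
  finally have eq: "cycles D g = parts D (insert (a, b) (link D f))" .
  then show "cycles D g = cycles D f - {cycle D f a, cycle D f b} \<union> {cycle D f a \<union> cycle D f b}"
    using parts_insert ab by metis
  show "card (cycles D f) = Suc (card (cycles D g))"
    unfolding eq using sep by (intro card_parts_insert fin ab) (simp add: cl_iff)
qed

lemma cycles_swap_split:
  assumes fin: "finite D" and bij: "bij_betw f D D" and ab: "a \<in> D" "b \<in> cycle D f a" "a \<noteq> b"
  defines "g \<equiv> f \<circ> tau a b"
  shows "cycles D f = cycles D g - {cycle D g a, cycle D g b} \<union> {cycle D f a}"
    and "cycle D f a = cycle D g a \<union> cycle D g b"
    and "cycle D g a \<inter> cycle D g b = {}"
    and "card (cycles D g) = Suc (card (cycles D f))"
proof -
  have b: "b \<in> D" using ab cl_subset[of "link D f" D a] link_subset[of f D] bij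
    by (auto simp: bij_betw_def)
  have sep: "b \<notin> cycle D g a" using swap_split[OF fin bij ab] by (simp add: g_def)
  have bijg: "bij_betw g D D" unfolding g_def using bij ab(1) b by (rule bij_betw_swap)
  have f: "f = g \<circ> tau a b" by (simp add: g_def comp_assoc)
  note merge = cycles_swap_merge[OF fin bijg ab(1) b sep, folded f]
  have conn: "conn (insert (a, b) (link D g)) = conn (insert (a, b) (link D f))"
    using swap_link_conn[OF ab(1) b ab(3), of f "{}"] by (simp add: g_def)
  have "conn (insert (a, b) (link D f)) = conn (link D f)"
    using ab by (intro conn_eqI) (auto intro: conn_base simp: cl_iff)
  then have "cycle D f a = cl (insert (a, b) (link D g)) a" using conn by (simp add: cl_def)
  also have "\<dots> = cycle D g a \<union> cycle D g b" by (simp add: cl_insert)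
  finally show *: "cycle D f a = cycle D g a \<union> cycle D g b" .
  show "cycles D f = cycles D g - {cycle D g a, cycle D g b} \<union> {cycle D f a}"
    using merge(1) * by simp
  show "cycle D g a \<inter> cycle D g b = {}" using sep cl_disjoint cl_self by metis
  show "card (cycles D g) = Suc (card (cycles D f))" using merge(2) .
qed


section \<open>Gluings and the Euler inequality\<close>

text \<open>
  A fixed-point-free involution of \<open>A\<close>. The darts outside \<open>A\<close> are inert marks on the faces. They make it
  possible to delete an edge without changing the set of darts, and to have polygons without sides.
\<close>

definition matching :: "'a set \<Rightarrow> ('a \<Rightarrow> 'a) \<Rightarrow> bool" where
  "matching A h \<longleftrightarrow>
     (\<forall>x\<in>A. h x \<in> A \<and> h x \<noteq> x \<and> h (h x) = x) \<and> (\<forall>x. x \<notin> A \<longrightarrow> h x = x)"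

abbreviation comps :: "'a set \<Rightarrow> ('a \<Rightarrow> 'a) \<Rightarrow> ('a \<Rightarrow> 'a) \<Rightarrow> 'a set set" where
  "comps D f h \<equiv> parts D (link D f \<union> link D h)"

text \<open>
  Connectedness and Euler's formula \<open>V - E + F = 2\<close> for the surface with vertices the cycles of \<open>f \<circ> h\<close>,
  \<open>card A / 2\<close> edges and faces the cycles of \<open>f\<close>, doubled to avoid the division.
\<close>

definition spherical :: "'a set \<Rightarrow> ('a \<Rightarrow> 'a) \<Rightarrow> 'a set \<Rightarrow> ('a \<Rightarrow> 'a) \<Rightarrow> bool" where
  "spherical D f A h \<longleftrightarrow>
     card (comps D f h) = 1 \<and>
     2 * card (cycles D (f \<circ> h)) + 2 * card (cycles D f) = card A + 4"

definition gluings :: "'a set \<Rightarrow> ('a \<Rightarrow> 'a) \<Rightarrow> 'a set \<Rightarrow> ('a \<Rightarrow> 'a) set" where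
  "gluings D f A = {h. matching A h \<and> spherical D f A h}"

lemma comps_id: "comps D f id = cycles D f"
proof -
  have "conn (link D f \<union> link D id) = conn (link D f)"
  proof (rule conn_eqI)
    have "link D id \<subseteq> conn (link D f)" by (auto simp: link_def)
    then show "link D f \<union> link D id \<subseteq> conn (link D f)" using subset_conn by blast
    show "link D f \<subseteq> conn (link D f \<union> link D id)" using subset_conn by blast
  qed
  then show ?thesis by (simp add: parts_def cl_def)
qed

lemma matching_involution: "matching A h \<Longrightarrow> h (h x) = x"
  unfolding matching_def by metis

lemma matching_in_iff: "matching A h \<Longrightarrow> h x \<in> A \<longleftrightarrow> x \<in> A"
  unfolding matching_def by metis

lemma matching_bij_betw:
  assumes "matching A h" "A \<subseteq> D"
  shows "bij_betw h D D"
proof (rule bij_betwI[where g = h])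
  show "h \<in> D \<rightarrow> D"
  proof
    fix x assume "x \<in> D"
    then show "h x \<in> D" using assms unfolding matching_def by (cases "x \<in> A") auto
  qed
  then show "h \<in> D \<rightarrow> D" .
qed (use matching_involution[OF assms(1)] in auto)

lemma finite_matchings:
  assumes "finite A"
  shows "finite {h. matching A h}"
proof (rule finite_subset)
  have "h permutes A" if "matching A h" for h
    using that matching_bij_betw[OF that order_refl] by (intro bij_imp_permutes) (auto simp: matching_def)
  then show "{h. matching A h} \<subseteq> {h. h permutes A}" by blast
  show "finite {h. h permutes A}" using assms by (rule finite_permutations)
qed

lemma finite_gluings: "finite A \<Longrightarrow> finite (gluings D f A)"
  by (rule finite_subset[OF _ finite_matchings]) (auto simp: gluings_def)

lemma matching_empty: "matching {} h \<longleftrightarrow> h = id"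
  by (auto simp: matching_def fun_eq_iff)

text \<open>
  Composing with the transposition of two matched darts \<open>a\<close> and \<open>b\<close> turns them into inert marks.
\<close>

lemma matching_remove:
  assumes h: "matching A h" and a: "a \<in> A" and b: "b = h a"
  shows "matching (A - {a, b}) (h \<circ> tau a b)"
    and "a \<noteq> b" "b \<in> A" "h b = a"
proof -
  show ab: "a \<noteq> b" "b \<in> A" "h b = a" using assms unfolding matching_def by metis+
  show "matching (A - {a, b}) (h \<circ> tau a b)"
    unfolding matching_def
  proof (intro conjI ballI allI impI)
    fix x assume x: "x \<in> A - {a, b}"
    then have t: "tau a b x = x" by simp
    have "x = b" if "h x = a" using matching_involution[OF h, of x] that b by simp
    moreover have "x = a" if "h x = b" using matching_involution[OF h, of x] that ab by simp
    ultimately have "h x \<noteq> a" "h x \<noteq> b" using x by auto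
    then show "(h \<circ> tau a b) x \<in> A - {a, b}"
      using x matching_in_iff[OF h] by (simp add: t)
    have "h x \<noteq> x" using x h by (auto simp: matching_def)
    then show "(h \<circ> tau a b) x \<noteq> x" by (simp add: t)
    show "(h \<circ> tau a b) ((h \<circ> tau a b) x) = x"
      using \<open>h x \<noteq> a\<close> \<open>h x \<noteq> b\<close> by (simp add: t matching_involution[OF h])
  next
    fix x assume x: "x \<notin> A - {a, b}"
    then consider "x = a" | "x = b" | "x \<notin> A" "x \<noteq> a" "x \<noteq> b" by blast
    then show "(h \<circ> tau a b) x = x"
      using b ab h by cases (auto simp: matching_def)
  qed
qed

lemma matching_add:
  assumes k: "matching (A - {a, b}) k" and ab: "a \<in> A" "b \<in> A" "a \<noteq> b"
  shows "matching A (k \<circ> tau a b)" "(k \<circ> tau a b) a = b"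
proof -
  have kab: "k a = a" "k b = b" using k by (auto simp: matching_def)
  then show "(k \<circ> tau a b) a = b" by simp
  show "matching A (k \<circ> tau a b)"
    unfolding matching_def
  proof (intro conjI ballI allI impI)
    fix x assume x: "x \<in> A"
    consider "x = a" | "x = b" | "x \<in> A - {a, b}" using x by blast
    then have "(k \<circ> tau a b) x \<in> A \<and> (k \<circ> tau a b) x \<noteq> x \<and>
      (k \<circ> tau a b) ((k \<circ> tau a b) x) = x"
    proof cases
      case 3
      then have "k x \<in> A - {a, b}" "k x \<noteq> x" "k (k x) = x"
        using k unfolding matching_def by blast+
      then show ?thesis using 3 by simp
    qed (use kab ab in auto)
    then show "(k \<circ> tau a b) x \<in> A" "(k \<circ> tau a b) x \<noteq> x"
      "(k \<circ> tau a b) ((k \<circ> tau a b) x) = x" by blast+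
  next
    fix x assume x: "x \<notin> A"
    then have "x \<noteq> a" "x \<noteq> b" using ab by auto
    then show "(k \<circ> tau a b) x = x" using x k by (simp add: matching_def)
  qed
qed

lemma swap_involution_commute:
  assumes "\<And>x. h (h x) = x" "b = h a"
  shows "tau a b \<circ> h = h \<circ> tau a b"
proof
  fix x
  have "h b = a" using assms by simp
  moreover have "h x = a \<longleftrightarrow> x = b" "h x = b \<longleftrightarrow> x = a" using assms by metis+
  ultimately show "(tau a b \<circ> h) x = (h \<circ> tau a b) x"
    using assms(2) by (auto simp: Transposition.transpose_def)
qed

text \<open>
  Deleting an edge multiplies the face permutation and the matching by the same transposition. It
  cancels in the product, which is the rotation about the vertices.
\<close>

lemma remove_edge_vertices:
  assumes "matching A h" "b = h a"
  shows "(f \<circ> tau a b) \<circ> (h \<circ> tau a b) = f \<circ> h"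
proof -
  have "(f \<circ> tau a b) \<circ> (h \<circ> tau a b) =
    f \<circ> (tau a b \<circ> h) \<circ> tau a b" by (simp add: comp_assoc)
  also have "\<dots> = f \<circ> h \<circ> (tau a b \<circ> tau a b)"
    using swap_involution_commute[of h b a] assms matching_involution[OF assms(1)] by (simp add: comp_assoc)
  finally show ?thesis by simp
qed

text \<open>
  For the components, deleting the edge joining \<open>a\<close> and \<open>b\<close> amounts to dropping the pair \<open>(a, b)\<close>.
\<close>

lemma remove_edge_conn:
  assumes h: "matching A h" and a: "a \<in> A" and b: "b = h a" and AD: "A \<subseteq> D"
  shows "conn (link D f \<union> link D h) =
    conn (insert (a, b) (link D (f \<circ> tau a b) \<union> link D (h \<circ> tau a b)))"
proof -
  note ab = matching_remove[OF h a b]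
  have D: "a \<in> D" "b \<in> D" using a ab AD by auto
  let ?h = "h \<circ> tau a b"
  have "conn (link D f \<union> link D h) = conn (insert (a, b) (link D f \<union> link D ?h))"
  proof (rule conn_eqI)
    have "(a, b) \<in> link D h" using D b unfolding link_def by blast
    then have abc: "(a, b) \<in> conn (link D f \<union> link D h)" by (intro conn_base) simp
    have "link D ?h \<subseteq> conn (link D f \<union> link D h)"
    proof
      fix p assume "p \<in> link D ?h"
      then obtain x where x: "x \<in> D" "p = (x, ?h x)" unfolding link_def by blast
      consider "x = a" | "x = b" | "x \<noteq> a" "x \<noteq> b" by blast
      then show "p \<in> conn (link D f \<union> link D h)"
      proof cases
        case 3
        then have "p \<in> link D h" using x unfolding link_def by auto
        then show ?thesis by (intro subsetD[OF subset_conn]) simp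
      qed (use x b ab in auto)
    qed
    then show "insert (a, b) (link D f \<union> link D ?h) \<subseteq> conn (link D f \<union> link D h)"
      using abc conn_base[of _ _ "link D f \<union> link D h"] by auto
    let ?T = "insert (a, b) (link D f \<union> link D ?h)"
    have abT: "(a, b) \<in> conn ?T" by (rule conn_base) simp
    have "link D h \<subseteq> conn ?T"
    proof
      fix p assume "p \<in> link D h"
      then obtain x where x: "x \<in> D" "p = (x, h x)" unfolding link_def by blast
      consider "x = a" | "x = b" | "x \<noteq> a" "x \<noteq> b" by blast
      then show "p \<in> conn ?T"
      proof cases
        case 3
        then have "p \<in> link D ?h" using x unfolding link_def by auto
        then show ?thesis by (intro subsetD[OF subset_conn]) simp
      qed (use x b ab abT conn_sym[OF abT] in auto)
    qed
    then show "link D f \<union> link D h \<subseteq> conn ?T"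
      using conn_base[of _ _ ?T] by auto
  qed
  also have "\<dots> = conn (insert (a, b) (link D (f \<circ> tau a b) \<union> link D ?h))"
    using swap_link_conn[OF D ab(2), of f "link D ?h"] by simp
  finally show ?thesis .
qed

lemma remove_edge_comps:
  assumes "matching A h" "a \<in> A" "b = h a" "A \<subseteq> D"
  shows "comps D f h = parts D
    (insert (a, b) (link D (f \<circ> tau a b) \<union> link D (h \<circ> tau a b)))"
  using remove_edge_conn[OF assms, of f] by (simp add: parts_def cl_def)

lemma card_remove2:
  assumes "finite A" "a \<in> A" "b \<in> A" "a \<noteq> b"
  shows "card A = card (A - {a, b}) + 2"
proof -
  have "card (A - {a, b}) = card A - card {a, b}" by (rule card_Diff_subset) (use assms in auto)
  moreover have "card {a, b} \<le> card A" by (rule card_mono) (use assms in auto)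
  ultimately show ?thesis using assms by simp
qed

text \<open>
  \<open>V - E + F \<le> 2 * c\<close>, by deleting the edges one after another while \<open>V\<close> is constant. If the ends of the
  edge lie on one face cycle, the deletion splits it, and at most one component is gained. If they lie
  on different face cycles, these merge, so that no component is gained. Without edges the faces are
  the vertices and the components.
\<close>

lemma euler_inequality:
  assumes "finite D" "bij_betw f D D" "A \<subseteq> D" "matching A h"
  shows "2 * card (cycles D (f \<circ> h)) + 2 * card (cycles D f) \<le> card A + 4 * card (comps D f h)"
  using assms(2-4)
proof (induction "card A" arbitrary: A f h rule: less_induct)
  case less
  have finA: "finite A" using less.prems(2) assms(1) finite_subset by blast
  show ?case
  proof (cases "A = {}")
    case True
    then have h: "h = id" using less.prems(3) matching_empty by blast
    then show ?thesis by (simp add: comps_id)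
  next
    case False
    then obtain a where a: "a \<in> A" by blast
    define b where "b = h a"
    note ab = matching_remove[OF less.prems(3) a b_def]
    have D: "a \<in> D" "b \<in> D" using a ab less.prems(2) by auto
    let ?f = "f \<circ> tau a b" and ?h = "h \<circ> tau a b"
    let ?S = "link D ?f \<union> link D ?h"
    have cA: "card A = card (A - {a, b}) + 2" using card_remove2 finA a ab by metis
    have "2 * card (cycles D (?f \<circ> ?h)) + 2 * card (cycles D ?f) \<le>
        card (A - {a, b}) + 4 * card (comps D ?f ?h)"
      by (rule less.hyps) (use cA ab less.prems D bij_betw_swap in auto)
    then have IH: "2 * card (cycles D (f \<circ> h)) + 2 * card (cycles D ?f) \<le>
        card (A - {a, b}) + 4 * card (comps D ?f ?h)"
      unfolding remove_edge_vertices[OF less.prems(3) b_def, of f] .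
    have eq: "comps D f h = parts D (insert (a, b) ?S)"
      by (rule remove_edge_comps) (use less.prems a b_def in auto)
    show ?thesis
    proof (cases "b \<in> cycle D f a")
      case True
      have "card (cycles D ?f) = Suc (card (cycles D f))"
        by (rule cycles_swap_split(4)) (use assms(1) less.prems(1) D(1) True ab(2) in auto)
      moreover have "card (comps D ?f ?h) \<le> Suc (card (comps D f h))"
        unfolding eq using assms(1) D by (rule card_parts_insert_le)
      ultimately show ?thesis using IH cA by linarith
    next
      case False
      have "card (cycles D f) = Suc (card (cycles D ?f))"
        using assms(1) less.prems(1) D False by (rule cycles_swap_merge(2))
      moreover have "b \<in> cycle D ?f a"
        using assms(1) less.prems(1) D False by (rule swap_merge)
      then have "(a, b) \<in> conn (link D ?f)" by (simp add: cl_iff)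
      then have "(a, b) \<in> conn ?S" using conn_mono[of "link D ?f" ?S] by blast
      then have "comps D f h = comps D ?f ?h" unfolding eq by (rule parts_insert_same)
      ultimately show ?thesis using IH cA by simp
    qed
  qed
qed


section \<open>Cutting a gluing along an edge\<close>

lemma cycle_closed: "x \<in> D \<Longrightarrow> x \<in> cycle D f y \<longleftrightarrow> f x \<in> cycle D f y"
  by (rule cl_closed) (auto simp: link_def)

lemma stable_restrict:
  assumes "finite D" "bij_betw f D D" "E \<subseteq> D" "f ` E \<subseteq> E"
  shows "bij_betw f E E" "bij_betw f (D - E) (D - E)"
proof -
  have inj: "inj_on f D" and sur: "f ` D = D" using assms(2) by (auto simp: bij_betw_def)
  have fE: "finite E" using assms(1,3) by (rule rev_finite_subset)
  have injE: "inj_on f E" using inj assms(3) by (rule inj_on_subset)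
  have E: "f ` E = E" using fE assms(4) injE by (rule endo_inj_surj)
  then show "bij_betw f E E" using injE by (simp add: bij_betw_def)
  have "f ` (D - E) = f ` D - f ` E" using inj assms(3) by (simp add: inj_on_image_set_diff)
  then have "f ` (D - E) = D - E" using E sur by simp
  then show "bij_betw f (D - E) (D - E)" using inj inj_on_subset[OF inj, of "D - E"] by (simp add: bij_betw_def)
qed

lemma link_stable: "bij_betw f D D \<Longrightarrow> link D f \<subseteq> D \<times> D"
  by (rule link_subset) (simp add: bij_betw_def)

text \<open>
  Some of the cycles of a permutation can be cut out, and so can the remaining ones.
\<close>

lemma cycles_partition:
  assumes "finite D" "bij_betw f D D" "P \<subseteq> cycles D f"
  shows "\<Union>P \<subseteq> D" "bij_betw f (\<Union>P) (\<Union>P)" "cycles (\<Union>P) f = P"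
    "bij_betw f (D - \<Union>P) (D - \<Union>P)" "cycles (D - \<Union>P) f = cycles D f - P"
proof -
  have link: "link D f \<subseteq> D \<times> D" using assms(2) by (rule link_stable)
  show sub: "\<Union>P \<subseteq> D" using parts_subset[OF link] assms(3) by blast
  have cyc: "cycle D f x \<in> P \<longleftrightarrow> x \<in> \<Union>P" if "x \<in> D" for x
  proof
    assume "x \<in> \<Union>P"
    then obtain C where C: "C \<in> P" "x \<in> C" by blast
    then have "C = cycle D f x" using parts_eq_cl[OF subsetD[OF assms(3)]] by simp
    then show "cycle D f x \<in> P" using C by simp
  qed (use cl_self[of x "link D f"] in blast)
  have img: "f ` \<Union>P \<subseteq> \<Union>P"
  proof
    fix y assume "y \<in> f ` \<Union>P"
    then obtain x C where x: "y = f x" "C \<in> P" "x \<in> C" by blast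
    then have "x \<in> D" using sub by blast
    have "C = cycle D f x" using parts_eq_cl[OF subsetD[OF assms(3) x(2)] x(3)] .
    then have "f x \<in> C" using cycle_closed[OF \<open>x \<in> D\<close>, of f x] x(3) by simp
    then show "y \<in> \<Union>P" using x by blast
  qed
  note st = stable_restrict[OF assms(1,2) sub img]
  show "bij_betw f (\<Union>P) (\<Union>P)" "bij_betw f (D - \<Union>P) (D - \<Union>P)" by (rule st)+
  have split: "link D f = link (\<Union>P) f \<union> link (D - \<Union>P) f"
    using link_union[of "\<Union>P" "D - \<Union>P" f] sub by (simp add: Un_absorb1)
  have in1: "cycle (\<Union>P) f x = cycle D f x" if "x \<in> \<Union>P" for x
    unfolding split
    by (rule cl_union_disjoint[OF that link_stable[OF st(1)] link_stable[OF st(2)], symmetric]) blast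
  have in2: "cycle (D - \<Union>P) f x = cycle D f x" if "x \<in> D - \<Union>P" for x
    unfolding split Un_commute[of "link (\<Union>P) f"]
    by (rule cl_union_disjoint[OF that link_stable[OF st(2)] link_stable[OF st(1)], symmetric]) blast
  show "cycles (\<Union>P) f = P"
  proof
    show "cycles (\<Union>P) f \<subseteq> P"
    proof
      fix C assume "C \<in> cycles (\<Union>P) f"
      then obtain x where x: "x \<in> \<Union>P" "C = cycle (\<Union>P) f x" unfolding parts_def by (rule imageE)
      then have "C = cycle D f x" using in1 by simp
      then show "C \<in> P" using cyc[OF subsetD[OF sub x(1)]] x(1) by simp
    qed
    show "P \<subseteq> cycles (\<Union>P) f"
    proof
      fix C assume C: "C \<in> P"
      obtain x where x: "x \<in> C" using parts_nonempty[OF subsetD[OF assms(3) C]] by blast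
      then have "C = cycle D f x" by (rule parts_eq_cl[OF subsetD[OF assms(3) C]])
      moreover have xP: "x \<in> \<Union>P" using C x by blast
      ultimately have "C = cycle (\<Union>P) f x" using in1[of x] by simp
      then show "C \<in> cycles (\<Union>P) f" using cl_in_parts[OF xP] by simp
    qed
  qed
  show "cycles (D - \<Union>P) f = cycles D f - P"
  proof
    show "cycles (D - \<Union>P) f \<subseteq> cycles D f - P"
    proof
      fix C assume "C \<in> cycles (D - \<Union>P) f"
      then obtain x where x: "x \<in> D - \<Union>P" "C = cycle (D - \<Union>P) f x"
        unfolding parts_def by (rule imageE)
      then have "C = cycle D f x" using in2 by simp
      moreover have "x \<in> D" "x \<notin> \<Union>P" using x by blast+
      ultimately show "C \<in> cycles D f - P" using cyc[of x] by simp
    qed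
    show "cycles D f - P \<subseteq> cycles (D - \<Union>P) f"
    proof
      fix C assume C: "C \<in> cycles D f - P"
      then obtain x where x: "x \<in> D" "C = cycle D f x" by (auto simp: parts_def)
      then have xP: "x \<in> D - \<Union>P" using C cyc by simp
      then have "C = cycle (D - \<Union>P) f x" using in2[of x] x by simp
      then show "C \<in> cycles (D - \<Union>P) f" using cl_in_parts[OF xP] by simp
    qed
  qed
qed

lemma component_subset_stable:
  assumes "finite D" "bij_betw f D D" "bij_betw k D D" "E \<subseteq> D" "f ` E \<subseteq> E" "k ` E \<subseteq> E" "x \<in> E"
  shows "cl (link D f \<union> link D k) x \<subseteq> E"
proof (rule cl_closed_subset[OF assms(7)])
  note st = stable_restrict(2)[OF assms(1,2,4,5)] stable_restrict(2)[OF assms(1,3,4,6)]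
  fix u v assume "(u, v) \<in> link D f \<union> link D k"
  then have uv: "u \<in> D" "v = f u \<or> v = k u" by (auto simp: link_def)
  show "u \<in> E \<longleftrightarrow> v \<in> E"
  proof
    assume "u \<in> E" then show "v \<in> E" using uv assms(5,6) by blast
  next
    assume v: "v \<in> E"
    show "u \<in> E"
    proof (rule ccontr)
      assume "u \<notin> E"
      then have "f u \<in> D - E" "k u \<in> D - E"
        using uv(1) bij_betwE[OF st(1)] bij_betwE[OF st(2)] by blast+
      then show False using uv v by blast
    qed
  qed
qed

lemma card_cycles_split:
  assumes "finite D" "bij_betw f D D" "E \<subseteq> D" "f ` E \<subseteq> E"
  shows "card (cycles D f) = card (cycles E f) + card (cycles (D - E) f)"
proof -
  note st = stable_restrict[OF assms]
  have D: "D = E \<union> (D - E)" using assms(3) by blast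
  then have "link D f = link E f \<union> link (D - E) f" using link_union[of E "D - E" f] by simp
  then have "cycles D f = cycles E f \<union> cycles (D - E) f"
    using parts_union(1)[OF link_stable[OF st(1)] link_stable[OF st(2)]] D by simp
  moreover have "cycles E f \<inter> cycles (D - E) f = {}"
    by (rule parts_union(2)[OF link_stable[OF st(1)] link_stable[OF st(2)]]) simp
  moreover have "finite E" using assms(1,3) by (rule rev_finite_subset)
  ultimately show ?thesis using assms(1) by (simp add: card_Un_disjoint)
qed

lemma card_comps_split:
  assumes "finite D" "bij_betw f D D" "bij_betw k D D" "E \<subseteq> D" "f ` E \<subseteq> E" "k ` E \<subseteq> E"
  shows "card (comps D f k) = card (comps E f k) + card (comps (D - E) f k)"
proof -
  note st = stable_restrict[OF assms(1,2,4,5)] stable_restrict[OF assms(1,3,4,6)]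
  have D: "D = E \<union> (D - E)" using assms(4) by blast
  have l1: "link E f \<union> link E k \<subseteq> E \<times> E" using link_stable[OF st(1)] link_stable[OF st(3)] by blast
  have l2: "link (D - E) f \<union> link (D - E) k \<subseteq> (D - E) \<times> (D - E)"
    using link_stable[OF st(2)] link_stable[OF st(4)] by blast
  have "link D f \<union> link D k = (link E f \<union> link E k) \<union> (link (D - E) f \<union> link (D - E) k)"
    using link_union[of E "D - E" f] link_union[of E "D - E" k] D by auto
  then have "comps D f k = comps E f k \<union> comps (D - E) f k"
    using parts_union(1)[OF l1 l2] D by simp
  moreover have "comps E f k \<inter> comps (D - E) f k = {}"
    by (rule parts_union(2)[OF l1 l2]) simp
  moreover have "finite E" using assms(1,4) by (rule rev_finite_subset)
  ultimately show ?thesis using assms(1) by (simp add: card_Un_disjoint)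
qed

lemma matching_restrict_stable:
  assumes "matching A k" "k ` E \<subseteq> E"
  shows "matching (A \<inter> E) (\<lambda>x. if x \<in> E then k x else x)"
  using assms unfolding matching_def by auto

lemma spherical_cong:
  assumes "\<And>x. x \<in> D \<Longrightarrow> k x = k' x"
  shows "spherical D f A k = spherical D f A k'"
proof -
  have "link D k = link D k'" "link D (f \<circ> k) = link D (f \<circ> k')"
    by (rule link_cong; simp add: assms)+
  then show ?thesis by (simp add: spherical_def)
qed

lemma euler_inequality_on:
  assumes "finite D" "bij_betw f D D" "A \<subseteq> D" "matching B k" "k ` D \<subseteq> D" "A = B \<inter> D"
  shows "2 * card (cycles D (f \<circ> k)) + 2 * card (cycles D f) \<le> card A + 4 * card (comps D f k)"
proof -
  let ?k = "\<lambda>x. if x \<in> D then k x else x"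
  have "link D ?k = link D k" "link D (f \<circ> ?k) = link D (f \<circ> k)"
    by (rule link_cong; simp)+
  moreover have "matching A ?k" using matching_restrict_stable[OF assms(4,5)] assms(6) by simp
  ultimately show ?thesis using euler_inequality[OF assms(1-3), of ?k] by simp
qed

text \<open>
  Between two different faces, deleting an edge merges the faces and keeps the surface connected, so
  that \<open>E\<close> and \<open>F\<close> drop by one while \<open>V\<close> and the number of components stay.
\<close>

lemma nonbridge_spherical:
  assumes fin: "finite D" and bij: "bij_betw f D D" and AD: "A \<subseteq> D" and h: "matching A h"
    and a: "a \<in> A" and b: "b = h a" and sep: "b \<notin> cycle D f a"
  shows "spherical D f A h \<longleftrightarrow>
    spherical D (f \<circ> tau a b) (A - {a, b}) (h \<circ> tau a b)"
proof -
  note ab = matching_remove[OF h a b]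
  have D: "a \<in> D" "b \<in> D" using a ab AD by auto
  let ?f = "f \<circ> tau a b" and ?h = "h \<circ> tau a b"
  have "finite A" using fin AD by (rule rev_finite_subset)
  then have cA: "card A = card (A - {a, b}) + 2" using card_remove2 a ab by metis
  have "card (cycles D f) = Suc (card (cycles D ?f))"
    using fin bij D sep by (rule cycles_swap_merge(2))
  moreover have "b \<in> cycle D ?f a" using fin bij D sep by (rule swap_merge)
  then have "(a, b) \<in> conn (link D ?f)" by (simp add: cl_iff)
  then have "(a, b) \<in> conn (link D ?f \<union> link D ?h)"
    using conn_mono[of "link D ?f" "link D ?f \<union> link D ?h"] by blast
  then have "comps D f h = comps D ?f ?h"
    unfolding remove_edge_comps[OF h a b AD] by (rule parts_insert_same)
  ultimately show ?thesis
    unfolding spherical_def remove_edge_vertices[OF h b, of f] cA by (simp add: ac_simps)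
qed

text \<open>
  Here \<open>E\<close> is one of the two sides of a bridge. Both sides satisfy the Euler inequality, and the sum of
  the two inequalities is an equality iff the whole gluing satisfies Euler's formula. So both sides are
  spherical iff the whole is.
\<close>

lemma bridge_spherical:
  assumes fin: "finite D" and bij: "bij_betw f D D" and AD: "A \<subseteq> D" and h: "matching A h"
    and a: "a \<in> A" and b: "b = h a" and bC: "b \<in> cycle D f a"
  defines "g \<equiv> f \<circ> tau a b" and "k \<equiv> h \<circ> tau a b"
  assumes E: "E \<subseteq> D" "g ` E \<subseteq> E" "k ` E \<subseteq> E" "a \<in> E" "b \<notin> E"
  shows "spherical D f A h \<longleftrightarrow>
    spherical E g ((A - {a, b}) \<inter> E) k \<and> spherical (D - E) g ((A - {a, b}) \<inter> (D - E)) k"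
proof -
  note ab = matching_remove[OF h a b, folded k_def]
  have D: "a \<in> D" "b \<in> D" using a ab AD by auto
  let ?A = "A - {a, b}"
  have finA: "finite A" using fin AD by (rule rev_finite_subset)
  then have cA: "card A = card ?A + 2" using card_remove2 a ab by metis
  have "card ((?A \<inter> E) \<union> (?A \<inter> (D - E))) = card (?A \<inter> E) + card (?A \<inter> (D - E))"
    using finA by (intro card_Un_disjoint) auto
  moreover have "(?A \<inter> E) \<union> (?A \<inter> (D - E)) = ?A" using AD by blast
  ultimately have cA': "card ?A = card (?A \<inter> E) + card (?A \<inter> (D - E))" by simp
  have bijg: "bij_betw g D D" unfolding g_def using bij D by (rule bij_betw_swap)
  have bijk: "bij_betw k D D" using ab(1) AD by (intro matching_bij_betw[of ?A]) auto
  have bijgk: "bij_betw (g \<circ> k) D D" using bijk bijg by (rule bij_betw_trans)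
  have gkE: "(g \<circ> k) ` E \<subseteq> E" using E(2,3) by auto
  note stg = stable_restrict[OF fin bijg E(1,2)] and stk = stable_restrict[OF fin bijk E(1,3)]
  have F: "card (cycles D g) = Suc (card (cycles D f))"
    unfolding g_def using fin bij D(1) bC ab(2) by (rule cycles_swap_split(4))
  have V: "cycles D (f \<circ> h) = cycles D (g \<circ> k)"
    unfolding g_def k_def remove_edge_vertices[OF h b] ..
  have "(a, b) \<notin> conn (link D g \<union> link D k)"
  proof
    assume "(a, b) \<in> conn (link D g \<union> link D k)"
    then have "b \<in> cl (link D g \<union> link D k) a" by (simp add: cl_iff)
    moreover have "cl (link D g \<union> link D k) a \<subseteq> E"
      by (rule component_subset_stable[OF fin bijg bijk E(1-4)])
    ultimately show False using E(5) by blast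
  qed
  then have "card (comps D g k) = Suc (card (comps D f h))"
    unfolding remove_edge_comps[OF h a b AD] g_def k_def by (rule card_parts_insert[OF fin D])
  then have c: "card (comps E g k) + card (comps (D - E) g k) = Suc (card (comps D f h))"
    using card_comps_split[OF fin bijg bijk E(1-3)] by simp
  have cpos: "card (comps E g k) \<ge> 1" "card (comps (D - E) g k) \<ge> 1"
  proof -
    have "finite E" using fin E(1) by (rule rev_finite_subset)
    moreover have "E \<noteq> {}" "D - E \<noteq> {}" using E D by auto
    ultimately show "card (comps E g k) \<ge> 1" "card (comps (D - E) g k) \<ge> 1"
      using fin by (auto simp: parts_def Suc_le_eq card_gt_0_iff)
  qed
  have V2: "card (cycles D (f \<circ> h)) = card (cycles E (g \<circ> k)) + card (cycles (D - E) (g \<circ> k))"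
    unfolding V by (rule card_cycles_split[OF fin bijgk E(1) gkE])
  have F2: "Suc (card (cycles D f)) = card (cycles E g) + card (cycles (D - E) g)"
    unfolding F[symmetric] by (rule card_cycles_split[OF fin bijg E(1,2)])
  have "2 * card (cycles E (g \<circ> k)) + 2 * card (cycles E g) \<le> card (?A \<inter> E) + 4 * card (comps E g k)"
    by (rule euler_inequality_on[OF _ stg(1) _ ab(1) E(3)]) (use fin E(1) finite_subset in auto)
  moreover have "2 * card (cycles (D - E) (g \<circ> k)) + 2 * card (cycles (D - E) g) \<le>
      card (?A \<inter> (D - E)) + 4 * card (comps (D - E) g k)"
    by (rule euler_inequality_on[OF _ stg(2) _ ab(1)]) (use fin stk(2) in \<open>auto simp: bij_betw_def\<close>)
  ultimately show ?thesis
    unfolding spherical_def using V2 F2 c cpos cA cA' by linarith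
qed

text \<open>
  On a sphere an edge with the same face on both sides is a bridge. If the rest were connected, it
  would have \<open>V - E + F = 4\<close>, since the deletion removes an edge and splits a face.
\<close>

lemma bridge_separates:
  assumes fin: "finite D" and bij: "bij_betw f D D" and AD: "A \<subseteq> D" and h: "matching A h"
    and a: "a \<in> A" and b: "b = h a" and bC: "b \<in> cycle D f a" and sph: "spherical D f A h"
  shows "b \<notin> cl (link D (f \<circ> tau a b) \<union> link D (h \<circ> tau a b)) a"
proof
  let ?g = "f \<circ> tau a b" and ?k = "h \<circ> tau a b"
  assume "b \<in> cl (link D ?g \<union> link D ?k) a"
  then have "(a, b) \<in> conn (link D ?g \<union> link D ?k)" by (simp add: cl_iff)
  then have "comps D f h = comps D ?g ?k"
    unfolding remove_edge_comps[OF h a b AD] by (rule parts_insert_same)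
  then have c: "card (comps D ?g ?k) = 1" using sph by (simp add: spherical_def)
  note ab = matching_remove[OF h a b]
  have D: "a \<in> D" "b \<in> D" using a ab AD by auto
  have finA: "finite A" using fin AD by (rule rev_finite_subset)
  then have cA: "card A = card (A - {a, b}) + 2" using card_remove2 a ab by metis
  have F: "card (cycles D ?g) = Suc (card (cycles D f))"
    using fin bij D(1) bC ab(2) by (rule cycles_swap_split(4))
  have "2 * card (cycles D (?g \<circ> ?k)) + 2 * card (cycles D ?g) \<le> card (A - {a, b}) + 4 * card (comps D ?g ?k)"
    by (rule euler_inequality[OF fin bij_betw_swap[OF bij D] _ ab(1)]) (use AD in auto)
  then show False
    unfolding remove_edge_vertices[OF h b, of f] using c F cA sph by (simp add: spherical_def)
qed


section \<open>Deleting the root edge\<close>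

lemma card_nonbridge_gluings:
  assumes fin: "finite D" and bij: "bij_betw f D D" and AD: "A \<subseteq> D"
    and a: "a \<in> A" and b: "b \<in> A" and sep: "b \<notin> cycle D f a"
  shows "card {h \<in> gluings D f A. h a = b} =
    card (gluings D (f \<circ> tau a b) (A - {a, b}))"
proof (rule bij_betw_same_card)
  let ?t = "tau a b"
  have ne: "a \<noteq> b" using sep by auto
  have tt: "h \<circ> ?t \<circ> ?t = h" for h :: "'a \<Rightarrow> 'a" by (simp add: comp_assoc)
  show "bij_betw (\<lambda>h. h \<circ> ?t) {h \<in> gluings D f A. h a = b} (gluings D (f \<circ> ?t) (A - {a, b}))"
  proof (rule bij_betw_byWitness[where f' = "\<lambda>h. h \<circ> ?t"])
    show "(\<lambda>h. h \<circ> ?t) ` {h \<in> gluings D f A. h a = b} \<subseteq> gluings D (f \<circ> ?t) (A - {a, b})"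
    proof
      fix k assume "k \<in> (\<lambda>h. h \<circ> ?t) ` {h \<in> gluings D f A. h a = b}"
      then obtain h where h: "h \<in> gluings D f A" "b = h a" "k = h \<circ> ?t" by blast
      then have m: "matching A h" "spherical D f A h" by (simp_all add: gluings_def)
      show "k \<in> gluings D (f \<circ> ?t) (A - {a, b})"
        using matching_remove(1)[OF m(1) a h(2)] m(2)
          nonbridge_spherical[OF fin bij AD m(1) a h(2) sep] h(3) by (simp add: gluings_def)
    qed
    show "(\<lambda>h. h \<circ> ?t) ` gluings D (f \<circ> ?t) (A - {a, b}) \<subseteq> {h \<in> gluings D f A. h a = b}"
    proof
      fix h assume "h \<in> (\<lambda>h. h \<circ> ?t) ` gluings D (f \<circ> ?t) (A - {a, b})"
      then obtain k where k: "matching (A - {a, b}) k" "spherical D (f \<circ> ?t) (A - {a, b}) k" "h = k \<circ> ?t"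
        by (auto simp: gluings_def)
      have m: "matching A h" "h a = b" using matching_add[OF k(1) a b ne] k(3) by simp_all
      have "h \<circ> ?t = k" using k(3) tt by simp
      then have "spherical D f A h"
        using nonbridge_spherical[OF fin bij AD m(1) a m(2)[symmetric] sep] k(2) by simp
      then show "h \<in> {h \<in> gluings D f A. h a = b}" using m by (simp add: gluings_def)
    qed
  qed (use tt in auto)
qed

lemma cycles_swap_split':
  assumes fin: "finite D" and bij: "bij_betw f D D" and ab: "a \<in> D" "b \<in> cycle D f a" "a \<noteq> b"
  defines "g \<equiv> f \<circ> tau a b"
  shows "cycles D f - {cycle D f a} = cycles D g - {cycle D g a, cycle D g b}"
proof -
  note sp = cycles_swap_split[OF fin bij ab, folded g_def]
  have "cycle D f a \<notin> cycles D g - {cycle D g a, cycle D g b}"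
  proof
    assume *: "cycle D f a \<in> cycles D g - {cycle D g a, cycle D g b}"
    then have "cycle D f a = cycle D g a" using parts_eq_cl[of "cycle D f a" D "link D g" a] by simp
    then show False using * by simp
  qed
  then show ?thesis using sp(1) by blast
qed

text \<open>
  The part of the map on the side of \<open>a\<close> consists of the new face of \<open>a\<close> and of some old faces, which are
  those contained in it.
\<close>

lemma root_component:
  assumes fin: "finite D" and bij: "bij_betw g D D" and a: "a \<in> D" and link: "link D k \<subseteq> D \<times> D"
    and sep: "b \<notin> K" and K: "K = cl (link D g \<union> link D k) a"
  shows "K = cycle D g a \<union> \<Union>{C \<in> cycles D g - {cycle D g a, cycle D g b}. C \<subseteq> K}"
proof
  have sub: "cycle D g x \<subseteq> K" if "x \<in> K" for x
  proof -
    have "cycle D g x \<subseteq> cl (link D g \<union> link D k) x" by (rule cl_mono) simp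
    also have "\<dots> = K" using that unfolding K by (rule cl_eq)
    finally show ?thesis .
  qed
  have "a \<in> K" unfolding K by simp
  then show "cycle D g a \<union> \<Union>{C \<in> cycles D g - {cycle D g a, cycle D g b}. C \<subseteq> K} \<subseteq> K"
    using sub by blast
  have KD: "K \<subseteq> D" unfolding K by (rule cl_subset) (use a link link_stable[OF bij] in auto)
  show "K \<subseteq> cycle D g a \<union> \<Union>{C \<in> cycles D g - {cycle D g a, cycle D g b}. C \<subseteq> K}"
  proof
    fix x assume x: "x \<in> K"
    have in_c: "cycle D g x \<in> cycles D g" using x KD by (intro cl_in_parts) blast
    have "cycle D g x \<noteq> cycle D g b" using sub[OF x] sep cl_self[of b] by blast
    moreover have "x \<in> cycle D g x" by simp
    ultimately show "x \<in> cycle D g a \<union> \<Union>{C \<in> cycles D g - {cycle D g a, cycle D g b}. C \<subseteq> K}"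
      using in_c sub[OF x] by blast
  qed
qed

text \<open>
  A gluing whose root edge \<open>{a, b}\<close> has the root face on both sides amounts to a set \<open>S\<close> of other faces,
  namely those on the side of \<open>a\<close>, together with a gluing of each side.
\<close>

lemma card_bridge_gluings:
  assumes fin: "finite D" and bij: "bij_betw f D D" and AD: "A \<subseteq> D"
    and a: "a \<in> A" and b: "b \<in> A" and ne: "a \<noteq> b" and bC: "b \<in> cycle D f a"
  defines "g \<equiv> f \<circ> tau a b" and "B \<equiv> A - {a, b}"
    and "Q \<equiv> cycles D f - {cycle D f a}"
  defines "E \<equiv> \<lambda>S. cycle D g a \<union> \<Union>S"
  shows "card {h \<in> gluings D f A. h a = b} =
    (\<Sum>S\<in>Pow Q. card (gluings (E S) g (B \<inter> E S)) * card (gluings (D - E S) g (B \<inter> (D - E S))))"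
proof -
  let ?t = "tau a b"
  have D: "a \<in> D" "b \<in> D" using a b AD by auto
  have tt: "h \<circ> ?t \<circ> ?t = h" for h :: "'a \<Rightarrow> 'a" by (simp add: comp_assoc)
  have bijg: "bij_betw g D D" unfolding g_def using bij D by (rule bij_betw_swap)
  have Q: "Q = cycles D g - {cycle D g a, cycle D g b}"
    unfolding Q_def g_def by (rule cycles_swap_split'[OF fin bij D(1) bC ne])
  have bC1: "b \<notin> cycle D g a" unfolding g_def by (rule swap_split[OF fin bij D(1) bC ne])
  have finA: "finite A" using fin AD by (rule rev_finite_subset)
  have finQ: "finite Q" using fin by (simp add: Q_def)
  have E_Union: "E S = \<Union>(insert (cycle D g a) S)" for S by (simp add: E_def)
  have P: "insert (cycle D g a) S \<subseteq> cycles D g" if "S \<subseteq> Q" for S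
    using that D(1) Q by auto
  have ED: "E S \<subseteq> D" and gE: "bij_betw g (E S) (E S)" if "S \<subseteq> Q" for S
    using cycles_partition(1,2)[OF fin bijg P[OF that]] by (simp_all add: E_def)
  have bE: "b \<notin> E S" if S: "S \<subseteq> Q" for S
  proof
    assume "b \<in> E S"
    then obtain C where C: "C \<in> S" "b \<in> C" using bC1 by (auto simp: E_def)
    then have "C \<in> cycles D g" "C \<noteq> cycle D g b" using S Q by auto
    then show False using parts_eq_cl[OF _ C(2)] by blast
  qed
  have aE: "a \<in> E S" for S by (simp add: E_def)
  \<comment> \<open>\<open>K h\<close> is the side of \<open>a\<close> once the edge is deleted, and \<open>\<phi> h\<close> is the set of old faces on it.\<close>
  define K where "K = (\<lambda>h. cl (link D g \<union> link D (h \<circ> ?t)) a)"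
  define \<phi> where "\<phi> = (\<lambda>h. {C \<in> Q. C \<subseteq> K h})"
  define H where "H = {h \<in> gluings D f A. h a = b}"
  have finH: "finite H" unfolding H_def using finite_gluings[OF finA] by simp
  have \<phi>E: "{C \<in> Q. C \<subseteq> E S} = S" if S: "S \<subseteq> Q" for S
  proof
    show "S \<subseteq> {C \<in> Q. C \<subseteq> E S}" using S by (auto simp: E_def)
    show "{C \<in> Q. C \<subseteq> E S} \<subseteq> S"
    proof
      fix C assume C: "C \<in> {C \<in> Q. C \<subseteq> E S}"
      then have Cc: "C \<in> cycles D g" "C \<noteq> cycle D g a" using Q by auto
      obtain x where x: "x \<in> C" using parts_nonempty[OF Cc(1)] by blast
      then have Cx: "C = cycle D g x" using parts_eq_cl[OF Cc(1)] by simp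
      have "x \<notin> cycle D g a" using cl_eq[of x "link D g" a] Cx Cc(2) by auto
      then obtain C' where C': "C' \<in> S" "x \<in> C'" using C x by (auto simp: E_def)
      then have "C' \<in> cycles D g" using S Q by auto
      then have "C' = C" using parts_eq_cl[OF _ C'(2)] Cx by simp
      then show "C \<in> S" using C' by simp
    qed
  qed
  have rem: "matching B (h \<circ> ?t)" "link D (h \<circ> ?t) \<subseteq> D \<times> D" if "matching A h" "h a = b" for h
  proof -
    show m: "matching B (h \<circ> ?t)" unfolding B_def
      using that by (intro matching_remove(1)[OF _ a]) auto
    show "link D (h \<circ> ?t) \<subseteq> D \<times> D"
      using m AD by (intro link_stable matching_bij_betw[of B]) (auto simp: B_def)
  qed
  have K_eq: "K h = E (\<phi> h)" if h: "h \<in> H" for h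
  proof -
    have m: "matching A h" "h a = b" "spherical D f A h" using h by (auto simp: H_def gluings_def)
    have "b \<notin> K h" unfolding K_def g_def
      using bridge_separates[OF fin bij AD m(1) a m(2)[symmetric] bC m(3)] by simp
    then show ?thesis unfolding E_def \<phi>_def Q
      by (rule root_component[OF fin bijg D(1) rem(2)[OF m(1,2)]]) (simp add: K_def)
  qed
  have "card H = (\<Sum>h\<in>H. 1)" by simp
  also have "\<dots> = (\<Sum>S\<in>Pow Q. \<Sum>h\<in>{h \<in> H. \<phi> h = S}. 1)"
    by (rule sum.group[symmetric]) (use finH finQ in \<open>auto simp: \<phi>_def\<close>)
  also have "\<dots> = (\<Sum>S\<in>Pow Q. card {h \<in> H. \<phi> h = S})" by simp
  also have "\<dots> = (\<Sum>S\<in>Pow Q. card (gluings (E S) g (B \<inter> E S)) * card (gluings (D - E S) g (B \<inter> (D - E S))))"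
  proof (rule sum.cong[OF refl])
    fix S assume "S \<in> Pow Q"
    then have S: "S \<subseteq> Q" by blast
    define r where "r = (\<lambda>X (k :: 'a \<Rightarrow> 'a) x. if x \<in> X then k x else x)"
    let ?E1 = "E S" and ?E2 = "D - E S"
    let ?G1 = "gluings ?E1 g (B \<inter> ?E1)" and ?G2 = "gluings ?E2 g (B \<inter> ?E2)"
    note ED = ED[OF S] and gE = gE[OF S] and bE = bE[OF S]
    have gE': "g ` ?E1 \<subseteq> ?E1" using gE by (simp add: bij_betw_def)
    have key: "spherical D f A h \<longleftrightarrow> spherical ?E1 g (B \<inter> ?E1) (h \<circ> ?t) \<and> spherical ?E2 g (B \<inter> ?E2) (h \<circ> ?t)"
      if "matching A h" "h a = b" "(h \<circ> ?t) ` ?E1 \<subseteq> ?E1" for h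
      unfolding B_def g_def
      by (rule bridge_spherical[OF fin bij AD that(1) a that(2)[symmetric] bC])
        (use ED gE' bE aE that(3) in \<open>simp_all add: g_def\<close>)
    have kE: "(h \<circ> ?t) ` ?E1 \<subseteq> ?E1" "(h \<circ> ?t) ` ?E2 \<subseteq> ?E2"
      if h: "h \<in> H" "\<phi> h = S" for h
    proof -
      have m: "matching A h" "h a = b" using h(1) by (auto simp: H_def gluings_def)
      have KE: "K h = ?E1" using K_eq[OF h(1)] h(2) by simp
      have bijk: "bij_betw (h \<circ> ?t) D D"
        using rem(1)[OF m] AD by (intro matching_bij_betw[of B]) (auto simp: B_def)
      show *: "(h \<circ> ?t) ` ?E1 \<subseteq> ?E1"
      proof
        fix y assume "y \<in> (h \<circ> ?t) ` ?E1"
        then obtain x where x: "x \<in> ?E1" "y = (h \<circ> ?t) x" by (rule imageE)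
        then have "x \<in> D" using ED by blast
        then have "(x, y) \<in> conn (link D g \<union> link D (h \<circ> ?t))"
          using x(2) by (intro conn_base) (auto simp: link_def)
        moreover have "(a, x) \<in> conn (link D g \<union> link D (h \<circ> ?t))"
          using x(1) unfolding KE[symmetric] K_def cl_iff .
        ultimately have "y \<in> K h" unfolding K_def cl_iff using conn_trans by metis
        then show "y \<in> ?E1" using KE by simp
      qed
      show "(h \<circ> ?t) ` ?E2 \<subseteq> ?E2"
        using stable_restrict(2)[OF fin bijk ED *] by (simp add: bij_betw_def)
    qed
    have "bij_betw (\<lambda>h. (r ?E1 (h \<circ> ?t), r ?E2 (h \<circ> ?t))) {h \<in> H. \<phi> h = S} (?G1 \<times> ?G2)"
    proof (rule bij_betw_byWitness[where f' = "\<lambda>(k1, k2). k1 \<circ> k2 \<circ> ?t"])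
      show "\<forall>h\<in>{h \<in> H. \<phi> h = S}. (\<lambda>(k1, k2). k1 \<circ> k2 \<circ> ?t) (r ?E1 (h \<circ> ?t), r ?E2 (h \<circ> ?t)) = h"
      proof
        fix h assume "h \<in> {h \<in> H. \<phi> h = S}"
        then have h: "h \<in> H" "\<phi> h = S" by auto
        have m: "matching A h" "h a = b" using h(1) by (auto simp: H_def gluings_def)
        define k where "k = h \<circ> ?t"
        have mk: "matching B k" and k1: "k ` ?E1 \<subseteq> ?E1" and k2: "k ` ?E2 \<subseteq> ?E2"
          unfolding k_def using rem(1)[OF m] kE[OF h] by auto
        have "r ?E1 k \<circ> r ?E2 k = k"
        proof
          fix x
          consider "x \<in> ?E1" | "x \<in> ?E2" | "x \<notin> D" using ED by blast
          then show "(r ?E1 k \<circ> r ?E2 k) x = k x"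
          proof cases
            case 2
            then have "k x \<in> ?E2" using k2 by blast
            then show ?thesis using 2 by (simp add: r_def)
          next
            case 3
            then have "x \<notin> B" "x \<notin> ?E1" using AD ED by (auto simp: B_def)
            then show ?thesis using 3 mk by (simp add: r_def matching_def)
          qed (simp add: r_def)
        qed
        then have "r ?E1 k \<circ> r ?E2 k \<circ> ?t = h" using tt by (simp add: k_def)
        then show "(\<lambda>(k1, k2). k1 \<circ> k2 \<circ> ?t) (r ?E1 (h \<circ> ?t), r ?E2 (h \<circ> ?t)) = h"
          unfolding k_def prod.case .
      qed
      have split: "r ?E1 (k1 \<circ> k2) = k1" "r ?E2 (k1 \<circ> k2) = k2" "matching B (k1 \<circ> k2)"
        "(k1 \<circ> k2) ` ?E1 \<subseteq> ?E1"
        if m1: "matching (B \<inter> ?E1) k1" and m2: "matching (B \<inter> ?E2) k2" for k1 k2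
      proof -
        have v1: "(k1 \<circ> k2) x = k1 x" if "x \<notin> ?E2" for x using that m2 by (simp add: matching_def)
        have v2: "(k1 \<circ> k2) x = k2 x" if "x \<notin> ?E1" for x
        proof -
          have "k2 x \<notin> ?E1" using that m2 unfolding matching_def by (cases "x \<in> B \<inter> ?E2") auto
          then show ?thesis using m1 by (simp add: matching_def)
        qed
        show "r ?E1 (k1 \<circ> k2) = k1" "r ?E2 (k1 \<circ> k2) = k2"
          using v1 v2 m1 m2 by (auto simp: r_def matching_def fun_eq_iff)
        have in1: "k1 x \<in> B \<inter> ?E1 \<and> k1 x \<noteq> x \<and> k1 (k1 x) = x" if "x \<in> B \<inter> ?E1" for x
          using m1 that unfolding matching_def by blast
        have in2: "k2 x \<in> B \<inter> ?E2 \<and> k2 x \<noteq> x \<and> k2 (k2 x) = x" if "x \<in> B \<inter> ?E2" for x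
          using m2 that unfolding matching_def by blast
        show "matching B (k1 \<circ> k2)"
          unfolding matching_def
        proof (intro conjI ballI allI impI)
          fix x assume "x \<in> B"
          then consider "x \<in> B \<inter> ?E1" | "x \<in> B \<inter> ?E2" using AD by (auto simp: B_def)
          then have "(k1 \<circ> k2) x \<in> B \<and> (k1 \<circ> k2) x \<noteq> x \<and> (k1 \<circ> k2) ((k1 \<circ> k2) x) = x"
          proof cases
            case 1
            then show ?thesis using in1[OF 1] v1[of x] v1[of "k1 x"] by simp
          next
            case 2
            then show ?thesis using in2[OF 2] v2[of x] v2[of "k2 x"] by simp
          qed
          then show "(k1 \<circ> k2) x \<in> B" "(k1 \<circ> k2) x \<noteq> x" "(k1 \<circ> k2) ((k1 \<circ> k2) x) = x" by blast+
        next
          fix x assume "x \<notin> B"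
          then show "(k1 \<circ> k2) x = x" using m1 m2 by (simp add: matching_def)
        qed
        show "(k1 \<circ> k2) ` ?E1 \<subseteq> ?E1"
        proof
          fix y assume "y \<in> (k1 \<circ> k2) ` ?E1"
          then obtain x where x: "x \<in> ?E1" "y = (k1 \<circ> k2) x" by (rule imageE)
          then have "y = k1 x" using v1[of x] by simp
          then show "y \<in> ?E1" using x(1) in1[of x] m1 by (cases "x \<in> B") (auto simp: matching_def)
        qed
      qed
      show "\<forall>p\<in>?G1 \<times> ?G2. (r ?E1 ((\<lambda>(k1, k2). k1 \<circ> k2 \<circ> ?t) p \<circ> ?t),
          r ?E2 ((\<lambda>(k1, k2). k1 \<circ> k2 \<circ> ?t) p \<circ> ?t)) = p"
        using split(1,2) tt by (auto simp: gluings_def)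
      show "(\<lambda>h. (r ?E1 (h \<circ> ?t), r ?E2 (h \<circ> ?t))) ` {h \<in> H. \<phi> h = S} \<subseteq> ?G1 \<times> ?G2"
      proof
        fix p assume "p \<in> (\<lambda>h. (r ?E1 (h \<circ> ?t), r ?E2 (h \<circ> ?t))) ` {h \<in> H. \<phi> h = S}"
        then obtain h where h: "h \<in> H" "\<phi> h = S" and p: "p = (r ?E1 (h \<circ> ?t), r ?E2 (h \<circ> ?t))" by blast
        have m: "matching A h" "h a = b" "spherical D f A h" using h(1) by (auto simp: H_def gluings_def)
        note sp = key[OF m(1,2) kE(1)[OF h]]
        have "matching (B \<inter> ?E1) (r ?E1 (h \<circ> ?t))" "matching (B \<inter> ?E2) (r ?E2 (h \<circ> ?t))"
          unfolding r_def using rem(1)[OF m(1,2)] kE[OF h] by (blast intro: matching_restrict_stable)+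
        moreover have "spherical ?E1 g (B \<inter> ?E1) (r ?E1 (h \<circ> ?t)) = spherical ?E1 g (B \<inter> ?E1) (h \<circ> ?t)"
          by (rule spherical_cong) (simp add: r_def)
        moreover have "spherical ?E2 g (B \<inter> ?E2) (r ?E2 (h \<circ> ?t)) = spherical ?E2 g (B \<inter> ?E2) (h \<circ> ?t)"
          by (rule spherical_cong) (simp add: r_def)
        ultimately show "p \<in> ?G1 \<times> ?G2" using sp m(3) unfolding p gluings_def by simp
      qed
      show "(\<lambda>(k1, k2). k1 \<circ> k2 \<circ> ?t) ` (?G1 \<times> ?G2) \<subseteq> {h \<in> H. \<phi> h = S}"
      proof
        fix h assume "h \<in> (\<lambda>(k1, k2). k1 \<circ> k2 \<circ> ?t) ` (?G1 \<times> ?G2)"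
        then obtain k1 k2 where k: "k1 \<in> ?G1" "k2 \<in> ?G2" and h: "h = k1 \<circ> k2 \<circ> ?t" by auto
        have mk: "matching (B \<inter> ?E1) k1" "matching (B \<inter> ?E2) k2"
          and sk: "spherical ?E1 g (B \<inter> ?E1) k1" "spherical ?E2 g (B \<inter> ?E2) k2"
          using k by (auto simp: gluings_def)
        note sp = split[OF mk]
        have ht: "h \<circ> ?t = k1 \<circ> k2" unfolding h by (rule tt)
        have m: "matching A h" "h a = b"
          using matching_add[OF sp(3)[unfolded B_def] a b ne] h by simp_all
        have r_on: "k1 x = (h \<circ> ?t) x" if "x \<in> ?E1" for x
          using fun_cong[OF sp(1), of x] that unfolding ht by (simp add: r_def)
        have r_on2: "k2 x = (h \<circ> ?t) x" if "x \<in> ?E2" for x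
          using fun_cong[OF sp(2), of x] that unfolding ht by (simp add: r_def)
        have s1: "spherical ?E1 g (B \<inter> ?E1) (h \<circ> ?t)"
          using sk(1) spherical_cong[of ?E1 k1 "h \<circ> ?t" g "B \<inter> ?E1"] r_on by blast
        have s2: "spherical ?E2 g (B \<inter> ?E2) (h \<circ> ?t)"
          using sk(2) spherical_cong[of ?E2 k2 "h \<circ> ?t" g "B \<inter> ?E2"] r_on2 by blast
        have st: "(h \<circ> ?t) ` ?E1 \<subseteq> ?E1" unfolding ht by (rule sp(4))
        have "spherical D f A h" using key[OF m st] s1 s2 by simp
        then have hH: "h \<in> H" using m by (simp add: H_def gluings_def)
        have "E (\<phi> h) = ?E1"
        proof
          have "card (comps ?E1 g (h \<circ> ?t)) = 1" using s1 by (simp add: spherical_def)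
          then have "\<forall>x\<in>?E1. \<forall>y\<in>?E1. (x, y) \<in> conn (link ?E1 g \<union> link ?E1 (h \<circ> ?t))"
            using card_parts_1_iff[of ?E1] aE by blast
          moreover have "link ?E1 g \<union> link ?E1 (h \<circ> ?t) \<subseteq> link D g \<union> link D (h \<circ> ?t)"
            using ED by (auto simp: link_def)
          ultimately have "(a, x) \<in> conn (link D g \<union> link D (h \<circ> ?t))" if "x \<in> ?E1" for x
            using that aE[of S] conn_mono by blast
          then have "?E1 \<subseteq> K h" unfolding K_def by (auto simp: cl_iff)
          then show "?E1 \<subseteq> E (\<phi> h)" using K_eq[OF hH] by simp
          have bijk: "bij_betw (h \<circ> ?t) D D"
            using rem(1)[OF m] AD by (intro matching_bij_betw[of B]) (auto simp: B_def)
          have "K h \<subseteq> ?E1" unfolding K_def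
            by (rule component_subset_stable[OF fin bijg bijk ED gE' st aE])
          then show "E (\<phi> h) \<subseteq> ?E1" using K_eq[OF hH] by simp
        qed
        then have "\<phi> h = S" using \<phi>E[OF S] \<phi>E[of "\<phi> h"] by (simp add: \<phi>_def)
        then show "h \<in> {h \<in> H. \<phi> h = S}" using hH by simp
      qed
    qed
    then have "card {h \<in> H. \<phi> h = S} = card (?G1 \<times> ?G2)" by (rule bij_betw_same_card)
    then show "card {h \<in> H. \<phi> h = S} = card ?G1 * card ?G2" by (simp add: card_cartesian_product)
  qed
  finally show ?thesis by (simp add: H_def)
qed


section \<open>Counting gluings\<close>

text \<open>
  Tutte's recursion for the number of rooted planar maps with a root face of given degree and \<open>m\<close> further
  faces of degree 4. If the root face has degree \<open>q + 1\<close>, the root edge is a bridge, and the \<open>q - 1\<close>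
  remaining sides of the root face are distributed on two maps, or it separates the root face from a
  quadrangle, and its deletion leaves a root face of degree \<open>q + 3\<close>.
\<close>

function disk_count :: "nat \<Rightarrow> nat \<Rightarrow> nat" where
  "disk_count 0 m = (if m = 0 then 1 else 0)"
| "disk_count (Suc q) m =
     (\<Sum>i<q. \<Sum>j\<le>m. disk_count (q - 1 - i) j * disk_count i (m - j)) +
     (if m = 0 then 0 else disk_count (q + 3) (m - 1))"
  by pat_completeness auto
termination
  by (relation "measure (\<lambda>(p, m). p + 4 * m)") auto

text \<open>
  If the root cycle has no side, nothing can be attached to it.
\<close>

lemma gluings_no_root_side:
  assumes fin: "finite D" and bij: "bij_betw f D D" and AD: "A \<subseteq> D"
    and C0: "C0 \<in> cycles D f" and A0: "C0 \<inter> A = {}"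
    and deg: "\<And>C. C \<in> cycles D f - {C0} \<Longrightarrow> card (C \<inter> A) = d"
  shows "card (gluings D f A) = (if card (cycles D f) = 1 then 1 else 0)"
proof (cases "card (cycles D f) = 1")
  case True
  then have one: "cycles D f = {C0}" using C0 by (auto simp: card_1_singleton_iff)
  have "\<Union>(cycles D f) = D" by (rule Union_parts[OF link_stable[OF bij]])
  then have "A = {}" using one A0 AD by blast
  have "spherical D f A id" using True \<open>A = {}\<close> by (simp add: spherical_def comps_id)
  then have "gluings D f A = {id}" using \<open>A = {}\<close> by (auto simp: gluings_def matching_empty)
  then show ?thesis using True by simp
next
  case False
  have "gluings D f A = {}"
  proof (rule equals0I)
    fix h assume "h \<in> gluings D f A"
    then have m: "matching A h" and one: "card (comps D f h) = 1" by (auto simp: gluings_def spherical_def)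
    obtain a where a: "a \<in> D" "C0 = cycle D f a" using C0 by (auto simp: parts_def)
    have "cycles D f \<noteq> {C0}" using False by auto
    then obtain x where x: "x \<in> D" "cycle D f x \<noteq> C0" using a by (auto simp: parts_def)
    have "(a, x) \<in> conn (link D f \<union> link D h)"
      using card_parts_1_iff[of D] one a(1) x(1) by blast
    then have "x \<in> cl (link D f \<union> link D h) a" by (simp add: cl_iff)
    also have "\<dots> \<subseteq> C0"
    proof (rule cl_closed_subset)
      show "a \<in> C0" using a by simp
      fix u v assume "(u, v) \<in> link D f \<union> link D h"
      then have u: "u \<in> D" "v = f u \<or> v = h u" by (auto simp: link_def)
      have "h u \<in> C0 \<longleftrightarrow> u \<in> C0"
      proof (cases "u \<in> A")
        case True
        then have "h u \<in> A" using m by (simp add: matching_def)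
        then show ?thesis using True A0 by blast
      next
        case False
        then show ?thesis using m by (simp add: matching_def)
      qed
      then show "u \<in> C0 \<longleftrightarrow> v \<in> C0" using u cycle_closed[OF u(1), of f a] a(2) by auto
    qed
    finally have "x \<in> cycle D f a" using a by simp
    then show False using x(2) a(2) cl_eq[of x "link D f" a] by simp
  qed
  then show ?thesis using False by simp
qed

text \<open>
  As \<open>b\<close> runs through the other sides of the root face, the number of sides cut off on the side of \<open>b\<close>
  takes every value below \<open>q\<close> once, because the stretches from \<open>a\<close> to \<open>b\<close> are nested.
\<close>

lemma bij_betw_arc_size:
  fixes f :: "'a \<Rightarrow> 'a"
  assumes fin: "finite D" and bij: "bij_betw f D D" and AD: "A \<subseteq> D" and a: "a \<in> A"
    and q: "card (cycle D f a \<inter> A) = Suc q"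
  shows "bij_betw (\<lambda>b. card (cycle D (f \<circ> tau a b) b \<inter> (A - {a, b})))
    (cycle D f a \<inter> A - {a}) {..<q}"
proof -
  let ?g = "\<lambda>b. f \<circ> tau a b"
  let ?X = "cycle D f a \<inter> A - {a}"
  let ?s = "\<lambda>b. card (cycle D (?g b) b \<inter> (A - {a, b}))"
  have aD: "a \<in> D" using a AD by blast
  have finA: "finite A" using fin AD by (rule rev_finite_subset)
  have cX: "card ?X = q" using q a finA by (simp add: card_Diff_subset)
  define k where "k = (\<lambda>b. LEAST n. (f ^^ n) a = b)"
  have k: "(f ^^ k b) a = b" "\<And>i. i < k b \<Longrightarrow> (f ^^ i) a \<noteq> b" if b: "b \<in> ?X" for b
  proof -
    obtain n where n: "(f ^^ n) a = b" using b cycle_eq_funpow[OF fin bij aD] by auto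
    show "(f ^^ k b) a = b" unfolding k_def using n by (rule LeastI)
    show "\<And>i. i < k b \<Longrightarrow> (f ^^ i) a \<noteq> b" unfolding k_def by (rule not_less_Least)
  qed
  have arc: "cycle D (?g b) b = (\<lambda>i. (f ^^ i) a) ` {1..k b}" "a \<notin> cycle D (?g b) b"
    "inj_on (\<lambda>i. (f ^^ i) a) {1..k b}" if b: "b \<in> ?X" for b
  proof -
    have "a \<noteq> b" using b by auto
    note sc = swap_cycle_arc[OF fin bij aD k(1)[OF b] this k(2)[OF b]]
    show "cycle D (?g b) b = (\<lambda>i. (f ^^ i) a) ` {1..k b}" "a \<notin> cycle D (?g b) b"
      "inj_on (\<lambda>i. (f ^^ i) a) {1..k b}" using sc by blast+
  qed
  have s: "card (cycle D (?g b) b \<inter> A) = Suc (?s b)" if b: "b \<in> ?X" for b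
  proof -
    have "cycle D (?g b) b \<inter> A = insert b (cycle D (?g b) b \<inter> (A - {a, b}))"
      using arc(2)[OF b] b by auto
    then show ?thesis using finA by simp
  qed
  have less: "?s b < ?s b'" if b: "b \<in> ?X" and b': "b' \<in> ?X" and "k b < k b'" for b b'
  proof -
    have "cycle D (?g b) b \<subseteq> cycle D (?g b') b'"
      unfolding arc(1)[OF b] arc(1)[OF b'] using \<open>k b < k b'\<close> by (intro image_mono) auto
    moreover have "b' \<notin> cycle D (?g b) b"
    proof
      assume "b' \<in> cycle D (?g b) b"
      then obtain i where i: "i \<in> {1..k b}" "(f ^^ i) a = b'" unfolding arc(1)[OF b] by auto
      then show False using k(2)[OF b', of i] \<open>k b < k b'\<close> by simp
    qed
    moreover have "b' \<in> A" using b' by blast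
    ultimately have "cycle D (?g b) b \<inter> A \<subset> cycle D (?g b') b' \<inter> A"
      using cl_self[of b' "link D (?g b')"] by blast
    then have "card (cycle D (?g b) b \<inter> A) < card (cycle D (?g b') b' \<inter> A)"
      using finA by (intro psubset_card_mono) auto
    then show ?thesis using s[OF b] s[OF b'] by simp
  qed
  have inj: "inj_on ?s ?X"
  proof (rule inj_onI)
    fix b b' assume bb: "b \<in> ?X" "b' \<in> ?X" "?s b = ?s b'"
    then have "k b = k b'" using less[OF bb(1,2)] less[OF bb(2,1)] by linarith
    then have "(f ^^ k b) a = (f ^^ k b') a" by (rule arg_cong[where f = "\<lambda>i. (f ^^ i) a"])
    then show "b = b'" unfolding k(1)[OF bb(1)] k(1)[OF bb(2)] .
  qed
  have "?s ` ?X \<subseteq> {..<q}"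
  proof
    fix y assume "y \<in> ?s ` ?X"
    then obtain b where b: "b \<in> ?X" "y = ?s b" by (rule imageE)
    have "b \<noteq> a" "b \<in> cycle D f a" using b(1) by blast+
    have "cycle D (?g b) b \<subseteq> cycle D f a"
      using cycles_swap_split(2)[OF fin bij aD \<open>b \<in> cycle D f a\<close>] \<open>b \<noteq> a\<close> by blast
    then have "cycle D (?g b) b \<inter> (A - {a, b}) \<subseteq> ?X - {b}" by blast
    then have "?s b \<le> card (?X - {b})" using finA by (intro card_mono) auto
    also have "\<dots> < card ?X" using b(1) finA by (intro psubset_card_mono) auto
    finally show "y \<in> {..<q}" using b cX by simp
  qed
  then have "?s ` ?X = {..<q}"
    by (rule card_subset_eq[OF finite_lessThan]) (use card_image[OF inj] cX in simp)
  then show ?thesis using inj by (simp add: bij_betw_def)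
qed

lemma sum_Pow_card:
  assumes "finite Q"
  shows "(\<Sum>S\<in>Pow Q. g (card S)) = (\<Sum>j\<le>card Q. (card Q choose j) * (g j :: nat))"
proof -
  have "(\<Sum>S\<in>Pow Q. g (card S)) = (\<Sum>j\<le>card Q. \<Sum>S\<in>{S \<in> Pow Q. card S = j}. g (card S))"
    by (rule sum.group[symmetric]) (use assms card_mono in auto)
  also have "\<dots> = (\<Sum>j\<le>card Q. (card Q choose j) * g j)"
  proof (rule sum.cong[OF refl])
    fix j
    have "card {S \<in> Pow Q. card S = j} = card Q choose j" using n_subsets[OF assms, of j] by simp
    then show "(\<Sum>S\<in>{S \<in> Pow Q. card S = j}. g (card S)) = (card Q choose j) * g j" by simp
  qed
  finally show ?thesis .
qed

lemma insert_pair_split: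
  "X = Y \<union> Z \<Longrightarrow> a \<in> X \<Longrightarrow> b \<in> X \<Longrightarrow> a \<in> A \<Longrightarrow> b \<in> A \<Longrightarrow>
    X \<inter> A = insert a (insert b ((Y \<inter> (A - {a, b})) \<union> (Z \<inter> (A - {a, b}))))"
  by blast

text \<open>
  The quadrangles of the fixed permutation are distinguishable and so are their sides, whence the
  factor \<open>m! * 4 ^ m\<close>. The induction is on the number of sides: an edge that starts at the fixed side \<open>a\<close>
  of the root face is deleted for each of its possible other ends \<open>b\<close>. A bridge reaches one of the sides
  on the root face and distributes the quadrangles in all ways, and any other edge reaches one of the
  \<open>4 * m\<close> sides of the quadrangles.
\<close>

theorem card_gluings:
  assumes fin: "finite D"
  assumes "bij_betw f D D" "A \<subseteq> D" "C0 \<in> cycles D f" "card (C0 \<inter> A) = p"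
    and "\<And>C. C \<in> cycles D f - {C0} \<Longrightarrow> card (C \<inter> A) = 4"
    and "card (cycles D f) = Suc m"
  shows "card (gluings D f A) = fact m * 4 ^ m * disk_count p m"
  using assms
proof (induction "card A" arbitrary: D f A C0 p m rule: less_induct)
  case less
  note fin = \<open>finite D\<close> and bij = \<open>bij_betw f D D\<close> and AD = \<open>A \<subseteq> D\<close> and C0 = \<open>C0 \<in> cycles D f\<close>
    and p = \<open>card (C0 \<inter> A) = p\<close> and deg = less.prems(6) and m = \<open>card (cycles D f) = Suc m\<close>
  have finA: "finite A" using fin AD by (rule rev_finite_subset)
  show ?case
  proof (cases p)
    case 0
    then have "C0 \<inter> A = {}" using p finA by simp
    then show ?thesis using gluings_no_root_side[OF fin bij AD C0 _ deg] m 0 by simp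
  next
    case (Suc q)
    then have "C0 \<inter> A \<noteq> {}" using p by auto
    then obtain a where a: "a \<in> C0" "a \<in> A" by blast
    then have aD: "a \<in> D" using AD by blast
    have C0a: "C0 = cycle D f a" by (rule parts_eq_cl[OF C0 a(1)])
    define Q where "Q = cycles D f - {C0}"
    have finQ: "finite Q" using fin by (simp add: Q_def)
    have cQ: "card Q = m" using m C0 fin by (simp add: Q_def card_Diff_subset)
    define N where "N = (\<lambda>b. card {h \<in> gluings D f A. h a = b})"
    have "card (gluings D f A) = (\<Sum>h\<in>gluings D f A. 1)" by simp
    also have "\<dots> = (\<Sum>b\<in>A - {a}. \<Sum>h\<in>{h \<in> gluings D f A. h a = b}. 1)"
      by (rule sum.group[symmetric])
        (use finA finite_gluings[OF finA] a in \<open>auto simp: gluings_def matching_def\<close>)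
    also have "\<dots> = (\<Sum>b\<in>A - {a}. N b)" by (simp add: N_def)
    also have "A - {a} = (C0 \<inter> A - {a}) \<union> (A - C0)" using a by blast
    also have "(\<Sum>b\<in>\<dots>. N b) = (\<Sum>b\<in>C0 \<inter> A - {a}. N b) + (\<Sum>b\<in>A - C0. N b)"
      by (rule sum.union_disjoint) (use finA in auto)
    finally have total: "card (gluings D f A) = (\<Sum>b\<in>C0 \<inter> A - {a}. N b) + (\<Sum>b\<in>A - C0. N b)" .

    \<comment> \<open>Other ends on the root face give bridges.\<close>
    have "(\<Sum>b\<in>C0 \<inter> A - {a}. N b) =
        (\<Sum>b\<in>C0 \<inter> A - {a}. fact m * 4 ^ m *
          (\<Sum>j\<le>m. disk_count (q - 1 - card (cycle D (f \<circ> tau a b) b \<inter> (A - {a, b}))) j *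
            disk_count (card (cycle D (f \<circ> tau a b) b \<inter> (A - {a, b}))) (m - j)))"
    proof (rule sum.cong[OF refl])
      fix b assume b: "b \<in> C0 \<inter> A - {a}"
      then have bA: "b \<in> A" and ne: "a \<noteq> b" and bC: "b \<in> cycle D f a" using C0a by auto
      have bD: "b \<in> D" using bA AD by blast
      define g where "g = f \<circ> tau a b"
      define B where "B = A - {a, b}"
      let ?C1 = "cycle D g a" and ?C2 = "cycle D g b"
      let ?i = "card (?C2 \<inter> B)"
      have cB: "card A = card B + 2" unfolding B_def using finA a(2) bA ne by (rule card_remove2)
      have finB: "finite B" using finA by (simp add: B_def)
      have bijg: "bij_betw g D D" unfolding g_def using bij aD bD by (rule bij_betw_swap)
      note sp = cycles_swap_split[OF fin bij aD bC ne, folded g_def]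
      have Qg: "Q = cycles D g - {?C1, ?C2}"
        unfolding Q_def C0a g_def by (rule cycles_swap_split'[OF fin bij aD bC ne])
      have C12: "?C1 \<in> cycles D g" "?C2 \<in> cycles D g" using aD bD by simp_all
      have C12ne: "?C1 \<noteq> ?C2" using sp(3) cl_self[of a "link D g"] by blast
      have degB: "card (C \<inter> B) = 4" if "C \<in> Q" for C
      proof -
        have C: "C \<in> cycles D g" "C \<noteq> ?C1" "C \<noteq> ?C2" using that Qg by auto
        then have "a \<notin> C" "b \<notin> C" using parts_eq_cl[OF C(1)] by auto
        then have "C \<inter> B = C \<inter> A" by (auto simp: B_def)
        then show ?thesis using deg that by (simp add: Q_def)
      qed
      \<comment> \<open>Of the \<open>q + 1\<close> sides of the root face, \<open>a\<close> and \<open>b\<close> are used up.\<close>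
      have sum_deg: "card (?C1 \<inter> B) = q - 1 - ?i"
      proof -
        have "C0 \<inter> A = insert a (insert b ((?C1 \<inter> B) \<union> (?C2 \<inter> B)))"
          unfolding B_def
          by (rule insert_pair_split) (use sp(2) C0a a bA bC in simp_all)
        moreover have "a \<notin> insert b ((?C1 \<inter> B) \<union> (?C2 \<inter> B))" "b \<notin> (?C1 \<inter> B) \<union> (?C2 \<inter> B)"
          using ne by (auto simp: B_def)
        ultimately have "card (C0 \<inter> A) = Suc (Suc (card ((?C1 \<inter> B) \<union> (?C2 \<inter> B))))"
          using finB by simp
        also have "card ((?C1 \<inter> B) \<union> (?C2 \<inter> B)) = card (?C1 \<inter> B) + ?i"
          using finB sp(3) by (intro card_Un_disjoint) auto
        finally show ?thesis using p Suc by simp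
      qed
      have IH: "card (gluings X g (B \<inter> X)) = fact (card P - 1) * 4 ^ (card P - 1) * disk_count (card (C \<inter> B)) (card P - 1)"
        if X: "X \<subseteq> D" "bij_betw g X X" "cycles X g = P" and C: "C \<in> P" "P - {C} \<subseteq> Q" for X P C
      proof -
        have finX: "finite X" using fin X(1) by (rule rev_finite_subset)
        have sub: "C' \<subseteq> X" if "C' \<in> P" for C'
          using that parts_subset[OF link_stable[OF X(2)]] X(3) by blast
        have int: "C' \<inter> (B \<inter> X) = C' \<inter> B" if "C' \<in> P" for C' using sub[OF that] by blast
        have "card (B \<inter> X) \<le> card B" using finB by (intro card_mono) auto
        then have lt: "card (B \<inter> X) < card A" using cB by simp
        have finP: "finite P" using finX X(3) finite_parts by blast
        then have "card P \<noteq> 0" using C(1) by auto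
        then have cP: "card (cycles X g) = Suc (card P - 1)" using X(3) by simp
        have deg': "card (C' \<inter> (B \<inter> X)) = 4" if "C' \<in> cycles X g - {C}" for C'
        proof -
          have "C' \<in> P" "C' \<in> Q" using that X(3) C(2) by auto
          then show ?thesis using int degB by simp
        qed
        have "C \<in> cycles X g" using X(3) C(1) by simp
        moreover have "card (C \<inter> (B \<inter> X)) = card (C \<inter> B)" using int[OF C(1)] by simp
        ultimately show ?thesis
          by (intro less.hyps[OF lt finX X(2) _ _ _ deg' cP]) auto
      qed
      define E where "E = (\<lambda>S. ?C1 \<union> \<Union>S)"
      have "N b = (\<Sum>S\<in>Pow Q. card (gluings (E S) g (B \<inter> E S)) * card (gluings (D - E S) g (B \<inter> (D - E S))))"
        unfolding N_def E_def B_def g_def Q_def C0a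
        by (rule card_bridge_gluings[OF fin bij AD a(2) bA ne bC])
      also have "\<dots> = (\<Sum>S\<in>Pow Q. (fact (card S) * 4 ^ card S * disk_count (q - 1 - ?i) (card S)) *
          (fact (m - card S) * 4 ^ (m - card S) * disk_count ?i (m - card S)))"
      proof (rule sum.cong[OF refl])
        fix S assume "S \<in> Pow Q"
        then have S: "S \<subseteq> Q" by blast
        have finS: "finite S" using finQ S by (rule rev_finite_subset)
        let ?P = "insert ?C1 S"
        have P: "?P \<subseteq> cycles D g" using S Qg C12 by blast
        have EU: "E S = \<Union>?P" by (simp add: E_def)
        note part = cycles_partition[OF fin bijg P, folded EU]
        have "?C1 \<notin> S" using S Qg by blast
        then have c1: "card ?P - 1 = card S" using finS by simp
        have compl: "cycles D g - ?P = insert ?C2 (Q - S)"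
          using S Qg C12 C12ne by blast
        have "?C2 \<notin> Q - S" using Qg by blast
        then have "card (cycles D g - ?P) - 1 = card (Q - S)" unfolding compl using finQ by simp
        then have c2: "card (cycles D g - ?P) - 1 = m - card S"
          using card_Diff_subset[OF finS S] cQ by simp
        have "card (gluings (E S) g (B \<inter> E S)) = fact (card S) * 4 ^ card S * disk_count (q - 1 - ?i) (card S)"
          using IH[OF part(1,2,3), of ?C1] S unfolding c1 sum_deg by blast
        moreover have "card (gluings (D - E S) g (B \<inter> (D - E S))) =
            fact (m - card S) * 4 ^ (m - card S) * disk_count ?i (m - card S)"
          using IH[OF _ part(4,5), of ?C2] unfolding c2 unfolding compl by blast
        ultimately show "card (gluings (E S) g (B \<inter> E S)) * card (gluings (D - E S) g (B \<inter> (D - E S))) =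
          (fact (card S) * 4 ^ card S * disk_count (q - 1 - ?i) (card S)) *
          (fact (m - card S) * 4 ^ (m - card S) * disk_count ?i (m - card S))" by simp
      qed
      also have "\<dots> = (\<Sum>j\<le>m. (m choose j) * ((fact j * 4 ^ j * disk_count (q - 1 - ?i) j) *
          (fact (m - j) * 4 ^ (m - j) * disk_count ?i (m - j))))"
        using sum_Pow_card[OF finQ, of "\<lambda>j. (fact j * 4 ^ j * disk_count (q - 1 - ?i) j) *
          (fact (m - j) * 4 ^ (m - j) * disk_count ?i (m - j))"] unfolding cQ .
      also have "\<dots> = (\<Sum>j\<le>m. fact m * 4 ^ m * (disk_count (q - 1 - ?i) j * disk_count ?i (m - j)))"
      proof (rule sum.cong[OF refl])
        fix j assume "j \<in> {..m}"
        then have j: "j \<le> m" by simp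
        have f: "fact j * fact (m - j) * (m choose j) = fact m" using binomial_fact_lemma[OF j] .
        have "(4::nat) ^ j * 4 ^ (m - j) = 4 ^ m" using j by (simp flip: power_add)
        then have "fact m * 4 ^ m = (fact j * fact (m - j) * (m choose j)) * ((4::nat) ^ j * 4 ^ (m - j))"
          using f by simp
        then show "(m choose j) * ((fact j * 4 ^ j * disk_count (q - 1 - ?i) j) *
            (fact (m - j) * 4 ^ (m - j) * disk_count ?i (m - j))) =
          fact m * 4 ^ m * (disk_count (q - 1 - ?i) j * disk_count ?i (m - j))" by (simp add: mult_ac)
      qed
      finally show "N b = fact m * 4 ^ m *
          (\<Sum>j\<le>m. disk_count (q - 1 - card (cycle D (f \<circ> tau a b) b \<inter> (A - {a, b}))) j *
            disk_count (card (cycle D (f \<circ> tau a b) b \<inter> (A - {a, b}))) (m - j))"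
        by (simp add: sum_distrib_left g_def B_def)
    qed
    also have "\<dots> = (\<Sum>i<q. fact m * 4 ^ m * (\<Sum>j\<le>m. disk_count (q - 1 - i) j * disk_count i (m - j)))"
      unfolding C0a
      by (rule sum.reindex_bij_betw[OF bij_betw_arc_size[OF fin bij AD a(2)],
          where g = "\<lambda>i. fact m * 4 ^ m * (\<Sum>j\<le>m. disk_count (q - 1 - i) j * disk_count i (m - j))"])
        (use p Suc C0a in simp)
    finally have bridges: "(\<Sum>b\<in>C0 \<inter> A - {a}. N b) =
        fact m * 4 ^ m * (\<Sum>i<q. \<Sum>j\<le>m. disk_count (q - 1 - i) j * disk_count i (m - j))"
      by (simp add: sum_distrib_left)

    \<comment> \<open>Other ends on a quadrangle merge it into the root face.\<close>
    have "(\<Sum>b\<in>A - C0. N b) = (\<Sum>b\<in>A - C0. fact (m - 1) * 4 ^ (m - 1) * disk_count (q + 3) (m - 1))"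
    proof (rule sum.cong[OF refl])
      fix b assume b: "b \<in> A - C0"
      then have bA: "b \<in> A" and bC: "b \<notin> cycle D f a" using C0a by auto
      have ne: "a \<noteq> b" using bC by auto
      have bD: "b \<in> D" using bA AD by blast
      define g where "g = f \<circ> tau a b"
      define B where "B = A - {a, b}"
      have cB: "card A = card B + 2" unfolding B_def using finA a(2) bA ne by (rule card_remove2)
      have finB: "finite B" using finA by (simp add: B_def)
      have bijg: "bij_betw g D D" unfolding g_def using bij aD bD by (rule bij_betw_swap)
      let ?C = "cycle D f b"
      have CQ: "?C \<in> Q" using bD bC C0a cl_self[of b "link D f"] by (auto simp: Q_def)
      note mg = cycles_swap_merge[OF fin bij aD bD bC, folded g_def C0a]
      have disj: "C0 \<inter> ?C = {}" using parts_disjoint[OF C0] CQ by (auto simp: Q_def)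
      have "Q \<noteq> {}" using CQ by blast
      then have "m \<noteq> 0" using cQ finQ card_eq_0_iff[of Q] by simp
      then have cg: "card (cycles D g) = Suc (m - 1)" using mg(2) m by simp
      \<comment> \<open>The root face keeps \<open>q\<close> sides and gains three from the quadrangle of \<open>b\<close>.\<close>
      have cU: "card ((C0 \<union> ?C) \<inter> B) = q + 3"
      proof -
        have "(C0 \<union> ?C) \<inter> B = (C0 \<inter> A - {a}) \<union> (?C \<inter> A - {b})"
          using b disj a(1) cl_self[of b "link D f"] by (auto simp: B_def)
        moreover have "card ((C0 \<inter> A - {a}) \<union> (?C \<inter> A - {b})) = card (C0 \<inter> A - {a}) + card (?C \<inter> A - {b})"
          using finA disj by (intro card_Un_disjoint) auto
        moreover have "card (C0 \<inter> A - {a}) = q" using p Suc a by (simp add: card_Diff_subset)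
        moreover have "card (?C \<inter> A) = 4" using deg CQ by (simp add: Q_def)
        then have "card (?C \<inter> A - {b}) = 3" using bA by (simp add: card_Diff_subset)
        ultimately show ?thesis by simp
      qed
      have "N b = card (gluings D g B)"
        unfolding N_def g_def B_def by (rule card_nonbridge_gluings[OF fin bij AD a(2) bA bC])
      also have "\<dots> = fact (m - 1) * 4 ^ (m - 1) * disk_count (q + 3) (m - 1)"
      proof (rule less.hyps[OF _ fin bijg _ _ cU _ cg])
        show "card B < card A" using cB by simp
        show "B \<subseteq> D" using AD by (auto simp: B_def)
        show "C0 \<union> ?C \<in> cycles D g" unfolding mg(1) by simp
        fix C assume "C \<in> cycles D g - {C0 \<union> ?C}"
        then have C: "C \<in> cycles D f" "C \<noteq> C0" "C \<noteq> ?C" unfolding mg(1) by auto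
        then have "a \<notin> C" "b \<notin> C" using parts_eq_cl[OF C(1)] C0a by auto
        then have "C \<inter> B = C \<inter> A" by (auto simp: B_def)
        then show "card (C \<inter> B) = 4" using deg C by simp
      qed
      finally show "N b = fact (m - 1) * 4 ^ (m - 1) * disk_count (q + 3) (m - 1)" .
    qed
    also have "\<dots> = card (A - C0) * (fact (m - 1) * 4 ^ (m - 1) * disk_count (q + 3) (m - 1))" by simp
    also have "card (A - C0) = 4 * m"
    proof -
      have "\<Union>(cycles D f) = D" by (rule Union_parts[OF link_stable[OF bij]])
      then have "A - C0 = (\<Union>C\<in>Q. C \<inter> A)"
        using AD parts_disjoint[OF C0] by (fastforce simp: Q_def)
      also have "card \<dots> = (\<Sum>C\<in>Q. card (C \<inter> A))"
      proof (rule card_UN_disjoint[OF finQ])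
        show "\<forall>C\<in>Q. finite (C \<inter> A)" using finA by simp
        show "\<forall>C\<in>Q. \<forall>C'\<in>Q. C \<noteq> C' \<longrightarrow> C \<inter> A \<inter> (C' \<inter> A) = {}"
        proof (intro ballI impI)
          fix C C' assume "C \<in> Q" "C' \<in> Q" "C \<noteq> C'"
          then have "C \<inter> C' = {}" using parts_disjoint[of C D "link D f" C'] by (simp add: Q_def)
          then show "C \<inter> A \<inter> (C' \<inter> A) = {}" by blast
        qed
      qed
      also have "\<dots> = (\<Sum>C\<in>Q. 4)" by (rule sum.cong[OF refl]) (simp add: deg Q_def)
      finally show ?thesis using cQ by simp
    qed
    finally have others: "(\<Sum>b\<in>A - C0. N b) = (if m = 0 then 0 else fact m * 4 ^ m * disk_count (q + 3) (m - 1))"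
      by (cases m) (simp_all add: algebra_simps)
    show ?thesis unfolding total bridges others Suc disk_count.simps by (simp add: distrib_left)
  qed
qed


section \<open>Catalan numbers\<close>

fun catalan :: "nat \<Rightarrow> nat" where
  "catalan 0 = 1"
| "catalan (Suc n) = (\<Sum>i\<le>n. catalan i * catalan (n - i))"

definition catalan_fps :: "real fps" where
  "catalan_fps = Abs_fps (\<lambda>n. real (catalan n))"

lemma catalan_fps_eq: "catalan_fps = 1 + fps_X * catalan_fps\<^sup>2"
proof (rule fps_ext)
  fix n
  show "fps_nth catalan_fps n = fps_nth (1 + fps_X * catalan_fps\<^sup>2) n"
    by (cases n) (simp_all add: catalan_fps_def power2_eq_square atLeast0AtMost
      fps_mult_nth[of "Abs_fps f" "Abs_fps f" for f])
qed

text \<open>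
  The quadratic equation of the series yields a linear differential equation, whose coefficients give
  a two-term recurrence.
\<close>

lemma catalan_rec: "(real n + 2) * real (catalan (Suc n)) = (4 * real n + 2) * real (catalan n)"
proof -
  let ?C = catalan_fps and ?X = "fps_X :: real fps"
  have eq: "?C = 1 + ?X * ?C\<^sup>2" by (rule catalan_fps_eq)
  have d: "fps_deriv ?C = ?C\<^sup>2 + 2 * ?X * ?C * fps_deriv ?C"
    by (subst (1) eq) (simp add: power2_eq_square algebra_simps)
  have "?X * (1 - 4 * ?X) * fps_deriv ?C = 1 - ?C + 2 * ?X * ?C"
    using eq d by algebra
  then have ode: "?X * fps_deriv ?C - 4 * (?X * (?X * fps_deriv ?C)) = 1 - ?C + 2 * (?X * ?C)"
    by (simp add: algebra_simps)
  have "fps_nth (?X * fps_deriv ?C - 4 * (?X * (?X * fps_deriv ?C))) (Suc n) =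
    fps_nth (1 - ?C + 2 * (?X * ?C)) (Suc n)" by (simp only: ode)
  moreover have "fps_nth (4 * f) k = 4 * fps_nth f k" "fps_nth (2 * f) k = 2 * fps_nth f k" for f :: "real fps" and k
    by (simp_all add: numeral_fps_const)
  ultimately show ?thesis
    by (cases n) (simp_all add: catalan_fps_def algebra_simps)
qed

lemma catalan_binomial: "real (catalan n) = real ((2 * n) choose n) / (real n + 1)"
proof (induction n)
  case (Suc n)
  define X Y Z where "X = 2 * Suc n choose Suc n" and "Y = Suc (2 * n) choose n" and "Z = 2 * n choose n"
  have "Suc n * X = (2 * n + 2) * Y"
    using Suc_times_binomial[of n "2 * n + 1"] by (simp add: X_def Y_def)
  moreover have "Suc n * Y = (2 * n + 1) * Z"
    using Suc_times_binomial[of n "2 * n"] binomial_symmetric[of "Suc n" "Suc (2 * n)"]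
    by (simp add: Y_def Z_def)
  ultimately have XY: "real (Suc n * X) = real ((2 * n + 2) * Y)" "real (Suc n * Y) = real ((2 * n + 1) * Z)"
    by (simp_all only:)
  have "(real n + 1) * real X = 2 * ((real n + 1) * real Y)"
    using XY(1) by (simp add: algebra_simps)
  also have "(real n + 1) * real Y = (2 * real n + 1) * real Z"
    using XY(2) by (simp add: algebra_simps)
  finally have b: "(real n + 1) * real (2 * Suc n choose Suc n) = (4 * real n + 2) * real (2 * n choose n)"
    unfolding X_def Z_def by (simp add: algebra_simps)
  have "(real n + 2) * real (catalan (Suc n)) = (4 * real n + 2) * (real (2 * n choose n) / (real n + 1))"
    using catalan_rec[of n] Suc.IH by simp
  also have "\<dots> = real (2 * Suc n choose Suc n)"
    using b by (simp add: field_simps)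
  finally show ?case by (simp add: field_simps del: catalan.simps)
qed simp


section \<open>Solving the recursion for the number of quadrangulated discs\<close>

text \<open>
  The series \<open>R = T(z)\<close>. Its inner variable \<open>z\<close> marks quadrangles when it is used for discs.
\<close>

definition tree_fps :: "real fps" where
  "tree_fps = Abs_fps (\<lambda>n. 3 ^ n * real (catalan n))"

lemma tree_fps_nth [simp]: "fps_nth tree_fps n = 3 ^ n * real (catalan n)"
  by (simp add: tree_fps_def)

lemma tree_fps_eq: "tree_fps = 1 + 3 * fps_X * tree_fps\<^sup>2"
proof (rule fps_ext)
  fix n
  show "fps_nth tree_fps n = fps_nth (1 + 3 * fps_X * tree_fps\<^sup>2) n"
  proof (cases n)
    case (Suc k)
    have "fps_nth (1 + 3 * fps_X * tree_fps\<^sup>2) (Suc k) = 3 * fps_nth (tree_fps\<^sup>2) k"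
      by (simp add: numeral_fps_const mult.assoc)
    also have "\<dots> = 3 * (\<Sum>i\<le>k. 3 ^ i * real (catalan i) * (3 ^ (k - i) * real (catalan (k - i))))"
      by (simp add: power2_eq_square fps_mult_nth atLeast0AtMost)
    also have "\<dots> = (\<Sum>i\<le>k. 3 ^ Suc k * (real (catalan i) * real (catalan (k - i))))"
      unfolding sum_distrib_left
    proof (rule sum.cong[OF refl])
      fix i assume "i \<in> {..k}"
      then have "(3::real) ^ i * 3 ^ (k - i) = 3 ^ k" by (simp flip: power_add)
      then have "(3::real) ^ Suc k = 3 * (3 ^ i * 3 ^ (k - i))" by simp
      then show "3 * (3 ^ i * real (catalan i) * (3 ^ (k - i) * real (catalan (k - i)))) =
        3 ^ Suc k * (real (catalan i) * real (catalan (k - i)))" by (simp only: mult_ac)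
    qed
    finally show ?thesis using Suc by (simp add: sum_distrib_left)
  qed simp
qed

text \<open>
  The Catalan series at \<open>x * R\<close>, where \<open>R\<close> is \<open>tree_fps\<close> and the outer variable \<open>x\<close> marks half the
  perimeter of the root face.
\<close>

definition binary_fps :: "real fps fps" where
  "binary_fps = Abs_fps (\<lambda>p. of_nat (catalan p) * tree_fps ^ p)"

lemma binary_fps_eq: "binary_fps = 1 + fps_const tree_fps * fps_X * binary_fps\<^sup>2"
proof (rule fps_ext)
  fix n
  show "fps_nth binary_fps n = fps_nth (1 + fps_const tree_fps * fps_X * binary_fps\<^sup>2) n"
  proof (cases n)
    case (Suc k)
    have "fps_nth (1 + fps_const tree_fps * fps_X * binary_fps\<^sup>2) (Suc k) = tree_fps * fps_nth (binary_fps\<^sup>2) k"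
      by (simp add: mult.assoc)
    also have "\<dots> = tree_fps * (\<Sum>i\<le>k. (of_nat (catalan i) * tree_fps ^ i) * (of_nat (catalan (k - i)) * tree_fps ^ (k - i)))"
      by (simp add: power2_eq_square fps_mult_nth atLeast0AtMost binary_fps_def)
    also have "\<dots> = (\<Sum>i\<le>k. tree_fps ^ Suc k * (of_nat (catalan i) * of_nat (catalan (k - i))))"
      unfolding sum_distrib_left
    proof (rule sum.cong[OF refl])
      fix i assume "i \<in> {..k}"
      then have "tree_fps ^ i * tree_fps ^ (k - i) = tree_fps ^ k" by (simp flip: power_add)
      then have "tree_fps ^ Suc k = tree_fps * (tree_fps ^ i * tree_fps ^ (k - i))" by simp
      then show "tree_fps * (of_nat (catalan i) * tree_fps ^ i * (of_nat (catalan (k - i)) * tree_fps ^ (k - i))) =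
        tree_fps ^ Suc k * (of_nat (catalan i) * of_nat (catalan (k - i)))" by (simp only: mult_ac)
    qed
    finally show ?thesis using Suc
      by (simp add: binary_fps_def sum_distrib_left mult.commute)
  qed (simp add: binary_fps_def)
qed

definition disk_coeff :: "real fps" where
  "disk_coeff = fps_const (1/3) * (tree_fps - 1) * tree_fps"

text \<open>
  The series of all \<open>disk_count (2 * p) m * z ^ m * x ^ p\<close>. Its coefficient at \<open>x ^ p\<close> is the known
  \<open>catalan p * R ^ p * (2 * p + 2 - p * R) / (p + 2)\<close>. The form used here comes from rewriting the
  last factor as \<open>1 - (R - 1) * p / (p + 2)\<close>, since the numbers \<open>3 * catalan p * p / (p + 2)\<close> are the
  coefficients of \<open>x\<close> times the cube of the Catalan series.
\<close>

definition disk_fps :: "real fps fps" where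
  "disk_fps = binary_fps - fps_const disk_coeff * fps_X * binary_fps ^ 3"

lemma disk_coeff_3: "3 * disk_coeff = (tree_fps - 1) * tree_fps"
proof -
  have "3 * fps_const (1/3::real) = 1" by (simp add: numeral_fps_const)
  then show ?thesis unfolding disk_coeff_def by (metis mult.assoc mult_1)
qed

lemma disk_fps_0 [simp]: "fps_nth disk_fps 0 = 1"
  by (simp add: disk_fps_def binary_fps_def mult.assoc)

lemma disk_fps_1: "fps_nth disk_fps 1 = tree_fps - disk_coeff"
proof -
  have "fps_nth binary_fps 0 = 1" "fps_nth binary_fps 1 = tree_fps" by (simp_all add: binary_fps_def)
  then show ?thesis by (simp add: disk_fps_def mult.assoc fps_power_zeroth)
qed

lemma disk_fps_nth_0: "fps_nth (fps_nth disk_fps n) 0 = real (catalan n)"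
proof -
  have c: "fps_nth disk_coeff 0 = 0" by (simp add: disk_coeff_def)
  have p: "fps_nth (tree_fps ^ n) 0 = 1" by (induction n) simp_all
  have "fps_nth (of_nat k :: real fps) 0 = real k" for k by (simp add: fps_of_nat[symmetric])
  then show ?thesis
    by (simp add: disk_fps_def binary_fps_def c p mult.assoc)
qed

text \<open>
  Tutte's functional equation for \<open>F\<close>, multiplied by \<open>9 * r\<^sup>2\<close> to clear the denominators of
  \<open>z = (r - 1) / (3 * r\<^sup>2)\<close> and of \<open>c\<close>. In the variables \<open>y = r * x\<close> and \<open>e = r - 1\<close> it is a polynomial of
  degree two in \<open>e\<close>, and each of its coefficients vanishes because of \<open>d = 1 + y * d\<^sup>2\<close>.
\<close>

lemma disk_equation_ring:
  fixes r x d F f1 z :: "'a :: idom"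
  assumes d: "d = 1 + r * x * d\<^sup>2" and c: "3 * c = (r - 1) * r" and F: "F = d - c * x * d ^ 3"
    and f1: "f1 = r - c" and z: "r = 1 + 3 * z * r\<^sup>2"
  shows "9 * r\<^sup>2 * (x * F - x - x\<^sup>2 * F\<^sup>2 - z * (F - 1 - x * f1)) = 0"
proof -
  define y e G where "y = r * x" and "e = r - 1" and "G = 3 * d - e * y * d ^ 3"
  have dy: "d = 1 + y * d\<^sup>2" using d by (simp add: y_def)
  have re: "r = 1 + e" by (simp add: e_def)
  have "3 * F = 3 * d - (3 * c) * x * d ^ 3" by (simp add: F algebra_simps)
  then have G: "3 * F = G" unfolding c by (simp add: G_def y_def e_def mult_ac)
  have "3 * f1 = 3 * r - 3 * c" by (simp add: f1 algebra_simps)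
  then have "x * (3 * f1) = x * (3 * r - (r - 1) * r)" unfolding c by simp
  then have f1': "x * (3 * f1) = 3 * y - e * y" by (simp add: y_def e_def algebra_simps)
  have z': "3 * z * r\<^sup>2 = e" using z by (simp add: e_def algebra_simps)
  have "9 * r\<^sup>2 * (x * F - x - x\<^sup>2 * F\<^sup>2 - z * (F - 1 - x * f1)) =
      3 * r * y * (3 * F) - 9 * r * y - y\<^sup>2 * (3 * F)\<^sup>2 - (3 * z * r\<^sup>2) * (3 * F - 3 - x * (3 * f1))"
    by (simp add: y_def algebra_simps power2_eq_square)
  also have "\<dots> = 3 * (1 + e) * y * G - 9 * (1 + e) * y - y\<^sup>2 * G\<^sup>2 - e * (G - 3 - (3 * y - e * y))"
    unfolding G f1' z' unfolding re ..
  also have "\<dots> = 9 * y * (d - 1 - y * d\<^sup>2)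
      + e * (9 * y * d - 3 * y\<^sup>2 * d ^ 3 - 6 * y + 6 * y ^ 3 * d ^ 4 - 3 * d + 3)
      + e\<^sup>2 * (y * d ^ 3 - 3 * y\<^sup>2 * d ^ 3 - y ^ 4 * d ^ 6 - y)"
    unfolding G_def by algebra
  also have "9 * y * d - 3 * y\<^sup>2 * d ^ 3 - 6 * y + 6 * y ^ 3 * d ^ 4 - 3 * d + 3 = 0"
    using dy by algebra
  also have "y * d ^ 3 - 3 * y\<^sup>2 * d ^ 3 - y ^ 4 * d ^ 6 - y = 0"
    using dy by algebra
  also have "d - 1 - y * d\<^sup>2 = 0" using dy by algebra
  finally show ?thesis by simp
qed

text \<open>
  The functional equation read coefficientwise is the recursion of \<open>disk_count\<close> for even perimeters.
\<close>

lemma disk_fps_rec: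
  "fps_nth disk_fps (Suc p) =
     (\<Sum>i\<le>p. fps_nth disk_fps i * fps_nth disk_fps (p - i)) + fps_X * fps_nth disk_fps (p + 2)"
proof -
  let ?r = "fps_const tree_fps" and ?F = disk_fps and ?x = "fps_X :: real fps fps"
    and ?z = "fps_const fps_X :: real fps fps" and ?f1 = "fps_const (fps_nth disk_fps 1)"
  have three: "fps_const (3 :: real fps) = 3" by (simp add: numeral_fps_const)
  have one: "fps_const (1 :: real fps) = 1" by simp
  have c: "3 * fps_const disk_coeff = (?r - 1) * ?r"
    unfolding three[symmetric] one[symmetric] fps_const_sub fps_const_mult disk_coeff_3 ..
  have z: "?r = 1 + 3 * ?z * ?r\<^sup>2"
  proof -
    have "?r = fps_const (1 + 3 * fps_X * tree_fps\<^sup>2)" using tree_fps_eq by simp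
    then show ?thesis
      unfolding three[symmetric] one[symmetric] power2_eq_square fps_const_mult fps_const_add .
  qed
  have f1: "?f1 = ?r - fps_const disk_coeff" unfolding disk_fps_1 by simp
  have "9 * ?r\<^sup>2 * (?x * ?F - ?x - ?x\<^sup>2 * ?F\<^sup>2 - ?z * (?F - 1 - ?x * ?f1)) = 0"
    by (rule disk_equation_ring[OF binary_fps_eq c disk_fps_def f1 z])
  moreover have "fps_nth tree_fps 0 \<noteq> 0" by simp
  then have "tree_fps \<noteq> 0" by (metis fps_zero_nth)
  ultimately have "?x * ?F - ?x - ?x\<^sup>2 * ?F\<^sup>2 - ?z * (?F - 1 - ?x * ?f1) = 0"
    by simp
  then have eq: "?x * ?F = ?x + ?x * (?x * ?F\<^sup>2) + ?z * (?F - 1 - ?x * ?f1)"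
    by (simp add: algebra_simps power2_eq_square)
  have "fps_nth (?x * ?F) (Suc (Suc p)) = fps_nth (?x + ?x * (?x * ?F\<^sup>2) + ?z * (?F - 1 - ?x * ?f1)) (Suc (Suc p))"
    by (simp only: eq)
  then show ?thesis
    by (simp add: power2_eq_square fps_mult_nth[of ?F ?F] atLeast0AtMost)
qed

lemma sum_even_only:
  fixes g :: "nat \<Rightarrow> 'a :: comm_monoid_add"
  assumes "\<And>i. odd i \<Longrightarrow> g i = 0"
  shows "(\<Sum>i<2 * p + 1. g i) = (\<Sum>a\<le>p. g (2 * a))"
proof (induction p)
  case (Suc p)
  have "(\<Sum>i<2 * Suc p + 1. g i) = (\<Sum>i<2 * p + 1. g i) + g (2 * p + 1) + g (2 * p + 2)"
    by (simp add: add.assoc)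
  then show ?case using Suc.IH assms[of "2 * p + 1"] by simp
qed simp

text \<open>
  The recursion has only one solution. Odd perimeters do not occur, since the sides are paired off.
\<close>

lemma disk_count_eq:
  "real (disk_count q m) = (if even q then fps_nth (fps_nth disk_fps (q div 2)) m else 0)"
proof (induction q m rule: disk_count.induct)
  case (1 m)
  then show ?case by simp
next
  case (2 q m)
  let ?F = "\<lambda>i m. fps_nth (fps_nth disk_fps i) m"
  have IH1: "real (disk_count (q - 1 - i) j) = (if even (q - 1 - i) then ?F ((q - 1 - i) div 2) j else 0)"
    "real (disk_count i (m - j)) = (if even i then ?F (i div 2) (m - j) else 0)"
    if "i < q" "j \<le> m" for i j
    using 2(1,2)[of i j] that by simp_all
  have IH2: "real (disk_count (q + 3) (m - 1)) = (if even (q + 3) then ?F ((q + 3) div 2) (m - 1) else 0)"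
    if "m \<noteq> 0" using 2(3) that by simp
  have sums: "real (disk_count (Suc q) m) =
      (\<Sum>i<q. \<Sum>j\<le>m. real (disk_count (q - 1 - i) j) * real (disk_count i (m - j))) +
      (if m = 0 then 0 else real (disk_count (q + 3) (m - 1)))"
    by simp
  show ?case
  proof (cases "even q")
    case True
    have "(\<Sum>i<q. \<Sum>j\<le>m. real (disk_count (q - 1 - i) j) * real (disk_count i (m - j))) = 0"
    proof (intro sum.neutral ballI)
      fix i j assume ij: "i \<in> {..<q}" "j \<in> {..m}"
      then have "odd (q - 1 - i) \<or> odd i" using True by (auto simp: even_diff_nat)
      then show "real (disk_count (q - 1 - i) j) * real (disk_count i (m - j)) = 0"
        using IH1[of i j] ij by auto
    qed
    then show ?thesis unfolding sums using True IH2 by simp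
  next
    case False
    then obtain p where p: "q = 2 * p + 1" by (auto elim: oddE)
    have "(\<Sum>i<q. \<Sum>j\<le>m. real (disk_count (q - 1 - i) j) * real (disk_count i (m - j))) =
        (\<Sum>i<2 * p + 1. if even i then \<Sum>j\<le>m. ?F (p - i div 2) j * ?F (i div 2) (m - j) else 0)"
      unfolding p
    proof (rule sum.cong[OF refl])
      fix i assume i: "i \<in> {..<2 * p + 1}"
      show "(\<Sum>j\<le>m. real (disk_count (2 * p + 1 - 1 - i) j) * real (disk_count i (m - j))) =
        (if even i then \<Sum>j\<le>m. ?F (p - i div 2) j * ?F (i div 2) (m - j) else 0)"
      proof (cases "even i")
        case True
        then obtain a where a: "i = 2 * a" by (auto elim: evenE)
        have "real (disk_count (2 * p + 1 - 1 - i) j) = ?F (p - i div 2) j"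
          "real (disk_count i (m - j)) = ?F (i div 2) (m - j)" if "j \<le> m" for j
          using IH1[of i j] that i unfolding p a by (simp_all flip: diff_mult_distrib2)
        then show ?thesis using True by simp
      next
        case False
        then have "disk_count i (m - j) = 0" if "j \<le> m" for j
          using IH1(2)[of i j] that i p by simp
        then show ?thesis using False by simp
      qed
    qed
    also have "\<dots> = (\<Sum>a\<le>p. \<Sum>j\<le>m. ?F (p - a) j * ?F a (m - j))"
      by (subst sum_even_only) simp_all
    also have "\<dots> = (\<Sum>a\<le>p. fps_nth (fps_nth disk_fps (p - a) * fps_nth disk_fps a) m)"
      by (simp only: fps_mult_nth atLeast0AtMost)
    also have "\<dots> = fps_nth (\<Sum>a\<le>p. fps_nth disk_fps a * fps_nth disk_fps (p - a)) m"
      unfolding fps_sum_nth by (rule sum.cong[OF refl], subst mult.commute) (rule refl)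
    finally have s: "(\<Sum>i<q. \<Sum>j\<le>m. real (disk_count (q - 1 - i) j) * real (disk_count i (m - j))) =
      fps_nth (\<Sum>a\<le>p. fps_nth disk_fps a * fps_nth disk_fps (p - a)) m" .
    have "(q + 3) div 2 = p + 2" "even (q + 3)" "Suc q div 2 = Suc p" using p by simp_all
    then show ?thesis unfolding sums s disk_fps_rec[of p] using IH2 False
      by (simp add: disk_fps_rec[of p])
  qed
qed

lemma disk_count_trees: "disk_count (2 * n) 0 = catalan n"
  using disk_count_eq[of "2 * n" 0] disk_fps_nth_0[of n] by simp

text \<open>
  The coefficient at \<open>x\<close> of the functional equation expresses the discs of perimeter 4 through those of
  perimeter 2, that is through \<open>R - (R - 1) * R / 3\<close>, and the square of \<open>R\<close> is
  \<open>R\<close> shifted by one, up to a factor 3.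
\<close>

lemma disk_count_quads:
  assumes "n > 0"
  shows "real (disk_count 4 (n - 1)) = 2 * 3 ^ n * real (catalan n) / (real n + 2)"
proof -
  have z: "fps_X * fps_nth disk_fps 2 = fps_nth disk_fps 1 - 1"
    using disk_fps_rec[of 0] by (simp add: numeral_2_eq_2)
  have "real (disk_count 4 (n - 1)) = fps_nth (fps_X * fps_nth disk_fps 2) n"
    using disk_count_eq[of 4 "n - 1"] assms by simp
  also have "\<dots> = fps_nth (tree_fps - disk_coeff) n" using z assms disk_fps_1 by simp
  finally have "3 * real (disk_count 4 (n - 1)) = 3 * fps_nth tree_fps n - fps_nth (3 * disk_coeff) n"
    by (simp add: numeral_fps_const)
  also have "\<dots> = 4 * fps_nth tree_fps n - fps_nth (tree_fps\<^sup>2) n"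
    unfolding disk_coeff_3 by (simp add: algebra_simps power2_eq_square)
  also have "3 * fps_nth (tree_fps\<^sup>2) n = fps_nth tree_fps (Suc n)"
    by (subst tree_fps_eq) (simp add: numeral_fps_const mult.assoc)
  then have "fps_nth (tree_fps\<^sup>2) n = 3 ^ n * real (catalan (Suc n))" by simp
  finally have "3 * real (disk_count 4 (n - 1)) = 3 ^ n * (4 * real (catalan n) - real (catalan (Suc n)))"
    by (simp add: algebra_simps del: catalan.simps)
  then have "3 * real (disk_count 4 (n - 1)) * (real n + 2) =
      3 ^ n * (4 * real (catalan n) - real (catalan (Suc n))) * (real n + 2)" by (simp only:)
  also have "\<dots> = 3 ^ n * (4 * (real n + 2) * real (catalan n) - (real n + 2) * real (catalan (Suc n)))"
    by (simp add: algebra_simps del: catalan.simps)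
  also have "\<dots> = 3 ^ n * (6 * real (catalan n))"
    unfolding catalan_rec by (simp add: algebra_simps)
  finally show ?thesis by (simp add: field_simps)
qed


section \<open>Isomorphisms of permutations\<close>

text \<open>
  The starting point is the first element of its cycle to be met again.
\<close>

lemma cycle_enumeration:
  fixes f :: "'a \<Rightarrow> 'a"
  assumes "finite D" "bij_betw f D D" "x \<in> D"
  shows "(f ^^ i) x = (f ^^ j) x \<longleftrightarrow> i mod card (cycle D f x) = j mod card (cycle D f x)"
proof -
  obtain n0 where n0: "n0 > 0" "(f ^^ n0) x = x" using finite_permutes_returns[OF assms] .
  define n where "n = (LEAST n. n > 0 \<and> (f ^^ n) x = x)"
  have n: "n > 0" "(f ^^ n) x = x"
    unfolding n_def using n0 LeastI[of "\<lambda>n. n > 0 \<and> (f ^^ n) x = x"] by auto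
  have least: "(f ^^ i) x \<noteq> x" if "0 < i" "i < n" for i
    using not_less_Least[of i "\<lambda>n. n > 0 \<and> (f ^^ n) x = x"] that unfolding n_def by auto
  have md: "(f ^^ (i mod n)) x = (f ^^ i) x" for i using n(2) by (rule funpow_mod_eq)
  have inj: "inj_on (\<lambda>i. (f ^^ i) x) {..<n}"
  proof (rule linorder_inj_onI)
    fix i j assume ij: "i < j" "i \<in> {..<n}" "j \<in> {..<n}"
    show "(f ^^ i) x \<noteq> (f ^^ j) x"
    proof
      assume eq: "(f ^^ i) x = (f ^^ j) x"
      have "(f ^^ (n - j + j)) x = (f ^^ (n - j)) ((f ^^ j) x)" by (simp add: funpow_add)
      also have "\<dots> = (f ^^ (n - j + i)) x" unfolding eq[symmetric] by (simp add: funpow_add)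
      finally have "(f ^^ (n - j + i)) x = x" using ij n by simp
      moreover have "0 < n - j + i" "n - j + i < n" using ij by auto
      ultimately show False using least[of "n - j + i"] by simp
    qed
  qed auto
  have "cycle D f x = (\<lambda>i. (f ^^ i) x) ` {..<n}"
  proof
    show "cycle D f x \<subseteq> (\<lambda>i. (f ^^ i) x) ` {..<n}"
    proof
      fix y assume "y \<in> cycle D f x"
      then obtain i where "y = (f ^^ i) x" unfolding cycle_eq_funpow[OF assms] by blast
      then have "y = (f ^^ (i mod n)) x" using md by simp
      then show "y \<in> (\<lambda>i. (f ^^ i) x) ` {..<n}" using n(1) by (intro image_eqI[of _ _ "i mod n"]) auto
    qed
  qed (use cycle_eq_funpow[OF assms] in blast)
  then have c: "card (cycle D f x) = n" using card_image[OF inj] by simp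
  show ?thesis
  proof
    assume "(f ^^ i) x = (f ^^ j) x"
    then have "(f ^^ (i mod n)) x = (f ^^ (j mod n)) x" using md by simp
    then show "i mod card (cycle D f x) = j mod card (cycle D f x)"
      using inj n(1) unfolding c by (simp add: inj_on_def)
  next
    assume "i mod card (cycle D f x) = j mod card (cycle D f x)"
    then show "(f ^^ i) x = (f ^^ j) x" using md[of i] md[of j] unfolding c by simp
  qed
qed

text \<open>
  Isomorphisms from \<open>f\<close> on \<open>D\<close> to \<open>f'\<close> on \<open>D'\<close>, made unique outside \<open>D\<close> so that they can be counted.
\<close>

definition perm_isos :: "'a set \<Rightarrow> ('a \<Rightarrow> 'a) \<Rightarrow> 'b set \<Rightarrow> ('b \<Rightarrow> 'b) \<Rightarrow> ('a \<Rightarrow> 'b) set" where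
  "perm_isos D f D' f' =
     {g \<in> extensional D. bij_betw g D D' \<and> (\<forall>x\<in>D. g (f x) = f' (g x))}"

lemma finite_perm_isos:
  assumes "finite D" "finite D'"
  shows "finite (perm_isos D f D' f')"
proof (rule finite_subset)
  show "perm_isos D f D' f' \<subseteq> D \<rightarrow>\<^sub>E D'"
    by (auto simp: perm_isos_def PiE_def bij_betw_def)
  show "finite (D \<rightarrow>\<^sub>E D')" using assms by (intro finite_PiE) auto
qed

lemma perm_iso_funpow:
  assumes "g \<in> perm_isos D f D' f'" "bij_betw f D D" "x \<in> D"
  shows "g ((f ^^ i) x) = (f' ^^ i) (g x)"
proof -
  have in_D: "(f ^^ i) x \<in> D" for i
    using assms(2,3) by (induction i) (auto simp: bij_betw_apply)
  show ?thesis using assms(1) in_D by (induction i) (auto simp: perm_isos_def)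
qed

lemma cycle_iso_exists:
  fixes f :: "'a \<Rightarrow> 'a" and f' :: "'b \<Rightarrow> 'b"
  assumes D: "finite D" "bij_betw f D D" "x \<in> D" and D': "finite D'" "bij_betw f' D' D'" "y \<in> D'"
    and c: "card (cycle D f x) = card (cycle D' f' y)"
  obtains e where "bij_betw e (cycle D f x) (cycle D' f' y)"
    "\<And>i. e ((f ^^ i) x) = (f' ^^ i) y"
proof -
  have eq: "(f ^^ i) x = (f ^^ j) x \<longleftrightarrow> (f' ^^ i) y = (f' ^^ j) y" for i j
    unfolding cycle_enumeration[OF D] cycle_enumeration[OF D'] c ..
  define e where "e = (\<lambda>z. (f' ^^ (SOME i. z = (f ^^ i) x)) y)"
  have e: "e ((f ^^ i) x) = (f' ^^ i) y" for i
  proof -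
    have "(f ^^ i) x = (f ^^ (SOME j. (f ^^ i) x = (f ^^ j) x)) x" by (rule someI_ex) blast
    then show ?thesis unfolding e_def using eq by metis
  qed
  have "bij_betw e (cycle D f x) (cycle D' f' y)"
    unfolding bij_betw_def
  proof
    show "inj_on e (cycle D f x)"
    proof (rule inj_onI)
      fix u v assume uv: "u \<in> cycle D f x" "v \<in> cycle D f x" "e u = e v"
      then obtain i j where "u = (f ^^ i) x" "v = (f ^^ j) x"
        unfolding cycle_eq_funpow[OF D] by blast
      then show "u = v" using uv(3) e eq by metis
    qed
    show "e ` cycle D f x = cycle D' f' y"
    proof
      show "e ` cycle D f x \<subseteq> cycle D' f' y"
        unfolding cycle_eq_funpow[OF D] cycle_eq_funpow[OF D'] using e by blast
      show "cycle D' f' y \<subseteq> e ` cycle D f x"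
      proof
        fix w assume "w \<in> cycle D' f' y"
        then obtain i where "w = (f' ^^ i) y" unfolding cycle_eq_funpow[OF D'] by blast
        then have "w = e ((f ^^ i) x)" using e by simp
        moreover have "(f ^^ i) x \<in> cycle D f x" unfolding cycle_eq_funpow[OF D] by blast
        ultimately show "w \<in> e ` cycle D f x" by blast
      qed
    qed
  qed
  then show thesis using e that by blast
qed

text \<open>
  One value determines an isomorphism on a whole cycle; the other cycles are mapped independently.
\<close>

lemma card_perm_isos_through:
  fixes f :: "'a \<Rightarrow> 'a" and f' :: "'b \<Rightarrow> 'b"
  assumes D: "finite D" "bij_betw f D D" "x \<in> D" and D': "finite D'" "bij_betw f' D' D'" "y \<in> D'"
    and c: "card (cycle D f x) = card (cycle D' f' y)"
  shows "card {g \<in> perm_isos D f D' f'. g x = y} =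
    card (perm_isos (D - cycle D f x) f (D' - cycle D' f' y) f')"
proof (rule bij_betw_same_card)
  let ?C = "cycle D f x" and ?C' = "cycle D' f' y"
  obtain e where e: "bij_betw e ?C ?C'" "\<And>i. e ((f ^^ i) x) = (f' ^^ i) y"
    using cycle_iso_exists[OF assms] by blast
  have CD: "?C \<subseteq> D" "?C' \<subseteq> D'"
    by (rule cl_subset[OF link_stable[OF D(2)] D(3)], rule cl_subset[OF link_stable[OF D'(2)] D'(3)])
  have P: "{?C} \<subseteq> cycles D f" using D(3) by simp
  have fC: "f z \<in> ?C" if "z \<in> ?C" for z
    using cycle_closed[of z D f x] that CD(1) by blast
  have fC': "f z \<in> D - ?C" if "z \<in> D - ?C" for z
    using bij_betwE[OF cycles_partition(4)[OF D(1,2) P]] that by simp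
  have on_C: "g z = e z" if g: "g \<in> perm_isos D f D' f'" "g x = y" and z: "z \<in> ?C" for g z
  proof -
    obtain i where "z = (f ^^ i) x" using z unfolding cycle_eq_funpow[OF D] by blast
    then show ?thesis using perm_iso_funpow[OF g(1) D(2,3)] g(2) e(2) by simp
  qed
  let ?G = "\<lambda>k z. if z \<in> ?C then e z else k z"
  show "bij_betw (\<lambda>g. restrict g (D - ?C)) {g \<in> perm_isos D f D' f'. g x = y}
      (perm_isos (D - ?C) f (D' - ?C') f')"
  proof (rule bij_betw_byWitness[where f' = ?G])
    show "\<forall>g\<in>{g \<in> perm_isos D f D' f'. g x = y}. ?G (restrict g (D - ?C)) = g"
    proof (intro ballI ext)
      fix g z assume "g \<in> {g \<in> perm_isos D f D' f'. g x = y}"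
      then have g: "g \<in> perm_isos D f D' f'" "g x = y" by auto
      then have "g z = undefined" if "z \<notin> D" using that by (auto simp: perm_isos_def extensional_def)
      then show "?G (restrict g (D - ?C)) z = g z" using on_C[OF g] by auto
    qed
    show "\<forall>k\<in>perm_isos (D - ?C) f (D' - ?C') f'. restrict (?G k) (D - ?C) = k"
    proof (intro ballI ext)
      fix k z assume "k \<in> perm_isos (D - ?C) f (D' - ?C') f'"
      then have "k z = undefined" if "z \<notin> D - ?C" using that by (auto simp: perm_isos_def extensional_def)
      then show "restrict (?G k) (D - ?C) z = k z" by auto
    qed
    show "(\<lambda>g. restrict g (D - ?C)) ` {g \<in> perm_isos D f D' f'. g x = y} \<subseteq>
        perm_isos (D - ?C) f (D' - ?C') f'"
    proof
      fix k assume "k \<in> (\<lambda>g. restrict g (D - ?C)) ` {g \<in> perm_isos D f D' f'. g x = y}"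
      then obtain g where k: "k = restrict g (D - ?C)" and g: "g \<in> perm_isos D f D' f'" "g x = y" by blast
      have bg: "bij_betw g D D'" using g(1) by (simp add: perm_isos_def)
      have "g ` ?C = e ` ?C" by (rule image_cong[OF refl]) (rule on_C[OF g])
      then have "g ` ?C = ?C'" using e(1) by (simp add: bij_betw_def)
      then have "g ` (D - ?C) = D' - ?C'"
        using bg CD(1) inj_on_image_set_diff[of g D D ?C] by (auto simp: bij_betw_def)
      then have "bij_betw g (D - ?C) (D' - ?C')"
        using bg inj_on_subset[of g D "D - ?C"] by (auto simp: bij_betw_def)
      then have "bij_betw k (D - ?C) (D' - ?C')" unfolding k
        by (rule bij_betw_cong[THEN iffD1, rotated]) simp
      moreover have "\<forall>z\<in>D - ?C. k (f z) = f' (k z)"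
        using g(1) fC' unfolding k by (simp add: perm_isos_def)
      ultimately show "k \<in> perm_isos (D - ?C) f (D' - ?C') f'" by (simp add: perm_isos_def k)
    qed
    show "?G ` perm_isos (D - ?C) f (D' - ?C') f' \<subseteq> {g \<in> perm_isos D f D' f'. g x = y}"
    proof
      fix g assume "g \<in> ?G ` perm_isos (D - ?C) f (D' - ?C') f'"
      then obtain k where g: "g = ?G k" and k: "k \<in> perm_isos (D - ?C) f (D' - ?C') f'" by blast
      have "bij_betw g ?C ?C'"
        using e(1) unfolding g by (rule bij_betw_cong[THEN iffD1, rotated]) simp
      moreover have "bij_betw k (D - ?C) (D' - ?C')" using k by (simp add: perm_isos_def)
      then have "bij_betw g (D - ?C) (D' - ?C')"
        unfolding g by (rule bij_betw_cong[THEN iffD1, rotated]) simp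
      ultimately have "bij_betw g (?C \<union> (D - ?C)) (?C' \<union> (D' - ?C'))"
        by (rule bij_betw_combine) blast
      moreover have "?C \<union> (D - ?C) = D" "?C' \<union> (D' - ?C') = D'" using CD by blast+
      ultimately have bg: "bij_betw g D D'" by simp
      have comm: "g (f z) = f' (g z)" if z: "z \<in> D" for z
      proof (cases "z \<in> ?C")
        case True
        then obtain i where i: "z = (f ^^ i) x" unfolding cycle_eq_funpow[OF D] by blast
        have "g (f z) = e ((f ^^ Suc i) x)" using fC[OF True] unfolding g i by simp
        also have "\<dots> = f' (e z)" unfolding e(2) i by simp
        finally show ?thesis using True unfolding g by simp
      next
        case False
        then have "z \<in> D - ?C" "f z \<notin> ?C" using z fC' by blast+
        then show ?thesis using k unfolding g by (simp add: perm_isos_def)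
      qed
      have ext: "g \<in> extensional D"
        using k CD(1) unfolding g perm_isos_def extensional_def by auto
      have "g x = y" using e(2)[of 0] unfolding g by simp
      then show "g \<in> {g \<in> perm_isos D f D' f'. g x = y}"
        using bg comm ext by (simp add: perm_isos_def)
    qed
  qed
qed

lemma card_equal_cycles:
  assumes "finite D" "bij_betw f D D" "\<And>C. C \<in> cycles D f \<Longrightarrow> card C = k"
  shows "card D = k * card (cycles D f)"
proof -
  have U: "\<Union>(cycles D f) = D" by (rule Union_parts[OF link_stable[OF assms(2)]])
  have "k * card (cycles D f) = card (\<Union>(cycles D f))"
    by (rule card_partition) (use assms U parts_disjoint[of _ D "link D f"] in auto)
  then show ?thesis using U by simp
qed

text \<open>
  A first dart can be sent to each of the \<open>k * m\<close> darts, which uses up one cycle on either side.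
\<close>

lemma card_perm_isos:
  fixes f :: "'a \<Rightarrow> 'a" and f' :: "'b \<Rightarrow> 'b"
  assumes "finite D" "bij_betw f D D" "\<And>C. C \<in> cycles D f \<Longrightarrow> card C = k" "card (cycles D f) = m"
    and "finite D'" "bij_betw f' D' D'" "\<And>C. C \<in> cycles D' f' \<Longrightarrow> card C = k" "card (cycles D' f') = m"
  shows "card (perm_isos D f D' f') = fact m * k ^ m"
    and "x \<in> D \<Longrightarrow> y \<in> D' \<Longrightarrow> card {g \<in> perm_isos D f D' f'. g x = y} = fact (m - 1) * k ^ (m - 1)"
proof -
  have "card (perm_isos D f D' f') = fact m * k ^ m \<and>
    (\<forall>x\<in>D. \<forall>y\<in>D'. card {g \<in> perm_isos D f D' f'. g x = y} = fact (m - 1) * k ^ (m - 1))"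
    using assms
  proof (induction m arbitrary: D D')
    case 0
    then have "cycles D f = {}" "cycles D' f' = {}" by simp_all
    then have "D = {}" "D' = {}" by (simp_all add: parts_def)
    then have "perm_isos D f D' f' = {\<lambda>_. undefined}"
      by (auto simp: perm_isos_def extensional_def bij_betw_def)
    then show ?case using \<open>D = {}\<close> by simp
  next
    case (Suc m)
    note D = Suc.prems(1-4) and D' = Suc.prems(5-8)
    have through: "card {g \<in> perm_isos D f D' f'. g x = y} = fact m * k ^ m" if x: "x \<in> D" and y: "y \<in> D'" for x y
    proof -
      let ?C = "cycle D f x" and ?C' = "cycle D' f' y"
      have C: "?C \<in> cycles D f" "?C' \<in> cycles D' f'" using x y by simp_all
      have P: "{?C} \<subseteq> cycles D f" "{?C'} \<subseteq> cycles D' f'" using C by simp_all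
      note p = cycles_partition(4,5)[OF D(1,2) P(1)] and p' = cycles_partition(4,5)[OF D'(1,2) P(2)]
      have "card ?C = card ?C'" using D(3)[OF C(1)] D'(3)[OF C(2)] by simp
      then have "card {g \<in> perm_isos D f D' f'. g x = y} = card (perm_isos (D - ?C) f (D' - ?C') f')"
        using D(1,2) D'(1,2) x y by (intro card_perm_isos_through)
      also have "\<dots> = fact m * k ^ m"
      proof (rule conjunct1[OF Suc.IH])
        show "bij_betw f (D - ?C) (D - ?C)" "bij_betw f' (D' - ?C') (D' - ?C')" using p(1) p'(1) by simp_all
        have eq: "cycles (D - ?C) f = cycles D f - {?C}" "cycles (D' - ?C') f' = cycles D' f' - {?C'}"
          using p(2) p'(2) by simp_all
        show "card (cycles (D - ?C) f) = m" "card (cycles (D' - ?C') f') = m"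
          unfolding eq using C D D' by (simp_all add: card_Diff_subset)
        show "card X = k" if "X \<in> cycles (D - ?C) f" for X using that D(3) unfolding eq by blast
        show "card X = k" if "X \<in> cycles (D' - ?C') f'" for X using that D'(3) unfolding eq by blast
      qed (use D(1) D'(1) in auto)
      finally show ?thesis .
    qed
    have "D \<noteq> {}"
    proof
      assume "D = {}"
      then have "card (cycles D f) = 0" by (simp add: parts_def)
      then show False using D(4) by simp
    qed
    then obtain x where x: "x \<in> D" by blast
    have "card (perm_isos D f D' f') = (\<Sum>g\<in>perm_isos D f D' f'. 1)" by simp
    also have "\<dots> = (\<Sum>y\<in>D'. \<Sum>g\<in>{g \<in> perm_isos D f D' f'. g x = y}. 1)"
      by (rule sum.group[symmetric])
        (use finite_perm_isos[OF D(1) D'(1)] D'(1) x in \<open>auto simp: perm_isos_def bij_betw_apply\<close>)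
    also have "\<dots> = (\<Sum>y\<in>D'. fact m * k ^ m)" by (rule sum.cong[OF refl]) (simp add: through[OF x])
    also have "\<dots> = card D' * (fact m * k ^ m)" by simp
    also have "card D' = k * Suc m" using card_equal_cycles[OF D'(1-3)] D'(4) by simp
    also have "k * Suc m * (fact m * k ^ m) = fact (Suc m) * k ^ Suc m" by (simp add: algebra_simps)
    finally show ?case using through by simp
  qed
  then show "card (perm_isos D f D' f') = fact m * k ^ m"
    "x \<in> D \<Longrightarrow> y \<in> D' \<Longrightarrow> card {g \<in> perm_isos D f D' f'. g x = y} = fact (m - 1) * k ^ (m - 1)" by blast+
qed


section \<open>Counting classes through representatives\<close>

text \<open>
  Isomorphism classes are counted through representatives of a special form: it is enough that each
  object has the same number of such representatives.
\<close>

lemma card_quotient_fibers: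
  assumes eq: "equiv S R" and X: "finite X" and F: "F ` X \<subseteq> S"
    and fib: "\<And>s. s \<in> S \<Longrightarrow> card {x \<in> X. (F x, s) \<in> R} = c" and c: "c > 0"
  shows "card X = c * card (S // R)"
proof -
  have cls: "S // R = (\<lambda>x. R `` {F x}) ` X"
  proof
    show "(\<lambda>x. R `` {F x}) ` X \<subseteq> S // R" using F by (auto intro: quotientI)
    show "S // R \<subseteq> (\<lambda>x. R `` {F x}) ` X"
    proof
      fix Q assume "Q \<in> S // R"
      then obtain s where s: "s \<in> S" "Q = R `` {s}" by (rule quotientE)
      have "{x \<in> X. (F x, s) \<in> R} \<noteq> {}" using fib[OF s(1)] c by (metis card.empty less_numeral_extra(3))
      then obtain x where x: "x \<in> X" "(F x, s) \<in> R" by blast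
      then have "R `` {F x} = Q" using equiv_class_eq[OF eq] s(2) by simp
      then show "Q \<in> (\<lambda>x. R `` {F x}) ` X" using x(1) by blast
    qed
  qed
  have "card X = (\<Sum>x\<in>X. 1)" by simp
  also have "\<dots> = (\<Sum>Q\<in>S // R. \<Sum>x\<in>{x \<in> X. R `` {F x} = Q}. 1)"
    by (rule sum.group[symmetric]) (use X cls in auto)
  also have "\<dots> = (\<Sum>Q\<in>S // R. c)"
  proof (rule sum.cong[OF refl])
    fix Q assume "Q \<in> S // R"
    then obtain s where s: "s \<in> S" "Q = R `` {s}" by (rule quotientE)
    have "{x \<in> X. R `` {F x} = Q} = {x \<in> X. (F x, s) \<in> R}"
      using s F eq_equiv_class_iff[OF eq _ s(1)] by blast
    then show "(\<Sum>x\<in>{x \<in> X. R `` {F x} = Q}. 1) = c" using fib[OF s(1)] by simp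
  qed
  finally show ?thesis by simp
qed

text \<open>
  Extra data on a structure (a basepoint or a labelling) does not change the number of
  representatives if it can be transported in exactly one way.
\<close>

lemma card_Sigma_unique:
  assumes "\<And>x e. x \<in> X \<Longrightarrow> e \<in> E x \<Longrightarrow> P x e \<Longrightarrow> Q x"
    and "\<And>x. x \<in> X \<Longrightarrow> Q x \<Longrightarrow> \<exists>!e. e \<in> E x \<and> P x e"
  shows "card {p \<in> Sigma X E. P (fst p) (snd p)} = card {x \<in> X. Q x}"
proof (rule bij_betw_same_card)
  show "bij_betw fst {p \<in> Sigma X E. P (fst p) (snd p)} {x \<in> X. Q x}"
    unfolding bij_betw_def
  proof
    show "inj_on fst {p \<in> Sigma X E. P (fst p) (snd p)}"
    proof (rule inj_onI)
      fix p p' assume p: "p \<in> {p \<in> Sigma X E. P (fst p) (snd p)}" "p' \<in> {p \<in> Sigma X E. P (fst p) (snd p)}"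
        and eq: "fst p = fst p'"
      have "fst p \<in> X" "Q (fst p)" using p assms(1) by auto
      then have "snd p = snd p'" using assms(2)[of "fst p"] p eq by (auto simp: mem_Times_iff)
      then show "p = p'" using eq by (rule prod_eqI[rotated])
    qed
    show "fst ` {p \<in> Sigma X E. P (fst p) (snd p)} = {x \<in> X. Q x}"
    proof
      show "{x \<in> X. Q x} \<subseteq> fst ` {p \<in> Sigma X E. P (fst p) (snd p)}"
      proof
        fix x assume "x \<in> {x \<in> X. Q x}"
        then have x: "x \<in> X" "Q x" by auto
        then obtain e where "e \<in> E x" "P x e" using assms(2) by blast
        then show "x \<in> fst ` {p \<in> Sigma X E. P (fst p) (snd p)}"
          using x(1) by (intro image_eqI[of _ _ "(x, e)"]) auto
      qed
    qed (use assms(1) in auto)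
  qed
qed


section \<open>Labels with prescribed increments along a forest\<close>

text \<open>
  A pair of \<open>E\<close> lowers the number of classes by at most one, so the cardinality condition says that each
  pair joins two different classes when the pairs are added one after another. The labels of one of
  these classes can then be shifted to obtain the required increment.
\<close>

lemma forest_labels:
  fixes inc :: "'a \<times> 'a \<Rightarrow> int"
  assumes fin: "finite D" and "finite E" "E \<subseteq> D \<times> D"
    and "card (parts D (E \<union> S)) + card E \<le> card (parts D S)"
  shows "\<exists>lab :: 'a \<Rightarrow> int. (\<forall>(u, v)\<in>S. lab u = lab v) \<and> (\<forall>(u, v)\<in>E. lab v = lab u + inc (u, v))"
  using assms(2-4)
proof (induction E rule: finite_induct)
  case empty
  show ?case by (intro exI[of _ "\<lambda>_. 0"]) simp
next
  case (insert p E)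
  obtain a b where p: "p = (a, b)" by (cases p)
  let ?T = "E \<union> S"
  have ab: "a \<in> D" "b \<in> D" using insert.prems(1) p by auto
  have c: "card (parts D (insert (a, b) ?T)) + Suc (card E) \<le> card (parts D S)"
    using insert.prems(2) insert.hyps p by simp
  have "card (parts D ?T) \<le> Suc (card (parts D (insert (a, b) ?T)))"
    by (rule card_parts_insert_le[OF fin ab])
  then have "card (parts D ?T) + card E \<le> card (parts D S)" using c by linarith
  then obtain lab where lab: "\<forall>(u, v)\<in>S. lab u = lab v" "\<forall>(u, v)\<in>E. lab v = lab u + inc (u, v)"
    using insert.IH insert.prems(1) by auto
  have gen: "card (parts D S) \<le> card (parts D (E' \<union> S)) + card E'" if "finite E'" "E' \<subseteq> D \<times> D" for E'
    using that
  proof (induction E' rule: finite_induct)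
    case (insert q E')
    obtain u v where q: "q = (u, v)" by (cases q)
    have "u \<in> D" "v \<in> D" using insert.prems q by auto
    then have "card (parts D (E' \<union> S)) \<le> Suc (card (parts D (insert (u, v) (E' \<union> S))))"
      by (rule card_parts_insert_le[OF fin])
    then show ?case using insert q by simp
  qed simp
  have nab: "(a, b) \<notin> conn ?T"
  proof
    assume "(a, b) \<in> conn ?T"
    then have "parts D (insert (a, b) ?T) = parts D ?T" by (rule parts_insert_same)
    then show False using c gen[of E] insert.hyps(1) insert.prems(1) by simp
  qed
  \<comment> \<open>The class of \<open>b\<close> is shifted as a whole, which changes no increment inside it.\<close>
  define s where "s = lab a + inc (a, b) - lab b"
  define lab' where "lab' = (\<lambda>x. if x \<in> cl ?T b then lab x + s else lab x)"
  have same: "u \<in> cl ?T b \<longleftrightarrow> v \<in> cl ?T b" if "(u, v) \<in> ?T" for u v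
    using that by (rule cl_closed)
  have "lab' b = lab' a + inc (a, b)"
    using nab conn_sym[of b a ?T] by (auto simp: lab'_def s_def cl_iff)
  moreover have "lab' u = lab' v" if "(u, v) \<in> S" for u v
    using same[of u v] that lab(1) by (auto simp: lab'_def)
  moreover have "lab' v = lab' u + inc (u, v)" if "(u, v) \<in> E" for u v
    using same[of u v] that lab(2) by (auto simp: lab'_def)
  ultimately show ?case unfolding p by (intro exI[of _ lab']) auto
qed


section \<open>A reference permutation\<close>

text \<open>
  The reference faces: \<open>n\<close> blocks of \<open>k\<close> consecutive numbers, each of them permuted cyclically.
\<close>

definition block_perm :: "nat \<Rightarrow> nat \<Rightarrow> nat \<Rightarrow> nat" where
  "block_perm k n x = (if x < k * n then if Suc (x mod k) = k then Suc x - k else Suc x else x)"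

lemma block_less: "i < k \<Longrightarrow> j < n \<Longrightarrow> k * j + i < k * (n :: nat)"
proof -
  assume "i < k" "j < n"
  then have "k * j + i < k * Suc j" by simp
  also have "\<dots> \<le> k * n" using \<open>j < n\<close> by (intro mult_le_mono2) simp
  finally show ?thesis .
qed

lemma block_perm_at:
  assumes "i < k" "j < n"
  shows "block_perm k n (k * j + i) = (if Suc i = k then k * j else k * j + Suc i)"
proof -
  have "(k * j + i) mod k = i" using assms(1) by simp
  then show ?thesis using block_less[OF assms] by (auto simp: block_perm_def)
qed

lemma block_decomp:
  fixes x :: nat
  assumes "x < k * n"
  obtains i j where "i < k" "j < n" "x = k * j + i"
proof
  show "x mod k < k" using assms by (cases k) auto
  show "x div k < n" using assms by (metis less_mult_imp_div_less mult.commute)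
  show "x = k * (x div k) + x mod k" by simp
qed

lemma block_perm_bij: "bij_betw (block_perm k n) {..<k * n} {..<k * n}"
proof -
  have "block_perm k n ` {..<k * n} = {..<k * n}"
  proof
    show "block_perm k n ` {..<k * n} \<subseteq> {..<k * n}"
    proof
      fix y assume "y \<in> block_perm k n ` {..<k * n}"
      then obtain x where x: "x < k * n" "y = block_perm k n x" by auto
      obtain i j where ij: "i < k" "j < n" "x = k * j + i" using block_decomp[OF x(1)] .
      show "y \<in> {..<k * n}"
        using x(2) block_perm_at[OF ij(1,2)] ij block_less[of 0 k j n] block_less[of "Suc i" k j n]
        by (auto split: if_splits)
    qed
    show "{..<k * n} \<subseteq> block_perm k n ` {..<k * n}"
    proof
      fix y assume "y \<in> {..<k * n}"
      then have "y < k * n" by simp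
      then obtain i j where ij: "i < k" "j < n" "y = k * j + i" by (rule block_decomp)
      \<comment> \<open>The position before \<open>i\<close>, cyclically.\<close>
      define i' where "i' = (if i = 0 then k - 1 else i - 1)"
      have "i' < k" using ij(1) by (auto simp: i'_def)
      moreover have "block_perm k n (k * j + i') = y"
        using block_perm_at[OF \<open>i' < k\<close> ij(2)] ij by (auto simp: i'_def split: if_splits)
      ultimately show "y \<in> block_perm k n ` {..<k * n}"
        using block_less[of i' k j n] ij(2) by (intro image_eqI[of _ _ "k * j + i'"]) auto
    qed
  qed
  then show ?thesis by (simp add: bij_betw_def eq_card_imp_inj_on)
qed

lemma block_perm_permutes: "block_perm k n permutes {..<k * n}"
  by (rule bij_imp_permutes[OF block_perm_bij]) (simp add: block_perm_def)

lemma block_cycles: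
  assumes "k > 0"
  shows "cycles {..<k * n} (block_perm k n) = (\<lambda>j. {k * j..<k * j + k}) ` {..<n}"
proof -
  let ?D = "{..<k * n}" and ?f = "block_perm k n"
  have base: "(k * j, k * j + i) \<in> conn (link ?D ?f)" if "i < k" "j < n" for i j
    using that(1)
  proof (induction i)
    case (Suc i)
    have "(k * j + i, k * j + Suc i) \<in> link ?D ?f"
      using block_perm_at[of i k j n] block_less[of i k j n] Suc.prems that(2) by (auto simp: link_def)
    then have "(k * j + i, k * j + Suc i) \<in> conn (link ?D ?f)" by (rule conn_base)
    moreover have "(k * j, k * j + i) \<in> conn (link ?D ?f)" using Suc by simp
    ultimately show ?case using conn_trans by metis
  qed simp
  have cyc: "cycle ?D ?f (k * j) = {k * j..<k * j + k}" if j: "j < n" for j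
  proof
    show "cycle ?D ?f (k * j) \<subseteq> {k * j..<k * j + k}"
    proof (rule cl_closed_subset)
      show "k * j \<in> {k * j..<k * j + k}" using assms by simp
      fix u v assume "(u, v) \<in> link ?D ?f"
      then have u: "u < k * n" "v = ?f u" by (auto simp: link_def)
      obtain i l where il: "i < k" "l < n" "u = k * l + i" using block_decomp[OF u(1)] .
      have in_block: "k * l + i' \<in> {k * j..<k * j + k} \<longleftrightarrow> l = j" if "i' < k" for i'
      proof
        assume "k * l + i' \<in> {k * j..<k * j + k}"
        then have "k * l < k * Suc j" "k * j < k * Suc l" using that by auto
        then have "l < Suc j" "j < Suc l" using mult_less_cancel1 by blast+
        then show "l = j" by simp
      qed (use that in auto)
      have "\<exists>i'<k. v = k * l + i'"
        using u(2) block_perm_at[OF il(1,2)] il assms by (cases "Suc i = k") (auto intro: exI[of _ 0] exI[of _ "Suc i"])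
      then obtain i' where "i' < k" "v = k * l + i'" by blast
      then show "u \<in> {k * j..<k * j + k} \<longleftrightarrow> v \<in> {k * j..<k * j + k}"
        using in_block[OF il(1)] in_block[of i'] il(3) by simp
    qed
    show "{k * j..<k * j + k} \<subseteq> cycle ?D ?f (k * j)"
    proof
      fix x assume "x \<in> {k * j..<k * j + k}"
      then have "x - k * j < k" "x = k * j + (x - k * j)" by auto
      then have "(k * j, x) \<in> conn (link ?D ?f)" using base[of "x - k * j" j] j by simp
      then show "x \<in> cycle ?D ?f (k * j)" by (simp add: cl_iff)
    qed
  qed
  show ?thesis
  proof
    show "cycles ?D ?f \<subseteq> (\<lambda>j. {k * j..<k * j + k}) ` {..<n}"
    proof
      fix C assume "C \<in> cycles ?D ?f"
      then obtain x where x: "x < k * n" "C = cycle ?D ?f x" by (auto simp: parts_def)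
      obtain i j where ij: "i < k" "j < n" "x = k * j + i" using block_decomp[OF x(1)] .
      have "C = cycle ?D ?f (k * j)"
        using base[OF ij(1,2)] unfolding x(2) ij(3) cl_eq_iff by (rule conn_sym)
      then show "C \<in> (\<lambda>j. {k * j..<k * j + k}) ` {..<n}" using cyc[OF ij(2)] ij(2) by auto
    qed
    show "(\<lambda>j. {k * j..<k * j + k}) ` {..<n} \<subseteq> cycles ?D ?f"
    proof
      fix C assume "C \<in> (\<lambda>j. {k * j..<k * j + k}) ` {..<n}"
      then obtain j where j: "j < n" "C = {k * j..<k * j + k}" by auto
      have "k * j < k * n" using j(1) assms by simp
      then show "C \<in> cycles ?D ?f" unfolding j(2) cyc[OF j(1), symmetric] by (intro cl_in_parts) simp
    qed
  qed
qed

lemma block_cycles_card: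
  assumes "k > 0"
  shows "card (cycles {..<k * n} (block_perm k n)) = n"
    and "C \<in> cycles {..<k * n} (block_perm k n) \<Longrightarrow> card C = k"
proof -
  have "inj_on (\<lambda>j. {k * j..<k * j + k}) {..<n}"
  proof (rule inj_onI)
    fix i j assume "{k * i..<k * i + k} = {k * j..<k * j + k}"
    then have "k * i = k * j" using assms by (simp add: atLeastLessThan_eq_iff)
    then show "i = j" using assms by simp
  qed
  then show "card (cycles {..<k * n} (block_perm k n)) = n"
    unfolding block_cycles[OF assms] by (simp add: card_image)
  show "C \<in> cycles {..<k * n} (block_perm k n) \<Longrightarrow> card C = k"
    unfolding block_cycles[OF assms] by auto
qed


section \<open>Planar maps as gluings\<close>

lemma cmap_matching: "cmap M \<Longrightarrow> matching (darts M) (opp M)"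
  unfolding cmap_def matching_def by (auto simp: permutes_in_image permutes_not_in)

text \<open>
  All conditions on a map other than connectedness, with the reversal of arcs as a matching.
\<close>

definition premap :: "'d cmap \<Rightarrow> bool" where
  "premap M \<longleftrightarrow> finite (darts M) \<and> darts M \<noteq> {} \<and> rot M permutes darts M \<and> matching (darts M) (opp M)"

lemma matching_permutes: "matching D h \<Longrightarrow> h permutes D"
  using matching_bij_betw[of D h D] by (intro bij_imp_permutes) (auto simp: matching_def)

lemma cmap_iff_premap: "cmap M \<longleftrightarrow> premap M \<and> connected_darts M"
proof
  assume M: "cmap M"
  then show "premap M \<and> connected_darts M"
    using cmap_matching[OF M] unfolding premap_def cmap_def by blast
next
  assume M: "premap M \<and> connected_darts M"
  then have h: "matching (darts M) (opp M)" by (simp add: premap_def)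
  then have "\<forall>d\<in>darts M. opp M d \<noteq> d \<and> opp M (opp M d) = d" unfolding matching_def by blast
  then show "cmap M" using M matching_permutes[OF h] unfolding premap_def cmap_def by blast
qed

abbreviation face_perm :: "'d cmap \<Rightarrow> 'd \<Rightarrow> 'd" where
  "face_perm M \<equiv> rot M \<circ> opp M"

lemma premap_bijs:
  assumes "premap M"
  shows "bij_betw (rot M) (darts M) (darts M)" "bij_betw (opp M) (darts M) (darts M)"
    "bij_betw (face_perm M) (darts M) (darts M)" "face_perm M \<circ> opp M = rot M"
proof -
  show r: "bij_betw (rot M) (darts M) (darts M)" using assms by (simp add: premap_def permutes_imp_bij)
  show o: "bij_betw (opp M) (darts M) (darts M)"
    using assms by (intro matching_bij_betw[of "darts M"]) (simp_all add: premap_def)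
  show "bij_betw (face_perm M) (darts M) (darts M)" using o r by (rule bij_betw_trans)
  have "opp M (opp M x) = x" for x using assms by (intro matching_involution[of "darts M"]) (simp add: premap_def)
  then show "face_perm M \<circ> opp M = rot M" by (simp add: fun_eq_iff)
qed

text \<open>
  Directed reachability agrees with the generated equivalence, because inverses of finite permutations
  are powers. The face permutation and the rotation generate the same classes together with the
  reversal of arcs.
\<close>

lemma connected_darts_iff:
  assumes M: "premap M"
  shows "connected_darts M \<longleftrightarrow> card (comps (darts M) (face_perm M) (opp M)) = 1"
proof -
  let ?D = "darts M" and ?f = "face_perm M" and ?h = "opp M"
  let ?R = "{(x, rot M x) |x. x \<in> ?D} \<union> {(x, opp M x) |x. x \<in> ?D}"
  let ?S = "link ?D ?f \<union> link ?D ?h"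
  note b = premap_bijs[OF M]
  have fin: "finite ?D" and ne: "?D \<noteq> {}" using M by (auto simp: premap_def)
  have inv: "?h (?h x) = x" for x using M by (intro matching_involution[of "darts M"]) (simp add: premap_def)
  have hD: "?h x \<in> ?D" if "x \<in> ?D" for x using bij_betwE[OF b(2)] that by blast
  have hR: "(x, ?h x) \<in> ?R\<^sup>*" if "x \<in> ?D" for x using that by (intro r_into_rtrancl) blast
  have rotS: "(x, rot M x) \<in> conn ?S" if x: "x \<in> ?D" for x
  proof -
    have "(x, ?h x) \<in> conn ?S" using x by (intro conn_base) (auto simp: link_def)
    moreover have "(?h x, ?f (?h x)) \<in> conn ?S" using hD[OF x] by (intro conn_base) (auto simp: link_def)
    then have "(?h x, rot M x) \<in> conn ?S" by (simp add: inv)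
    ultimately show ?thesis by (rule conn_trans)
  qed
  have RS: "?R\<^sup>* \<subseteq> conn ?S"
  proof
    fix p assume "p \<in> ?R\<^sup>*"
    then obtain x y where p: "p = (x, y)" "(x, y) \<in> ?R\<^sup>*" by (cases p) blast
    from p(2) have "(x, y) \<in> conn ?S"
    proof (induction rule: rtrancl_induct)
      case (step y z)
      have "(y, z) \<in> conn ?S"
      proof (cases "z = rot M y")
        case True
        then show ?thesis using step.hyps(2) rotS by blast
      next
        case False
        then have "(y, z) \<in> link ?D ?h" using step.hyps(2) by (auto simp: link_def)
        then show ?thesis by (intro conn_base) simp
      qed
      then show ?case using step.IH by (rule conn_trans[rotated])
    qed simp
    then show "p \<in> conn ?S" using p by simp
  qed
  have rot_back: "(rot M y, y) \<in> ?R\<^sup>*" if y: "y \<in> ?D" for y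
  proof -
    have in_D: "(rot M ^^ i) y \<in> ?D" for i
      using y by (induction i) (auto simp: bij_betw_apply[OF b(1)])
    have fwd: "(rot M y, (rot M ^^ Suc i) y) \<in> ?R\<^sup>*" for i
    proof (induction i)
      case (Suc i)
      have "((rot M ^^ Suc i) y, rot M ((rot M ^^ Suc i) y)) \<in> ?R" using in_D[of "Suc i"] by blast
      then show ?case using Suc by (simp add: rtrancl.rtrancl_into_rtrancl)
    qed simp
    obtain n where n: "n > 0" "(rot M ^^ n) y = y" using finite_permutes_returns[OF fin b(1) y] .
    then show ?thesis using fwd[of "n - 1"] by simp
  qed
  have SR: "(u, v) \<in> ?R\<^sup>* \<and> (v, u) \<in> ?R\<^sup>*" if uv: "(u, v) \<in> ?S" for u v
  proof -
    have u: "u \<in> ?D" "v = ?f u \<or> v = ?h u" using uv by (auto simp: link_def)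
    have h: "(u, ?h u) \<in> ?R\<^sup>*" "(?h u, u) \<in> ?R\<^sup>*"
      using hR[OF u(1)] hR[OF hD[OF u(1)]] by (simp_all add: inv)
    have "(?h u, rot M (?h u)) \<in> ?R\<^sup>*" using hD[OF u(1)] by (intro r_into_rtrancl) blast
    then have "(u, ?f u) \<in> ?R\<^sup>*" "(?f u, u) \<in> ?R\<^sup>*"
      using h rot_back[OF hD[OF u(1)]] by (auto intro: rtrancl_trans)
    then show ?thesis using u(2) h by blast
  qed
  have "(x, y) \<in> ?R\<^sup>*" if "(x, y) \<in> conn ?S" for x y
    using that
  proof (induction rule: conn_induct)
    case (fwd u v)
    then show ?case using SR[of u v] by (meson rtrancl_trans)
  next
    case (bwd u v)
    then show ?case using SR[of v u] by (meson rtrancl_trans)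
  qed simp
  then have "conn ?S = ?R\<^sup>*" using RS by auto
  then show ?thesis
    unfolding card_parts_1_iff[OF ne] connected_darts_def by simp
qed

lemma card_edges:
  assumes M: "premap M"
  shows "2 * card (edges M) = card (darts M)"
proof -
  have h: "matching (darts M) (opp M)" using M by (simp add: premap_def)
  have fin: "finite (darts M)" using M by (simp add: premap_def)
  have inv: "opp M (opp M x) = x" for x using h by (rule matching_involution)
  have U: "\<Union>(edges M) = darts M" using h by (auto simp: edges_def matching_def)
  have "2 * card (edges M) = card (\<Union>(edges M))"
  proof (rule card_partition)
    show "finite (edges M)" using fin by (simp add: edges_def)
    show "finite (\<Union>(edges M))" using fin U by simp
    show "card e = 2" if e: "e \<in> edges M" for e
    proof -
      obtain d where "d \<in> darts M" "e = {d, opp M d}" using e by (auto simp: edges_def)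
      then show ?thesis using h by (auto simp: matching_def card_insert_if)
    qed
    show "e \<inter> e' = {}" if e: "e \<in> edges M" "e' \<in> edges M" "e \<noteq> e'" for e e'
    proof -
      obtain d d' where d: "e = {d, opp M d}" "e' = {d', opp M d'}" using e by (auto simp: edges_def)
      have "{x, opp M x} = {y, opp M y}" if "x \<in> {y, opp M y}" for x y using that inv by auto
      then show ?thesis using d e(3) by (metis disjoint_iff)
    qed
  qed
  then show ?thesis using U by simp
qed

lemma faces_eq_cycles: "premap M \<Longrightarrow> faces M = cycles (darts M) (face_perm M)"
  unfolding faces_def using cycles_eq_orbits premap_bijs(3) premap_def by metis

lemma vertex_of_eq_cycle: "premap M \<Longrightarrow> d \<in> darts M \<Longrightarrow> vertex_of M d = cycle (darts M) (rot M) d"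
  unfolding vertex_of_def using cycle_eq_orbit premap_bijs(1) premap_def by metis

lemma vertices_eq_cycles: "premap M \<Longrightarrow> vertices M = cycles (darts M) (rot M)"
  unfolding vertices_def parts_def by (rule image_cong[OF refl]) (rule vertex_of_eq_cycle)

text \<open>
  With the face permutation \<open>rot M \<circ> opp M\<close>, the rotation is again the product of the face permutation
  and the reversal, so that planarity is sphericity of a gluing in which every dart is a side.
\<close>

lemma planar_map_iff_spherical:
  assumes M: "premap M"
  shows "planar_map M \<longleftrightarrow> spherical (darts M) (face_perm M) (darts M) (opp M)"
proof -
  have "planar_map M \<longleftrightarrow> connected_darts M \<and>
      int (card (vertices M)) - int (card (edges M)) + int (card (faces M)) = 2"
    unfolding planar_map_def cmap_iff_premap using M by simp
  also have "(int (card (vertices M)) - int (card (edges M)) + int (card (faces M)) = 2) \<longleftrightarrow>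
      2 * card (vertices M) + 2 * card (faces M) = card (darts M) + 4"
    using card_edges[OF M] by linarith
  finally show ?thesis
    unfolding spherical_def connected_darts_iff[OF M] premap_bijs(4)[OF M]
      faces_eq_cycles[OF M] vertices_eq_cycles[OF M] .
qed

lemma conn_image: "(x, y) \<in> conn S \<Longrightarrow> (g x, g y) \<in> conn ((\<lambda>(x, y). (g x, g y)) ` S)"
proof (induction rule: conn_induct)
  case (fwd u v)
  then have "(g u, g v) \<in> conn ((\<lambda>(x, y). (g x, g y)) ` S)" by (intro conn_base) auto
  with fwd(1) show ?case by (rule conn_trans)
next
  case (bwd u v)
  then have "(g v, g u) \<in> conn ((\<lambda>(x, y). (g x, g y)) ` S)" by (intro conn_base) auto
  then have "(g u, g v) \<in> conn ((\<lambda>(x, y). (g x, g y)) ` S)" by (rule conn_sym)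
  with bwd(1) show ?case by (rule conn_trans)
qed simp

lemma card_parts_image:
  assumes inj: "inj_on g D" and S: "S \<subseteq> D \<times> D"
  shows "card (parts (g ` D) ((\<lambda>(x, y). (g x, g y)) ` S)) = card (parts D S)"
proof -
  let ?S = "(\<lambda>(x, y). (g x, g y)) ` S" and ?i = "inv_into D g"
  have pull_back: "(\<lambda>(x, y). (?i x, ?i y)) ` ?S = S"
    using inj S by (force simp: image_image)
  have iff: "(g x, g y) \<in> conn ?S \<longleftrightarrow> (x, y) \<in> conn S" if "x \<in> D" "y \<in> D" for x y
  proof
    assume "(g x, g y) \<in> conn ?S"
    then have "(?i (g x), ?i (g y)) \<in> conn S" using conn_image[of "g x" "g y" ?S ?i] pull_back by simp
    then show "(x, y) \<in> conn S" using that inj by simp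
  qed (rule conn_image)
  have cl: "cl ?S (g x) = g ` cl S x" if x: "x \<in> D" for x
  proof
    have "cl ?S (g x) \<subseteq> g ` D" by (rule cl_subset) (use S x in auto)
    then show "cl ?S (g x) \<subseteq> g ` cl S x"
      using iff[OF x] unfolding cl_def by blast
    show "g ` cl S x \<subseteq> cl ?S (g x)" using conn_image[of x _ S g] unfolding cl_def by blast
  qed
  have "parts (g ` D) ?S = (`) g ` parts D S"
    unfolding parts_def image_image by (rule image_cong[OF refl]) (rule cl)
  moreover have "inj_on ((`) g) (parts D S)"
    by (rule inj_on_subset[OF inj_on_image_Pow[OF inj]]) (use parts_subset[OF S] in blast)
  ultimately show ?thesis by (simp add: card_image)
qed

lemma link_image:
  assumes "\<And>x. x \<in> D \<Longrightarrow> g (f x) = f' (g x)"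
  shows "link (g ` D) f' = (\<lambda>(x, y). (g x, g y)) ` link D f"
  using assms by (force simp: link_def)

lemma spherical_image:
  assumes g: "bij_betw g D D'" and f: "f ` D \<subseteq> D" and h: "h ` D \<subseteq> D"
    and gf: "\<And>x. x \<in> D \<Longrightarrow> g (f x) = f' (g x)" and gh: "\<And>x. x \<in> D \<Longrightarrow> g (h x) = h' (g x)"
  shows "spherical D' f' D' h' = spherical D f D h"
proof -
  have D': "D' = g ` D" and inj: "inj_on g D" using g by (auto simp: bij_betw_def)
  have fh: "(f \<circ> h) ` D \<subseteq> D" using f h by auto
  have gfh: "g ((f \<circ> h) x) = (f' \<circ> h') (g x)" if "x \<in> D" for x
  proof -
    have "h x \<in> D" using h that by blast
    then show ?thesis using gf gh that by simp
  qed
  have l: "link D f \<union> link D h \<subseteq> D \<times> D" using link_subset[OF f] link_subset[OF h] by simp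
  have e: "link (g ` D) f' = (\<lambda>(x, y). (g x, g y)) ` link D f"
    "link (g ` D) h' = (\<lambda>(x, y). (g x, g y)) ` link D h"
    "link (g ` D) (f' \<circ> h') = (\<lambda>(x, y). (g x, g y)) ` link D (f \<circ> h)"
    by (rule link_image, rule gf, assumption, rule link_image, rule gh, assumption,
        rule link_image, rule gfh, assumption)
  show ?thesis
    unfolding spherical_def D' e image_Un[symmetric] card_image[OF inj]
      card_parts_image[OF inj l] card_parts_image[OF inj link_subset[OF f]]
      card_parts_image[OF inj link_subset[OF fh]] ..
qed


section \<open>Maps with equal face degrees\<close>

definition block_map :: "nat \<Rightarrow> nat \<Rightarrow> (nat \<Rightarrow> nat) \<Rightarrow> nat cmap" where
  "block_map k n h = \<lparr>darts = {..<k * n}, rot = block_perm k n \<circ> h, opp = h\<rparr>"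

abbreviation block_gluings :: "nat \<Rightarrow> nat \<Rightarrow> (nat \<Rightarrow> nat) set" where
  "block_gluings k n \<equiv> gluings {..<k * n} (block_perm k n) {..<k * n}"

definition face_regular_map :: "nat \<Rightarrow> nat \<Rightarrow> 'd cmap \<Rightarrow> bool" where
  "face_regular_map k n M \<longleftrightarrow> planar_map M \<and> card (faces M) = n \<and> (\<forall>F\<in>faces M. card F = k)"

lemma block_map_sel [simp]:
  "darts (block_map k n h) = {..<k * n}" "rot (block_map k n h) = block_perm k n \<circ> h"
  "opp (block_map k n h) = h"
  by (simp_all add: block_map_def)

lemma block_map_face_perm:
  assumes "h \<in> block_gluings k n"
  shows "face_perm (block_map k n h) = block_perm k n"
  using matching_involution[of "{..<k * n}" h] assms by (simp add: gluings_def fun_eq_iff)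

lemma block_map_premap:
  assumes "k > 0" "n > 0" "h \<in> block_gluings k n"
  shows "premap (block_map k n h)"
proof -
  have h: "matching {..<k * n} h" using assms(3) by (simp add: gluings_def)
  have "block_perm k n \<circ> h permutes {..<k * n}"
    using matching_permutes[OF h] block_perm_permutes by (rule permutes_compose)
  then show ?thesis using h assms(1,2) by (simp add: premap_def lessThan_empty_iff)
qed

lemma block_map_regular:
  assumes "k > 0" "n > 0" "h \<in> block_gluings k n"
  shows "face_regular_map k n (block_map k n h)"
proof -
  let ?M = "block_map k n h"
  note pre = block_map_premap[OF assms] and fp = block_map_face_perm[OF assms(3)]
  have "spherical (darts ?M) (face_perm ?M) (darts ?M) (opp ?M)"
    unfolding fp using assms(3) by (simp add: gluings_def)
  then have "planar_map ?M" using planar_map_iff_spherical[OF pre] by simp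
  moreover have "faces ?M = cycles {..<k * n} (block_perm k n)"
    unfolding faces_eq_cycles[OF pre] fp by simp
  ultimately show ?thesis
    using block_cycles_card[OF assms(1)] by (simp add: face_regular_map_def)
qed

lemma finite_block_gluings: "finite (block_gluings k n)"
  by (rule finite_gluings) simp

text \<open>
  The two cases in use: quadrangles, or a single face of any degree, which is then the root face.
\<close>

lemma card_block_gluings:
  assumes "k > 0" "n > 0" and "k = 4 \<or> n = 1"
  shows "card (block_gluings k n) = fact (n - 1) * 4 ^ (n - 1) * disk_count k (n - 1)"
proof (rule card_gluings)
  let ?D = "{..<k * n}" and ?f = "block_perm k n"
  have sub: "C \<inter> ?D = C" if "C \<in> cycles ?D ?f" for C
    using parts_subset[OF link_stable[OF block_perm_bij] that] by (rule Int_absorb2)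
  have "0 \<in> ?D" using assms(1,2) by simp
  then show c0: "cycle ?D ?f 0 \<in> cycles ?D ?f" by (rule cl_in_parts)
  show "card (cycle ?D ?f 0 \<inter> ?D) = k" unfolding sub[OF c0] by (rule block_cycles_card(2)[OF assms(1) c0])
  show "card (cycles ?D ?f) = Suc (n - 1)" using block_cycles_card(1)[OF assms(1)] assms(2) by simp
  show "card (C \<inter> ?D) = 4" if C: "C \<in> cycles ?D ?f - {cycle ?D ?f 0}" for C
  proof (cases "k = 4")
    case True
    have "C \<in> cycles ?D ?f" using C by blast
    then show ?thesis using sub block_cycles_card(2)[OF assms(1)] True by metis
  next
    case False
    then have "n = 1" using assms(3) by simp
    then have "card (cycles ?D ?f) = 1" using block_cycles_card(1)[OF assms(1), of n] by metis
    then obtain X where "cycles ?D ?f = {X}" by (auto simp: card_1_singleton_iff)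
    then show ?thesis using C c0 by blast
  qed
qed (use block_perm_bij in auto)

text \<open>
  Rigidity: by connectedness, the image of one dart determines an isomorphism.
\<close>

lemma cmap_iso_unique:
  assumes N: "cmap N" and g: "cmap_iso g N M" and g': "cmap_iso g' N M"
    and r: "r \<in> darts N" "g r = g' r" and x: "x \<in> darts N"
  shows "g x = g' x"
proof -
  let ?R = "{(x, rot N x) |x. x \<in> darts N} \<union> {(x, opp N x) |x. x \<in> darts N}"
  have "(r, x) \<in> ?R\<^sup>*" using N r(1) x by (simp add: cmap_def connected_darts_def)
  then show ?thesis
  proof (induction rule: rtrancl_induct)
    case (step y z)
    then have "y \<in> darts N" "z = rot N y \<or> z = opp N y" by blast+
    then show ?case using g g' step.IH by (auto simp: cmap_iso_def)
  qed (rule r(2))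
qed

text \<open>
  The reversal of arcs of \<open>M\<close>, carried back along an identification \<open>g\<close> of the faces.
\<close>

definition pull_opp :: "'a set \<Rightarrow> 'd cmap \<Rightarrow> ('a \<Rightarrow> 'd) \<Rightarrow> 'a \<Rightarrow> 'a" where
  "pull_opp D M g x = (if x \<in> D then inv_into D g (opp M (g x)) else x)"

text \<open>
  Every identification of the faces of \<open>M\<close> with the reference faces transports the reversal of arcs to a
  gluing that is isomorphic to \<open>M\<close>. By rigidity, different identifications respecting the root yield
  different gluings.
\<close>

lemma card_gluings_iso:
  fixes M :: "'d cmap"
  assumes kn: "k > 0" "n > 0" and M: "face_regular_map k n M" and r: "r \<in> darts M"
  shows "card {h \<in> block_gluings k n. \<exists>g. cmap_iso g (block_map k n h) M \<and> g 0 = r} =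
    fact (n - 1) * k ^ (n - 1)"
proof -
  let ?D = "{..<k * n}" and ?f = "block_perm k n" and ?f' = "face_perm M"
  let ?G = "{g \<in> perm_isos ?D ?f (darts M) ?f'. g 0 = r}"
  let ?H = "{h \<in> block_gluings k n. \<exists>g. cmap_iso g (block_map k n h) M \<and> g 0 = r}"
  have pre: "premap M" using M by (simp add: face_regular_map_def planar_map_def cmap_iff_premap)
  have sph: "spherical (darts M) ?f' (darts M) (opp M)"
    using M planar_map_iff_spherical[OF pre] by (simp add: face_regular_map_def)
  have inv: "opp M (opp M x) = x" for x
    using pre by (intro matching_involution[of "darts M"]) (simp add: premap_def)
  have opp_in: "opp M x \<in> darts M" "opp M x \<noteq> x" if "x \<in> darts M" for x
    using pre that by (auto simp: premap_def matching_def)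
  have zero: "0 \<in> ?D" using kn by simp
  have f_in: "?f x \<in> ?D" if "x \<in> ?D" for x using bij_betwE[OF block_perm_bij] that by blast
  have pull: "g (pull_opp ?D M g x) = opp M (g x)" "pull_opp ?D M g x \<in> ?D"
    if g: "g \<in> ?G" and x: "x \<in> ?D" for g x
  proof -
    have bg: "bij_betw g ?D (darts M)" using g by (simp add: perm_isos_def)
    then have "opp M (g x) \<in> g ` ?D" using opp_in x by (auto simp: bij_betw_def)
    then show "g (pull_opp ?D M g x) = opp M (g x)" "pull_opp ?D M g x \<in> ?D"
      unfolding pull_opp_def using x by (simp_all add: f_inv_into_f inv_into_into del: lessThan_iff)
  qed
  have match: "matching ?D (pull_opp ?D M g)" if g: "g \<in> ?G" for g
  proof -
    have inj: "inj_on g ?D" and gD: "g ` ?D = darts M" using g by (auto simp: perm_isos_def bij_betw_def)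
    show ?thesis
      unfolding matching_def
    proof (intro conjI ballI allI impI)
      fix x assume x: "x \<in> ?D"
      have gx: "g x \<in> darts M" using x gD by blast
      show p: "pull_opp ?D M g x \<in> ?D" by (rule pull(2)[OF g x])
      show "pull_opp ?D M g x \<noteq> x" using pull(1)[OF g x] opp_in(2)[OF gx] by metis
      have "g (pull_opp ?D M g (pull_opp ?D M g x)) = g x"
        unfolding pull(1)[OF g p] pull(1)[OF g x] by (rule inv)
      then show "pull_opp ?D M g (pull_opp ?D M g x) = x"
        by (rule inj_onD[OF inj _ pull(2)[OF g p] x])
    qed (simp add: pull_opp_def)
  qed
  have glue: "pull_opp ?D M g \<in> block_gluings k n" if g: "g \<in> ?G" for g
  proof -
    have "spherical (darts M) ?f' (darts M) (opp M) = spherical ?D ?f ?D (pull_opp ?D M g)"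
    proof (rule spherical_image[of g])
      show "bij_betw g ?D (darts M)" using g by (simp add: perm_isos_def)
      show "?f ` ?D \<subseteq> ?D" using f_in by blast
      show "pull_opp ?D M g ` ?D \<subseteq> ?D" using pull(2)[OF g] by blast
      show "g (?f x) = ?f' (g x)" if "x \<in> ?D" for x using g that by (simp add: perm_isos_def)
      show "g (pull_opp ?D M g x) = opp M (g x)" if "x \<in> ?D" for x by (rule pull(1)[OF g that])
    qed
    then show ?thesis using sph match[OF g] by (simp add: gluings_def)
  qed
  have iso: "cmap_iso g (block_map k n (pull_opp ?D M g)) M" if g: "g \<in> ?G" for g
    unfolding cmap_iso_def block_map_sel
  proof (intro conjI ballI)
    show "bij_betw g ?D (darts M)" using g by (simp add: perm_isos_def)
    fix x assume x: "x \<in> ?D"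
    show "g (pull_opp ?D M g x) = opp M (g x)" by (rule pull(1)[OF g x])
    have "g ((?f \<circ> pull_opp ?D M g) x) = ?f' (g (pull_opp ?D M g x))"
      using g pull(2)[OF g x] by (simp add: perm_isos_def)
    also have "\<dots> = rot M (g x)" unfolding pull(1)[OF g x] by (simp add: inv)
    finally show "g ((?f \<circ> pull_opp ?D M g) x) = rot M (g x)" .
  qed
  have "bij_betw (pull_opp ?D M) ?G ?H"
    unfolding bij_betw_def
  proof
    show "inj_on (pull_opp ?D M) ?G"
    proof (rule inj_onI)
      fix g g' assume g: "g \<in> ?G" and g': "g' \<in> ?G" and eq: "pull_opp ?D M g = pull_opp ?D M g'"
      let ?N = "block_map k n (pull_opp ?D M g)"
      have N: "cmap ?N" using block_map_regular[OF kn glue[OF g]] by (simp add: face_regular_map_def planar_map_def)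
      have g'': "cmap_iso g' ?N M" using iso[OF g'] eq by simp
      have same: "g 0 = g' 0" using g g' by simp
      have zero': "0 \<in> darts ?N" using zero by simp
      have "g x = g' x" if "x \<in> ?D" for x
      proof -
        have "x \<in> darts ?N" using that by simp
        then show ?thesis by (rule cmap_iso_unique[OF N iso[OF g] g'' zero' same])
      qed
      then show "g = g'"
        using g g' by (intro extensionalityI[of g ?D g']) (auto simp: perm_isos_def)
    qed
    show "pull_opp ?D M ` ?G = ?H"
    proof
      show "pull_opp ?D M ` ?G \<subseteq> ?H"
      proof
        fix h assume "h \<in> pull_opp ?D M ` ?G"
        then obtain g where g: "g \<in> ?G" "h = pull_opp ?D M g" by blast
        then have "g 0 = r" by simp
        then show "h \<in> ?H" using glue[OF g(1)] iso[OF g(1)] g(2) by blast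
      qed
      show "?H \<subseteq> pull_opp ?D M ` ?G"
      proof
        fix h assume "h \<in> ?H"
        then obtain g where h: "h \<in> block_gluings k n" and g: "cmap_iso g (block_map k n h) M" "g 0 = r"
          by blast
        have m: "matching ?D h" using h by (simp add: gluings_def)
        have h_in: "h x \<in> ?D" if "x \<in> ?D" for x using m that unfolding matching_def by blast
        have bg: "bij_betw g ?D (darts M)" using g(1) by (simp add: cmap_iso_def)
        have go: "g (h x) = opp M (g x)" if "x \<in> ?D" for x using g(1) that by (simp add: cmap_iso_def)
        have gr: "g (?f (h x)) = rot M (g x)" if "x \<in> ?D" for x using g(1) that by (simp add: cmap_iso_def)
        define e where "e = restrict g ?D"
        have e: "e x = g x" if "x \<in> ?D" for x using that by (simp add: e_def)
        have "bij_betw e ?D (darts M)"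
          using bg unfolding e_def by (rule bij_betw_cong[THEN iffD1, rotated]) simp
        moreover have "e (?f x) = ?f' (e x)" if x: "x \<in> ?D" for x
        proof -
          have "g (?f (h (h x))) = rot M (g (h x))" by (rule gr[OF h_in[OF x]])
          then have "g (?f x) = rot M (opp M (g x))" unfolding go[OF x] matching_involution[OF m] .
          then show ?thesis unfolding e[OF x] e[OF f_in[OF x]] by simp
        qed
        ultimately have "e \<in> perm_isos ?D ?f (darts M) ?f'" by (simp add: perm_isos_def e_def)
        then have "e \<in> ?G" using e[OF zero] g(2) by simp
        moreover have "pull_opp ?D M e = h"
        proof
          fix x
          show "pull_opp ?D M e x = h x"
          proof (cases "x \<in> ?D")
            case True
            have "opp M (e x) = e (h x)" unfolding e[OF True] e[OF h_in[OF True]] go[OF True] ..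
            then have "pull_opp ?D M e x = inv_into ?D e (e (h x))" using True by (simp add: pull_opp_def)
            also have "\<dots> = h x"
              using bij_betw_imp_inj_on[OF \<open>bij_betw e ?D (darts M)\<close>] h_in[OF True] by (rule inv_into_f_f)
            finally show ?thesis .
          next
            case False
            then show ?thesis using m by (simp add: pull_opp_def matching_def)
          qed
        qed
        ultimately show "h \<in> pull_opp ?D M ` ?G" by blast
      qed
    qed
  qed
  then have "card ?H = card ?G" by (rule bij_betw_same_card[symmetric])
  also have "card ?G = fact (n - 1) * k ^ (n - 1)"
  proof (rule card_perm_isos(2))
    show "finite (darts M)" using pre by (simp add: premap_def)
    show "bij_betw ?f' (darts M) (darts M)" by (rule premap_bijs(3)[OF pre])
    show "card (cycles (darts M) ?f') = n" "\<And>C. C \<in> cycles (darts M) ?f' \<Longrightarrow> card C = k"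
      using M unfolding face_regular_map_def faces_eq_cycles[OF pre] by blast+
  qed (use block_perm_bij block_cycles_card[OF kn(1)] zero r in auto)
  finally show ?thesis .
qed

lemma face_regular_map_vertices:
  assumes M: "face_regular_map k n M"
  shows "2 * card (vertices M) + 2 * n = k * n + 4"
proof -
  have pre: "premap M" using M by (simp add: face_regular_map_def planar_map_def cmap_iff_premap)
  have sph: "spherical (darts M) (face_perm M) (darts M) (opp M)"
    using M planar_map_iff_spherical[OF pre] by (simp add: face_regular_map_def)
  have "card (darts M) = k * card (cycles (darts M) (face_perm M))"
    by (rule card_equal_cycles)
      (use M pre premap_bijs(3)[OF pre] in \<open>auto simp: premap_def face_regular_map_def faces_eq_cycles[OF pre]\<close>)
  then show ?thesis
    using sph M unfolding spherical_def premap_bijs(4)[OF pre] vertices_eq_cycles[OF pre] face_regular_map_def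
      faces_eq_cycles[OF pre] by simp
qed

lemma quads_regular: "quadrangulation M \<and> card (faces M) = n \<longleftrightarrow> face_regular_map 4 n M"
  by (auto simp: quadrangulation_def face_regular_map_def)

text \<open>
  The factor \<open>(n - 1)! * 4 ^ (n - 1)\<close> in the number of gluings is exactly the number of gluings that
  represent one rooted quadrangulation.
\<close>

lemma num_rooted_quads_eq:
  assumes "n > 0"
  shows "num_rooted_quads n = disk_count 4 (n - 1)"
proof -
  let ?S = "rooted_quads n" and ?X = "block_gluings 4 n"
  let ?F = "\<lambda>h. (block_map 4 n h, 0 :: nat)"
  let ?R = "rooted_iso \<inter> ?S \<times> ?S"
  let ?c = "fact (n - 1) * 4 ^ (n - 1) :: nat"
  have S: "(M, r) \<in> ?S \<longleftrightarrow> face_regular_map 4 n M \<and> r \<in> darts M" for M r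
    using quads_regular[of M n] by (auto simp: rooted_quads_def)
  have F: "?F h \<in> ?S" if "h \<in> ?X" for h
    unfolding S using block_map_regular[OF _ assms that] assms by simp
  have "card ?X = ?c * card (?S // ?R)"
  proof (rule card_quotient_fibers[OF equiv_rooted_iso finite_block_gluings])
    show "?F ` ?X \<subseteq> ?S" using F by blast
    fix s assume s: "s \<in> ?S"
    obtain M r where Mr: "s = (M, r)" by (cases s)
    have "{h \<in> ?X. (?F h, s) \<in> ?R} = {h \<in> ?X. \<exists>g. cmap_iso g (block_map 4 n h) M \<and> g 0 = r}"
      using F s unfolding Mr by (auto simp: rooted_iso_def)
    then show "card {h \<in> ?X. (?F h, s) \<in> ?R} = ?c"
      using card_gluings_iso[of 4 n M r] assms s unfolding Mr S by simp
  qed simp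
  then have "?c * card (?S // ?R) = ?c * disk_count 4 (n - 1)"
    using card_block_gluings[of 4 n] assms by simp
  then show ?thesis using assms by (simp add: num_rooted_quads_def)
qed

text \<open>
  By rigidity a rooted quadrangulation has no symmetry that could identify two of its \<open>n + 2\<close> vertices.
\<close>

lemma num_rooted_pointed_quads_eq:
  assumes "n > 0"
  shows "num_rooted_pointed_quads n = (n + 2) * disk_count 4 (n - 1)"
proof -
  let ?S = "rooted_pointed_quads n" and ?X = "block_gluings 4 n"
  let ?V = "\<lambda>h. vertices (block_map 4 n h)"
  let ?F = "\<lambda>p. (block_map 4 n (fst p), 0 :: nat, snd p)"
  let ?R = "rooted_pointed_iso \<inter> ?S \<times> ?S"
  let ?c = "fact (n - 1) * 4 ^ (n - 1) :: nat"
  have S: "(M, r, v) \<in> ?S \<longleftrightarrow> face_regular_map 4 n M \<and> r \<in> darts M \<and> v \<in> vertices M" for M r v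
    using quads_regular[of M n] by (auto simp: rooted_pointed_quads_def)
  have reg: "face_regular_map 4 n (block_map 4 n h)" if "h \<in> ?X" for h
    using block_map_regular[OF _ assms that] by simp
  have cV: "card (?V h) = n + 2" if "h \<in> ?X" for h
    using face_regular_map_vertices[OF reg[OF that]] by simp
  have fV: "finite (?V h)" for h by (simp add: vertices_def)
  have F: "?F p \<in> ?S" if "p \<in> Sigma ?X ?V" for p
    unfolding S using reg that assms by auto
  have "card (Sigma ?X ?V) = ?c * card (?S // ?R)"
  proof (rule card_quotient_fibers[OF equiv_rooted_pointed_iso])
    show "finite (Sigma ?X ?V)" using finite_block_gluings fV by (rule finite_SigmaI)
    show "?F ` Sigma ?X ?V \<subseteq> ?S" using F by blast
    fix s assume s: "s \<in> ?S"
    obtain M r w where Mr: "s = (M, r, w)" by (metis prod_cases3)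
    have M: "face_regular_map 4 n M" "r \<in> darts M" "w \<in> vertices M" using s unfolding Mr S by blast+
    have eq: "{p \<in> Sigma ?X ?V. (?F p, s) \<in> ?R} = {p \<in> Sigma ?X ?V.
        (\<exists>g. cmap_iso g (block_map 4 n (fst p)) M \<and> g 0 = r \<and> g ` snd p = w)}"
      using F s unfolding Mr by (auto simp: rooted_pointed_iso_def)
    have "card {p \<in> Sigma ?X ?V. (\<exists>g. cmap_iso g (block_map 4 n (fst p)) M \<and> g 0 = r \<and> g ` snd p = w)} =
        card {h \<in> ?X. \<exists>g. cmap_iso g (block_map 4 n h) M \<and> g 0 = r}"
    proof (rule card_Sigma_unique)
      fix h assume h: "h \<in> ?X" and ex: "\<exists>g. cmap_iso g (block_map 4 n h) M \<and> g 0 = r"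
      let ?N = "block_map 4 n h"
      have N: "cmap ?N" using reg[OF h] by (simp add: face_regular_map_def planar_map_def)
      obtain g where g: "cmap_iso g ?N M" "g 0 = r" using ex by blast
      have inj: "inj_on g (darts ?N)" using g(1) by (simp add: cmap_iso_def bij_betw_def)
      have zero: "0 \<in> darts ?N" using assms by simp
      have vD: "v \<subseteq> darts ?N" if "v \<in> ?V h" for v
        using that vertex_of_subset[OF N] unfolding vertices_def by blast
      have "w \<in> (`) g ` ?V h" using M(3) vertices_iso[OF N g(1)] by simp
      then obtain v where v: "v \<in> ?V h" "g ` v = w" by blast
      show "\<exists>!v. v \<in> ?V h \<and> (\<exists>g. cmap_iso g ?N M \<and> g 0 = r \<and> g ` v = w)"
      proof (rule ex1I[of _ v])
        show "v \<in> ?V h \<and> (\<exists>g. cmap_iso g ?N M \<and> g 0 = r \<and> g ` v = w)" using v g by blast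
        fix v' assume "v' \<in> ?V h \<and> (\<exists>g. cmap_iso g ?N M \<and> g 0 = r \<and> g ` v' = w)"
        then obtain g' where v': "v' \<in> ?V h" and g': "cmap_iso g' ?N M" "g' 0 = r" "g' ` v' = w" by blast
        have "g x = g' x" if "x \<in> v'" for x
        proof (rule cmap_iso_unique[OF N g(1) g'(1) zero])
          show "g 0 = g' 0" using g(2) g'(2) by simp
          show "x \<in> darts ?N" using vD[OF v'] that by blast
        qed
        then have "g ` v' = g ` v" using g'(3) v(2) by (simp cong: image_cong)
        then show "v' = v" using inj_on_image_eq_iff[OF inj vD[OF v'] vD[OF v(1)]] by simp
      qed
    qed blast
    also have "\<dots> = ?c" by (rule card_gluings_iso[OF zero_less_numeral assms M(1,2)])
    finally show "card {p \<in> Sigma ?X ?V. (?F p, s) \<in> ?R} = ?c" unfolding eq .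
  qed simp
  moreover have "card (Sigma ?X ?V) = (\<Sum>h\<in>?X. card (?V h))"
    using finite_block_gluings fV by (intro card_SigmaI) auto
  moreover have "(\<Sum>h\<in>?X. card (?V h)) = card ?X * (n + 2)" using cV by simp
  ultimately have "?c * card (?S // ?R) = card ?X * (n + 2)" by (simp only:)
  also have "card ?X = ?c * disk_count 4 (n - 1)"
    using assms by (intro card_block_gluings) simp_all
  finally have "?c * card (?S // ?R) = ?c * ((n + 2) * disk_count 4 (n - 1))"
    by (simp only: mult_ac)
  then have "card (?S // ?R) = (n + 2) * disk_count 4 (n - 1)"
    by (subst (asm) mult_cancel1) simp
  then show ?thesis using assms by (simp add: num_rooted_pointed_quads_def)
qed


section \<open>Labelled trees\<close>

text \<open>
  Labellings as functions on the vertices, made unique elsewhere so that they can be counted.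
\<close>

definition labelings :: "'d cmap \<Rightarrow> 'd \<Rightarrow> ('d set \<Rightarrow> int) set" where
  "labelings N r = {l \<in> extensional (vertices N).
     (\<forall>d\<in>darts N. \<bar>l (vertex_of N d) - l (vertex_of N (opp N d))\<bar> \<le> 1) \<and> l (vertex_of N r) = 1}"

text \<open>
  The single face of a tree has both arcs of every edge on its boundary.
\<close>

lemma tree_regular:
  "planar_map M \<and> card (faces M) = 1 \<and> card (edges M) = n \<longleftrightarrow> face_regular_map (2 * n) 1 M"
proof (cases "planar_map M \<and> card (faces M) = 1")
  case True
  then have pre: "premap M" by (simp add: planar_map_def cmap_iff_premap)
  obtain C where C: "faces M = {C}" using True by (auto simp: card_1_singleton_iff)
  have "\<Union>(faces M) = darts M"
    unfolding faces_eq_cycles[OF pre] by (rule Union_parts[OF link_stable[OF premap_bijs(3)[OF pre]]])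
  then have "C = darts M" using C by simp
  then have "card C = 2 * card (edges M)" using card_edges[OF pre] by simp
  then show ?thesis using True C by (auto simp: face_regular_map_def)
qed (auto simp: face_regular_map_def)

lemma vertex_of_rot:
  assumes "premap N" "d \<in> darts N"
  shows "vertex_of N (rot N d) = vertex_of N d"
proof -
  have "rot N d \<in> darts N" using bij_betwE[OF premap_bijs(1)[OF assms(1)]] assms(2) by blast
  moreover have "(d, rot N d) \<in> conn (link (darts N) (rot N))"
    using assms(2) by (intro conn_base) (auto simp: link_def)
  ultimately show ?thesis
    using vertex_of_eq_cycle[OF assms(1)] assms(2) by (simp add: cl_eq_iff conn_sym)
qed

text \<open>
  A labelling corresponds to its increments along the edges. They determine it by connectedness, and
  they can be prescribed because a tree has one vertex more than edges, so that adding its edges to the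
  isolated vertices joins two components each time.
\<close>

lemma card_labelings:
  fixes N :: "nat cmap"
  assumes N: "planar_map N" "card (faces N) = 1" and r: "r \<in> darts N"
  shows "card (labelings N r) = 3 ^ card (edges N)" and "finite (labelings N r)"
proof -
  let ?D = "darts N" and ?v = "vertex_of N"
  have cm: "cmap N" using N by (simp add: planar_map_def)
  have pre: "premap N" using cm by (simp add: cmap_iff_premap)
  have fin: "finite ?D" and h: "matching ?D (opp N)" using pre by (auto simp: premap_def)
  have inv: "opp N (opp N d) = d" for d using h by (rule matching_involution)
  have opp_in: "opp N d \<in> ?D" "opp N d \<noteq> d" if "d \<in> ?D" for d using h that by (auto simp: matching_def)
  have rot_in: "rot N d \<in> ?D" if "d \<in> ?D" for d using bij_betwE[OF premap_bijs(1)[OF pre]] that by blast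
  have reach: "P d" if d: "d \<in> ?D" and r0: "P r"
    and rot: "\<And>x. x \<in> ?D \<Longrightarrow> P x \<Longrightarrow> P (rot N x)" and opp: "\<And>x. x \<in> ?D \<Longrightarrow> P x \<Longrightarrow> P (opp N x)" for P d
  proof -
    have "(r, d) \<in> ({(x, rot N x) |x. x \<in> ?D} \<union> {(x, opp N x) |x. x \<in> ?D})\<^sup>*"
      using cm r d by (simp add: cmap_def connected_darts_def)
    then show ?thesis
      by (induction rule: rtrancl_induct) (use r0 rot opp in blast)+
  qed

  \<comment> \<open>Darts are numbers, and the smaller dart of every edge gives it a direction.\<close>
  define E where "E = {d \<in> ?D. d < opp N d}"
  have finE: "finite E" using fin by (simp add: E_def)
  have either: "d \<in> E \<or> opp N d \<in> E" if "d \<in> ?D" for d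
    using opp_in[OF that] that inv[of d] unfolding E_def by auto
  have cE: "card E = card (edges N)"
  proof -
    have "?D = E \<union> opp N ` E"
    proof
      show "?D \<subseteq> E \<union> opp N ` E"
      proof
        fix d assume "d \<in> ?D"
        then have "d \<in> E \<or> opp N d \<in> E" by (rule either)
        then show "d \<in> E \<union> opp N ` E" using inv[of d] by (metis UnCI image_eqI)
      qed
      show "E \<union> opp N ` E \<subseteq> ?D" using opp_in(1) by (auto simp: E_def)
    qed
    moreover have "E \<inter> opp N ` E = {}" by (auto simp: E_def inv)
    moreover have "card (opp N ` E) = card E"
      by (rule card_image) (metis inj_onI inv)
    ultimately have "card ?D = card E + card E"
      using card_Un_disjoint[of E "opp N ` E"] finE by simp
    then show ?thesis using card_edges[OF pre] by simp
  qed

  define \<delta> where "\<delta> = (\<lambda>l :: nat set \<Rightarrow> int. \<lambda>d\<in>E. l (?v (opp N d)) - l (?v d))"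
  have "bij_betw \<delta> (labelings N r) (E \<rightarrow>\<^sub>E {-1, 0, 1})"
    unfolding bij_betw_def
  proof
    show "inj_on \<delta> (labelings N r)"
    proof (rule inj_onI)
      fix l l' assume l: "l \<in> labelings N r" and l': "l' \<in> labelings N r" and eq: "\<delta> l = \<delta> l'"
      have eq': "l (?v (opp N d)) - l (?v d) = l' (?v (opp N d)) - l' (?v d)" if "d \<in> E" for d
        using fun_cong[OF eq, of d] that by (simp add: \<delta>_def)
      have same: "l (?v d) = l' (?v d)" if "d \<in> ?D" for d
        using that
      proof (rule reach)
        show "l (?v r) = l' (?v r)" using l l' by (simp add: labelings_def)
        show "l (?v (rot N x)) = l' (?v (rot N x))" if "x \<in> ?D" "l (?v x) = l' (?v x)" for x
          using that vertex_of_rot[OF pre that(1)] by simp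
        show "l (?v (opp N x)) = l' (?v (opp N x))" if x: "x \<in> ?D" "l (?v x) = l' (?v x)" for x
          using either[OF x(1)]
        proof
          assume "x \<in> E"
          then show ?thesis using eq'[of x] x(2) by simp
        next
          assume "opp N x \<in> E"
          then show ?thesis using eq'[of "opp N x"] x(2) inv[of x] by simp
        qed
      qed
      show "l = l'"
      proof (rule extensionalityI[of l "vertices N" l'])
        show "l \<in> extensional (vertices N)" "l' \<in> extensional (vertices N)"
          using l l' by (simp_all add: labelings_def)
        show "l u = l' u" if "u \<in> vertices N" for u using that same by (auto simp: vertices_def)
      qed
    qed
    show "\<delta> ` labelings N r = E \<rightarrow>\<^sub>E {-1, 0, 1}"
    proof
      show "\<delta> ` labelings N r \<subseteq> E \<rightarrow>\<^sub>E {-1, 0, 1}"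
      proof
        fix e assume "e \<in> \<delta> ` labelings N r"
        then obtain l where l: "l \<in> labelings N r" "e = \<delta> l" by blast
        have "e d \<in> {-1, 0, 1}" if "d \<in> E" for d
        proof -
          have "\<bar>l (?v d) - l (?v (opp N d))\<bar> \<le> 1" using l(1) that by (simp add: labelings_def E_def)
          then show ?thesis using that unfolding l(2) \<delta>_def by auto
        qed
        then show "e \<in> E \<rightarrow>\<^sub>E {-1, 0, 1}" using l(2) by (auto simp: \<delta>_def)
      qed
      show "E \<rightarrow>\<^sub>E {-1, 0, 1} \<subseteq> \<delta> ` labelings N r"
      proof
        \<comment> \<open>Prescribed increments are integrated along the tree, starting from its isolated vertices.\<close>
        fix e :: "nat \<Rightarrow> int" assume e: "e \<in> E \<rightarrow>\<^sub>E {-1, 0, 1}"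
        let ?S = "link ?D (rot N)" and ?P = "(\<lambda>d. (d, opp N d)) ` E"
        have step: "(x, opp N x) \<in> conn (?P \<union> ?S)" if x: "x \<in> ?D" for x
          using either[OF x]
        proof
          assume "x \<in> E"
          then show ?thesis by (intro conn_base) blast
        next
          assume "opp N x \<in> E"
          then have "(opp N x, x) \<in> ?P" using inv[of x] by (intro image_eqI[of _ _ "opp N x"]) simp_all
          then have "(opp N x, x) \<in> conn (?P \<union> ?S)" by (intro conn_base) simp
          then show ?thesis by (rule conn_sym)
        qed
        have all: "(r, d) \<in> conn (?P \<union> ?S)" if "d \<in> ?D" for d
          using that
        proof (rule reach)
          show "(r, rot N x) \<in> conn (?P \<union> ?S)" if "x \<in> ?D" "(r, x) \<in> conn (?P \<union> ?S)" for x
          proof -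
            have "(x, rot N x) \<in> conn (?P \<union> ?S)" using that(1) by (intro conn_base) (auto simp: link_def)
            with that(2) show ?thesis by (rule conn_trans)
          qed
          show "(r, opp N x) \<in> conn (?P \<union> ?S)" if "x \<in> ?D" "(r, x) \<in> conn (?P \<union> ?S)" for x
            using that(2) step[OF that(1)] by (rule conn_trans)
        qed simp
        have "(x, y) \<in> conn (?P \<union> ?S)" if "x \<in> ?D" "y \<in> ?D" for x y
          using conn_sym[OF all[OF that(1)]] all[OF that(2)] by (rule conn_trans)
        then have one: "card (parts ?D (?P \<union> ?S)) = 1"
          using card_parts_1_iff[of ?D] r by blast
        have "card ?P = card E" by (rule card_image) (simp add: inj_on_def)
        moreover have "card (vertices N) = card (edges N) + 1"
          using N by (simp add: planar_map_def)
        ultimately have "card (parts ?D (?P \<union> ?S)) + card ?P \<le> card (parts ?D ?S)"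
          using one cE vertices_eq_cycles[OF pre] by simp
        moreover have "?P \<subseteq> ?D \<times> ?D" using opp_in(1) by (auto simp: E_def)
        ultimately obtain lab :: "nat \<Rightarrow> int" where
          lab: "\<forall>(u, v)\<in>?S. lab u = lab v" "\<forall>(u, v)\<in>?P. lab v = lab u + e (fst (u, v))"
          using forest_labels[OF fin, of ?P ?S "\<lambda>p. e (fst p)"] finE by auto
        have const: "lab y = lab x" if "(x, y) \<in> conn ?S" for x y
          using that
        proof (induction rule: conn_induct)
          case (fwd u v)
          then show ?case using lab(1) by fastforce
        next
          case (bwd u v)
          then show ?case using lab(1) by fastforce
        qed simp
        define l where "l = (\<lambda>u\<in>vertices N. lab (SOME x. x \<in> u) - lab r + 1)"
        have lv: "l (?v d) = lab d - lab r + 1" if d: "d \<in> ?D" for d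
        proof -
          have "?v d \<in> vertices N" using d by (simp add: vertices_def)
          moreover have "lab (SOME x. x \<in> ?v d) = lab d"
          proof (rule const)
            have "d \<in> ?v d" using vertex_of_eq_cycle[OF pre d] by simp
            then have "(SOME x. x \<in> ?v d) \<in> ?v d" by (rule someI)
            then show "(d, SOME x. x \<in> ?v d) \<in> conn ?S"
              using vertex_of_eq_cycle[OF pre d] by (simp add: cl_iff)
          qed
          ultimately show ?thesis by (simp add: l_def)
        qed
        have inc: "lab (opp N d) = lab d + e d" if "d \<in> E" for d using lab(2) that by auto
        have e_abs: "\<bar>e d\<bar> \<le> 1" if "d \<in> E" for d using e that by (auto simp: PiE_def Pi_def)
        have "l \<in> labelings N r"
          unfolding labelings_def
        proof (intro CollectI conjI ballI)
          show "l \<in> extensional (vertices N)" by (simp add: l_def)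
          show "l (?v r) = 1" using lv[OF r] by simp
          fix d assume d: "d \<in> ?D"
          from either[OF d] show "\<bar>l (?v d) - l (?v (opp N d))\<bar> \<le> 1"
          proof
            assume "d \<in> E"
            then show ?thesis using lv[OF d] lv[OF opp_in(1)[OF d]] inc[of d] e_abs[of d] by simp
          next
            assume "opp N d \<in> E"
            then show ?thesis
              using lv[OF d] lv[OF opp_in(1)[OF d]] inc[of "opp N d"] e_abs[of "opp N d"] inv[of d] by simp
          qed
        qed
        moreover have "\<delta> l = e"
        proof (rule extensionalityI[of _ E])
          show "\<delta> l \<in> extensional E" by (simp add: \<delta>_def)
          show "e \<in> extensional E" using e by (simp add: PiE_def)
          fix d assume d: "d \<in> E"
          then have "d \<in> ?D" by (simp add: E_def)
          then show "\<delta> l d = e d"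
            using d lv[of d] lv[OF opp_in(1)] inc[OF d] by (simp add: \<delta>_def)
        qed
        ultimately show "e \<in> \<delta> ` labelings N r" by blast
      qed
    qed
  qed
  note bij = this
  have "card (E \<rightarrow>\<^sub>E {-1, 0, 1 :: int}) = card {-1, 0, 1 :: int} ^ card E"
    by (rule card_funcsetE[OF finE])
  also have "card {-1, 0, 1 :: int} = 3" by simp
  finally show "card (labelings N r) = 3 ^ card (edges N)"
    using bij_betw_same_card[OF bij] cE by simp
  have "finite (E \<rightarrow>\<^sub>E {-1, 0, 1 :: int})" using finE by (intro finite_PiE) auto
  then show "finite (labelings N r)" using bij_betw_finite[OF bij] by simp
qed

text \<open>
  A rooted map with one face has a single representative, as its face can be identified with the
  reference face in only one way that respects the root.
\<close>

lemma num_labeled_trees_eq: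
  assumes "n > 0"
  shows "num_labeled_trees n = 3 ^ n * catalan n"
proof -
  let ?S = "labeled_trees n" and ?X = "block_gluings (2 * n) 1"
  let ?N = "block_map (2 * n) 1"
  let ?L = "\<lambda>h. labelings (?N h) 0"
  let ?F = "\<lambda>p. (?N (fst p), 0 :: nat, snd p)"
  let ?R = "labeled_iso \<inter> ?S \<times> ?S"
  have S: "(M, r, l) \<in> ?S \<longleftrightarrow> face_regular_map (2 * n) 1 M \<and> r \<in> darts M \<and>
      (\<forall>d\<in>darts M. \<bar>l (vertex_of M d) - l (vertex_of M (opp M d))\<bar> \<le> 1) \<and> l (vertex_of M r) = 1" for M r l
    unfolding tree_regular[symmetric] by (auto simp: labeled_trees_def)
  have n2: "0 < 2 * n" using assms by simp
  have reg: "face_regular_map (2 * n) 1 (?N h)" if "h \<in> ?X" for h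
    by (rule block_map_regular[OF n2 zero_less_one that])
  have zero: "0 \<in> darts (?N h)" for h using assms by simp
  have L: "card (?L h) = 3 ^ n" "finite (?L h)" if h: "h \<in> ?X" for h
  proof -
    have t: "planar_map (?N h)" "card (faces (?N h)) = 1" "card (edges (?N h)) = n"
      using reg[OF h] unfolding tree_regular[symmetric] by blast+
    show "card (?L h) = 3 ^ n" "finite (?L h)"
      using card_labelings[OF t(1,2) zero] t(3) by simp_all
  qed
  have F: "?F p \<in> ?S" if "p \<in> Sigma ?X ?L" for p
  proof -
    have p: "fst p \<in> ?X" "snd p \<in> ?L (fst p)" using that by auto
    show ?thesis unfolding S using reg[OF p(1)] zero p(2) unfolding labelings_def by blast
  qed
  have "card (Sigma ?X ?L) = 1 * card (?S // ?R)"
  proof (rule card_quotient_fibers[OF equiv_labeled_iso])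
    show "finite (Sigma ?X ?L)" using finite_block_gluings L(2) by (rule finite_SigmaI)
    show "?F ` Sigma ?X ?L \<subseteq> ?S" using F by blast
    fix s assume s: "s \<in> ?S"
    obtain M r m where Mr: "s = (M, r, m)" by (metis prod_cases3)
    have M: "face_regular_map (2 * n) 1 M" "r \<in> darts M"
      and m: "\<forall>d\<in>darts M. \<bar>m (vertex_of M d) - m (vertex_of M (opp M d))\<bar> \<le> 1" "m (vertex_of M r) = 1"
      using s unfolding Mr S by blast+
    have eq: "{p \<in> Sigma ?X ?L. (?F p, s) \<in> ?R} = {p \<in> Sigma ?X ?L.
        (\<exists>g. cmap_iso g (?N (fst p)) M \<and> g 0 = r \<and> (\<forall>v\<in>vertices (?N (fst p)). m (g ` v) = snd p v))}"
      using F s unfolding Mr by (auto simp: labeled_iso_def)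
    have "card {p \<in> Sigma ?X ?L. (\<exists>g. cmap_iso g (?N (fst p)) M \<and> g 0 = r \<and>
          (\<forall>v\<in>vertices (?N (fst p)). m (g ` v) = snd p v))} =
        card {h \<in> ?X. \<exists>g. cmap_iso g (?N h) M \<and> g 0 = r}"
    proof (rule card_Sigma_unique)
      fix h assume h: "h \<in> ?X" and ex: "\<exists>g. cmap_iso g (?N h) M \<and> g 0 = r"
      have N: "cmap (?N h)" using reg[OF h] by (simp add: face_regular_map_def planar_map_def)
      obtain g where g: "cmap_iso g (?N h) M" "g 0 = r" using ex by blast
      have opp_in: "opp (?N h) d \<in> darts (?N h)" if "d \<in> darts (?N h)" for d
        using cmap_matching[OF N] that unfolding matching_def by blast
      have gv: "g ` vertex_of (?N h) d = vertex_of M (g d)" if "d \<in> darts (?N h)" for d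
        using vertex_of_iso[OF N g(1) that] .
      have gd: "g d \<in> darts M" "g (opp (?N h) d) = opp M (g d)" if "d \<in> darts (?N h)" for d
        using g(1) that by (auto simp: cmap_iso_def bij_betw_def)
      have vin: "vertex_of (?N h) d \<in> vertices (?N h)" if "d \<in> darts (?N h)" for d
        using that unfolding vertices_def by blast
      define l where "l = (\<lambda>v\<in>vertices (?N h). m (g ` v))"
      have lv: "l (vertex_of (?N h) d) = m (vertex_of M (g d))" if "d \<in> darts (?N h)" for d
        unfolding l_def using vin[OF that] gv[OF that] by simp
      have "l \<in> ?L h"
        unfolding labelings_def
      proof (intro CollectI conjI ballI)
        show "l \<in> extensional (vertices (?N h))" by (simp add: l_def)
        show "l (vertex_of (?N h) 0) = 1" unfolding lv[OF zero] g(2) by (rule m(2))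
        fix d assume d: "d \<in> darts (?N h)"
        show "\<bar>l (vertex_of (?N h) d) - l (vertex_of (?N h) (opp (?N h) d))\<bar> \<le> 1"
          unfolding lv[OF d] lv[OF opp_in[OF d]] gd(2)[OF d] using m(1) gd(1)[OF d] by blast
      qed
      show "\<exists>!l. l \<in> ?L h \<and> (\<exists>g. cmap_iso g (?N h) M \<and> g 0 = r \<and> (\<forall>v\<in>vertices (?N h). m (g ` v) = l v))"
      proof (rule ex1I[of _ l])
        have "\<forall>v\<in>vertices (?N h). m (g ` v) = l v" by (simp add: l_def)
        then show "l \<in> ?L h \<and> (\<exists>g. cmap_iso g (?N h) M \<and> g 0 = r \<and> (\<forall>v\<in>vertices (?N h). m (g ` v) = l v))"
          using \<open>l \<in> ?L h\<close> g by blast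
        fix l' assume "l' \<in> ?L h \<and> (\<exists>g. cmap_iso g (?N h) M \<and> g 0 = r \<and> (\<forall>v\<in>vertices (?N h). m (g ` v) = l' v))"
        then obtain g' where l': "l' \<in> ?L h" and g': "cmap_iso g' (?N h) M" "g' 0 = r"
          "\<forall>v\<in>vertices (?N h). m (g' ` v) = l' v" by blast
        have same0: "g 0 = g' 0" using g(2) g'(2) by simp
        show "l' = l"
        proof (rule extensionalityI[of _ "vertices (?N h)"])
          show "l' \<in> extensional (vertices (?N h))" using l' by (simp add: labelings_def)
          show "l \<in> extensional (vertices (?N h))" by (simp add: l_def)
          fix v assume v: "v \<in> vertices (?N h)"
          then have "v \<subseteq> darts (?N h)" using vertex_of_subset[OF N] unfolding vertices_def by blast
          then have "g x = g' x" if "x \<in> v" for x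
            using cmap_iso_unique[OF N g(1) g'(1) zero same0] that by blast
          then have "g ` v = g' ` v" by (rule image_cong[OF refl])
          then show "l' v = l v" using g'(3) v by (simp add: l_def)
        qed
      qed
    qed blast
    also have "\<dots> = fact (1 - 1) * (2 * n) ^ (1 - 1)" by (rule card_gluings_iso[OF n2 zero_less_one M])
    also have "\<dots> = 1" by simp
    finally show "card {p \<in> Sigma ?X ?L. (?F p, s) \<in> ?R} = 1" unfolding eq .
  qed simp
  moreover have "card (Sigma ?X ?L) = (\<Sum>h\<in>?X. card (?L h))"
    by (rule card_SigmaI[OF finite_block_gluings]) (rule ballI, rule L(2))
  moreover have "(\<Sum>h\<in>?X. card (?L h)) = (\<Sum>h\<in>?X. 3 ^ n)" by (rule sum.cong[OF refl]) (rule L(1))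
  ultimately have "card (?S // ?R) = card ?X * 3 ^ n" by simp
  moreover have "card ?X = fact (1 - 1) * 4 ^ (1 - 1) * disk_count (2 * n) (1 - 1)"
    using n2 by (intro card_block_gluings) simp_all
  then have "card ?X = catalan n" using disk_count_trees[of n] by simp
  ultimately have "card (?S // ?R) = 3 ^ n * catalan n" by (simp only: mult.commute)
  then show ?thesis using assms by (simp add: num_labeled_trees_def)
qed


section \<open>The formula for quadrangulations\<close>

lemma num_rooted_pointed_quads_formula:
  "real (num_rooted_pointed_quads n) = 2 * (3 ^ n * real (catalan n))"
proof (cases "n = 0")
  case True
  then show ?thesis by (simp add: num_rooted_pointed_quads_def)
next
  case False
  then show ?thesis
    using disk_count_quads[of n] by (simp add: num_rooted_pointed_quads_eq field_simps)
qed

lemma num_rooted_quads_formula: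
  "real (num_rooted_quads n) = real (num_rooted_pointed_quads n) / (real n + 2)"
proof (cases "n = 0")
  case True
  then show ?thesis by (simp add: num_rooted_pointed_quads_def num_rooted_quads_def)
next
  case False
  then show ?thesis
    by (simp add: num_rooted_pointed_quads_eq num_rooted_quads_eq field_simps)
qed

theorem corollary4:
  shows "Q_pointed = 2 * T_series \<and>
    (\<forall>n::nat.
       real (num_rooted_quads n) = real (num_rooted_pointed_quads n) / (real n + 2) \<and>
       real (num_rooted_pointed_quads n) / (real n + 2) =
         2 / (real n + 2) * (3 ^ n / (real n + 1) * real ((2 * n) choose n)))"
proof (intro conjI allI)
  show "Q_pointed = 2 * T_series"
  proof (rule fps_ext)
    fix n
    have "num_labeled_trees n = 3 ^ n * catalan n"
      using num_labeled_trees_eq[of n] by (cases "n = 0") (simp_all add: num_labeled_trees_def)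
    then show "fps_nth Q_pointed n = fps_nth (2 * T_series) n"
      by (simp add: Q_pointed_def T_series_def num_rooted_pointed_quads_formula numeral_fps_const)
  qed
  fix n :: nat
  show "real (num_rooted_quads n) = real (num_rooted_pointed_quads n) / (real n + 2)"
    by (rule num_rooted_quads_formula)
  show "real (num_rooted_pointed_quads n) / (real n + 2) =
      2 / (real n + 2) * (3 ^ n / (real n + 1) * real ((2 * n) choose n))"
    unfolding num_rooted_pointed_quads_formula catalan_binomial by simp
qed

end
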